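(* Let $(M,\Omega)$ be a locally homogeneous multisymplectic manifold and let $G(M,\Omega)$ be the group of diffeomorphisms $\phi\colon M\to M$ with $\phi^*\Omega=\Omega$. Then $G(M,\Omega)$ is strongly locally transitive on $M$.
   Context: All manifolds are real, paracompact, connected and $C^\infty$; $\dim M=n$. A multisymplectic manifold of degree $k\ge 2$ is a pair $(M,\Omega)$ where $\Omega$ is a closed $k$-form on $M$ that is $1$-nondegenerate, i.e. for every $x\in M$ the map $T_xM\to\Lambda^{k-1}(T_x^*M)$, $v\mapsto i(v)\Omega_x$, is injective. A group $G$ of diffeomorphisms of $M$ is strongly locally transitive on $M$ if for each $x\in M$ and each neighborhood $U$ of $x$ there are neighborhoods $V$ and $W$ of $x$ with $\bar V\subset W\subset\bar W\subset U$ and $\bar W$ compact, such that for any $y\in V$ there is a smooth isotopy $\phi_t$ in $G$ with $\phi_0=\mathrm{id}$, $\phi_1(x)=y$, and $\phi_t$ leaves every point outside $\bar W$ fixed for all $t$. Local Euler-like vector field: let $x\in M$ and let $K$ be a compact set with $x$ in the interior of $K$. A local Euler-like vector field at $x$ with respect to $K$ is a vector field $\Delta^x$ on $M$ such that $\operatorname{supp}\Delta^x=\overline{\{y\in M: \Delta^x(y)\neq 0\}}\subset K$, and such that there is a diffeomorphism $\varphi$ from the interior of $\operatorname{supp}\Delta^x$ onto $\mathbb{R}^n$ with $\varphi(x)=0$ and $\varphi_*\Delta^x=x^i\,\partial/\partial x^i$ (the standard dilation vector field on $\mathbb{R}^n$). Locally homogeneous: a differential form $\Omega$ on $M$ is locally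 homogeneous at $x\in M$ if for every open set $U$ containing $x$ there exist a compact set $K\subset U$ and a local Euler-like vector field $\Delta^x$ at $x$ with respect to $K$ such that $L(\Delta^x)\Omega=f\,\Omega$ on $U$ for some $f\in C^\infty(U)$. $\Omega$ is locally homogeneous if this holds at every $x\in M$. A locally homogeneous multisymplectic manifold is a multisymplectic manifold $(M,\Omega)$ with $\Omega$ locally homogeneous. *)

theory Defs
  imports "HOL-Analysis.Analysis"
begin

section \<open>Smooth functions between normed spaces\<close>

text \<open>The definition is meant for open \<open>S\<close>; all uses below are on open sets.\<close>

primrec Ck_on :: "nat \<Rightarrow> 'a::real_normed_vector set \<Rightarrow> ('a \<Rightarrow> 'b::real_normed_vector) \<Rightarrow> bool" where
  "Ck_on 0 S f \<longleftrightarrow> continuous_on S f"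
| "Ck_on (Suc r) S f \<longleftrightarrow>
     (\<forall>x\<in>S. f differentiable (at x)) \<and> (\<forall>v. Ck_on r S (\<lambda>x. frechet_derivative f (at x) v))"

definition smooth_on :: "'a::real_normed_vector set \<Rightarrow> ('a \<Rightarrow> 'b::real_normed_vector) \<Rightarrow> bool" where
  "smooth_on S f \<longleftrightarrow> (\<forall>r. Ck_on r S f)"


section \<open>Smooth manifolds\<close>

text \<open>A manifold is a topological type \<open>'m\<close> with an atlas of charts into \<open>real ^ 'n\<close>, so
  \<open>n = CARD('n)\<close>.  A chart is a pair of its domain and its coordinate map; the values of the
  coordinate map outside the domain are irrelevant.  The atlas need not be maximal.\<close>

type_synonym ('m, 'n) chart = "'m set \<times> ('m \<Rightarrow> real ^ 'n)"

type_synonym ('m, 'n) atlas = "('m, 'n) chart set"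

definition chart_inv :: "('m, 'n::finite) chart \<Rightarrow> real ^ 'n \<Rightarrow> 'm" where
  "chart_inv c = inv_into (fst c) (snd c)"

definition is_chart :: "('m::topological_space, 'n::finite) chart \<Rightarrow> bool" where
  "is_chart c \<longleftrightarrow> open (fst c) \<and> open (snd c ` fst c) \<and>
     homeomorphism (fst c) (snd c ` fst c) (snd c) (chart_inv c)"

definition smooth_atlas :: "('m::topological_space, 'n::finite) atlas \<Rightarrow> bool" where
  "smooth_atlas A \<longleftrightarrow> (\<forall>c\<in>A. is_chart c) \<and> (\<Union>c\<in>A. fst c) = UNIV \<and>
     (\<forall>c\<in>A. \<forall>c'\<in>A. smooth_on (snd c ` (fst c \<inter> fst c')) (snd c' \<circ> chart_inv c))"

definition paracompact_type :: "'m::topological_space itself \<Rightarrow> bool" where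
  "paracompact_type (_ :: 'm itself) \<longleftrightarrow>
     (\<forall>\<U> :: 'm set set. (\<forall>U\<in>\<U>. open U) \<and> \<Union>\<U> = UNIV \<longrightarrow>
        (\<exists>\<V>. (\<forall>V\<in>\<V>. open V \<and> (\<exists>U\<in>\<U>. V \<subseteq> U)) \<and> \<Union>\<V> = UNIV \<and> locally_finite_in euclidean \<V>))"

definition smooth_manifold :: "('m::t2_space, 'n::finite) atlas \<Rightarrow> bool" where
  "smooth_manifold A \<longleftrightarrow> smooth_atlas A \<and> paracompact_type TYPE('m) \<and> connected (UNIV :: 'm set)"

definition std_chart :: "(real ^ 'n, 'n::finite) chart" where
  "std_chart = (UNIV, id)"

definition std_atlas :: "(real ^ 'n, 'n::finite) atlas" where
  "std_atlas = {std_chart}"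


section \<open>Smooth maps and diffeomorphisms\<close>

definition smooth_fun :: "('m::topological_space, 'n::finite) atlas \<Rightarrow> 'm set \<Rightarrow> ('m \<Rightarrow> real) \<Rightarrow> bool" where
  "smooth_fun A S f \<longleftrightarrow> (\<forall>c\<in>A. smooth_on (snd c ` (S \<inter> fst c)) (f \<circ> chart_inv c))"

definition smooth_map :: "('m::topological_space, 'n::finite) atlas \<Rightarrow> 'm set \<Rightarrow>
    ('m2::topological_space, 'n2::finite) atlas \<Rightarrow> ('m \<Rightarrow> 'm2) \<Rightarrow> bool" where
  "smooth_map A S B \<phi> \<longleftrightarrow> continuous_on S \<phi> \<and>
     (\<forall>c\<in>A. \<forall>c'\<in>B. smooth_on (snd c ` (S \<inter> fst c \<inter> \<phi> -` fst c')) (snd c' \<circ> \<phi> \<circ> chart_inv c))"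

text \<open>\<open>diffeo A S B T \<phi>\<close>: \<open>\<phi>\<close> restricts to a diffeomorphism of the open submanifold \<open>S\<close> onto the
  open submanifold \<open>T\<close>.\<close>

definition diffeo :: "('m::topological_space, 'n::finite) atlas \<Rightarrow> 'm set \<Rightarrow>
    ('m2::topological_space, 'n2::finite) atlas \<Rightarrow> 'm2 set \<Rightarrow> ('m \<Rightarrow> 'm2) \<Rightarrow> bool" where
  "diffeo A S B T \<phi> \<longleftrightarrow> open S \<and> open T \<and> bij_betw \<phi> S T \<and>
     smooth_map A S B \<phi> \<and> smooth_map B T A (inv_into S \<phi>)"


section \<open>Tangent vectors\<close>

text \<open>A tangent vector at \<open>p\<close> assigns to every chart of the atlas around \<open>p\<close> a component vector,
  and the components in two charts are related by the Jacobian of the transition map.  The value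
  \<open>0\<close> on all other pairs makes the representation unique.  Linear combinations are
  taken pointwise.\<close>

type_synonym ('m, 'n) tvector = "('m, 'n) chart \<Rightarrow> real ^ 'n"

definition tangent_space :: "('m, 'n::finite) atlas \<Rightarrow> 'm \<Rightarrow> ('m, 'n) tvector set" where
  "tangent_space A p = {v.
     (\<forall>c\<in>A. \<forall>c'\<in>A. p \<in> fst c \<longrightarrow> p \<in> fst c' \<longrightarrow>
        v c' = frechet_derivative (snd c' \<circ> chart_inv c) (at (snd c p)) (v c)) \<and>
     (\<forall>c. \<not> (c \<in> A \<and> p \<in> fst c) \<longrightarrow> v c = 0)}"

text \<open>The tangent vector at \<open>p\<close> whose component in the chart \<open>c\<close> is \<open>u\<close>.\<close>

definition tvec :: "('m, 'n::finite) atlas \<Rightarrow> ('m, 'n) chart \<Rightarrow> 'm \<Rightarrow> real ^ 'n \<Rightarrow> ('m, 'n) tvector" where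
  "tvec A c p u = (\<lambda>c'. if c' \<in> A \<and> p \<in> fst c'
     then frechet_derivative (snd c' \<circ> chart_inv c) (at (snd c p)) u else 0)"

definition chart_at :: "('m, 'n::finite) atlas \<Rightarrow> 'm \<Rightarrow> ('m, 'n) chart" where
  "chart_at A p = (SOME c. c \<in> A \<and> p \<in> fst c)"

text \<open>The differential \<open>T\<^sub>p \<phi>\<close>.  On tangent vectors it does not depend on the chosen chart around
  \<open>p\<close>; see lemma \<open>tangent_map_eq\<close> below.\<close>

definition tangent_map :: "('m, 'n::finite) atlas \<Rightarrow> ('m2, 'n2::finite) atlas \<Rightarrow> ('m \<Rightarrow> 'm2) \<Rightarrow> 'm \<Rightarrow>
    ('m, 'n) tvector \<Rightarrow> ('m2, 'n2) tvector" where
  "tangent_map A B \<phi> p v = (\<lambda>c'. if c' \<in> B \<and> \<phi> p \<in> fst c'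
     then let c = chart_at A p
          in frechet_derivative (snd c' \<circ> \<phi> \<circ> chart_inv c) (at (snd c p)) (v c)
     else 0)"

definition vector_field :: "('m::topological_space, 'n::finite) atlas \<Rightarrow> ('m \<Rightarrow> ('m, 'n) tvector) \<Rightarrow> bool" where
  "vector_field A X \<longleftrightarrow> (\<forall>p. X p \<in> tangent_space A p) \<and>
     (\<forall>c\<in>A. smooth_on (snd c ` fst c) (\<lambda>z. X (chart_inv c z) c))"

definition support :: "('m::topological_space \<Rightarrow> ('m, 'n::finite) tvector) \<Rightarrow> 'm set" where
  "support X = closure {p. X p \<noteq> (\<lambda>_. 0)}"

definition dilation_field :: "real ^ 'n::finite \<Rightarrow> (real ^ 'n, 'n) tvector" where
  "dilation_field z = tvec std_atlas std_chart z z"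


section \<open>Differential forms\<close>

text \<open>The value of a \<open>k\<close>-form at \<open>p\<close> is a function of lists of \<open>k\<close> tangent vectors at \<open>p\<close>; its
  values on other lists are irrelevant, and two \<open>k\<close>-forms are equal if they agree on
  \<open>tuples A p k\<close> for all \<open>p\<close>.\<close>

type_synonym ('m, 'n) dform = "'m \<Rightarrow> ('m, 'n) tvector list \<Rightarrow> real"

definition tuples :: "('m, 'n::finite) atlas \<Rightarrow> 'm \<Rightarrow> nat \<Rightarrow> ('m, 'n) tvector list set" where
  "tuples A p k = {vs. length vs = k \<and> set vs \<subseteq> tangent_space A p}"

definition alternating_form :: "('m, 'n::finite) atlas \<Rightarrow> nat \<Rightarrow> 'm \<Rightarrow> (('m, 'n) tvector list \<Rightarrow> real) \<Rightarrow> bool" where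
  "alternating_form A k p \<omega> \<longleftrightarrow>
     (\<forall>vs\<in>tuples A p k. \<forall>i<k. \<forall>u\<in>tangent_space A p. \<forall>w\<in>tangent_space A p. \<forall>a b.
        \<omega> (vs[i := (\<lambda>c. a *\<^sub>R u c + b *\<^sub>R w c)]) = a * \<omega> (vs[i := u]) + b * \<omega> (vs[i := w])) \<and>
     (\<forall>vs\<in>tuples A p k. \<not> distinct vs \<longrightarrow> \<omega> vs = 0)"

text \<open>The representative of a form in the chart \<open>c\<close>, a form on \<open>snd c ` fst c\<close>.\<close>

definition local_rep :: "('m, 'n::finite) atlas \<Rightarrow> ('m, 'n) chart \<Rightarrow> ('m, 'n) dform \<Rightarrow>
    real ^ 'n \<Rightarrow> (real ^ 'n) list \<Rightarrow> real" where
  "local_rep A c \<omega> z us = \<omega> (chart_inv c z) (map (tvec A c (chart_inv c z)) us)"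

definition differential_form :: "('m::topological_space, 'n::finite) atlas \<Rightarrow> nat \<Rightarrow> ('m, 'n) dform \<Rightarrow> bool" where
  "differential_form A k \<omega> \<longleftrightarrow> (\<forall>p. alternating_form A k p (\<omega> p)) \<and>
     (\<forall>c\<in>A. \<forall>us. length us = k \<longrightarrow> smooth_on (snd c ` fst c) (\<lambda>z. local_rep A c \<omega> z us))"

definition interior_product :: "('m \<Rightarrow> ('m, 'n::finite) tvector) \<Rightarrow> ('m, 'n) dform \<Rightarrow> ('m, 'n) dform" where
  "interior_product X \<omega> = (\<lambda>p vs. \<omega> p (X p # vs))"

text \<open>The exterior derivative, computed in the chart \<open>c\<close> around \<open>p\<close> by extending the arguments to
  fields with constant components:
  \<open>d\<omega>(v\<^sub>0,\<dots>,v\<^sub>k) = (\<Sum>i\<le>k. (-1)^i D(\<omega>(v\<^sub>0,\<dots>,v\<^sub>i omitted,\<dots>,v\<^sub>k)) v\<^sub>i)\<close>.\<close>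

definition ext_deriv :: "('m, 'n::finite) atlas \<Rightarrow> ('m, 'n) chart \<Rightarrow> ('m, 'n) dform \<Rightarrow> ('m, 'n) dform" where
  "ext_deriv A c \<omega> = (\<lambda>p vs. let us = map (\<lambda>v. v c) vs in
     \<Sum>i<length us. (-1) ^ i *
       frechet_derivative (\<lambda>z. local_rep A c \<omega> z (take i us @ drop (Suc i) us)) (at (snd c p)) (us ! i))"

definition closed_form :: "('m, 'n::finite) atlas \<Rightarrow> nat \<Rightarrow> ('m, 'n) dform \<Rightarrow> bool" where
  "closed_form A k \<omega> \<longleftrightarrow> (\<forall>c\<in>A. \<forall>p\<in>fst c. \<forall>vs\<in>tuples A p (Suc k). ext_deriv A c \<omega> p vs = 0)"

text \<open>The Lie derivative \<open>L(X) = d i(X) + i(X) d\<close> of forms of positive degree, with \<open>d\<close> computed in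
  the chart \<open>c\<close>.\<close>

definition lie_deriv :: "('m, 'n::finite) atlas \<Rightarrow> ('m, 'n) chart \<Rightarrow> ('m \<Rightarrow> ('m, 'n) tvector) \<Rightarrow>
    ('m, 'n) dform \<Rightarrow> ('m, 'n) dform" where
  "lie_deriv A c X \<omega> = (\<lambda>p vs.
     ext_deriv A c (interior_product X \<omega>) p vs + interior_product X (ext_deriv A c \<omega>) p vs)"

definition pullback :: "('m, 'n::finite) atlas \<Rightarrow> ('m2, 'n2::finite) atlas \<Rightarrow> ('m \<Rightarrow> 'm2) \<Rightarrow>
    ('m2, 'n2) dform \<Rightarrow> ('m, 'n) dform" where
  "pullback A B \<phi> \<omega> = (\<lambda>p vs. \<omega> (\<phi> p) (map (tangent_map A B \<phi> p) vs))"


section \<open>Multisymplectic manifolds and local homogeneity\<close>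

definition one_nondegenerate :: "('m, 'n::finite) atlas \<Rightarrow> nat \<Rightarrow> ('m, 'n) dform \<Rightarrow> bool" where
  "one_nondegenerate A k \<Omega> \<longleftrightarrow>
     (\<forall>p. inj_on (\<lambda>v. \<lambda>vs\<in>tuples A p (k - 1). \<Omega> p (v # vs)) (tangent_space A p))"

definition multisymplectic :: "('m::t2_space, 'n::finite) atlas \<Rightarrow> nat \<Rightarrow> ('m, 'n) dform \<Rightarrow> bool" where
  "multisymplectic A k \<Omega> \<longleftrightarrow> smooth_manifold A \<and> k \<ge> 2 \<and> differential_form A k \<Omega> \<and>
     closed_form A k \<Omega> \<and> one_nondegenerate A k \<Omega>"

definition local_euler_like :: "('m::topological_space, 'n::finite) atlas \<Rightarrow> 'm \<Rightarrow> 'm set \<Rightarrow>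
    ('m \<Rightarrow> ('m, 'n) tvector) \<Rightarrow> bool" where
  "local_euler_like A x K \<Delta> \<longleftrightarrow> compact K \<and> x \<in> interior K \<and>
     vector_field A \<Delta> \<and> support \<Delta> \<subseteq> K \<and>
     (\<exists>\<phi> :: 'm \<Rightarrow> real ^ 'n.
        diffeo A (interior (support \<Delta>)) std_atlas UNIV \<phi> \<and>
        x \<in> interior (support \<Delta>) \<and> \<phi> x = 0 \<and>
        (\<forall>y\<in>interior (support \<Delta>). tangent_map A std_atlas \<phi> y (\<Delta> y) = dilation_field (\<phi> y)))"

definition locally_homogeneous_at :: "('m::topological_space, 'n::finite) atlas \<Rightarrow> nat \<Rightarrow> ('m, 'n) dform \<Rightarrow> 'm \<Rightarrow> bool" where
  "locally_homogeneous_at A k \<Omega> x \<longleftrightarrow>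
     (\<forall>U. open U \<and> x \<in> U \<longrightarrow>
        (\<exists>K \<Delta> f. K \<subseteq> U \<and> local_euler_like A x K \<Delta> \<and> smooth_fun A U f \<and>
           (\<forall>c\<in>A. \<forall>p\<in>U \<inter> fst c. \<forall>vs\<in>tuples A p k.
              lie_deriv A c \<Delta> \<Omega> p vs = f p * \<Omega> p vs)))"

definition locally_homogeneous :: "('m::topological_space, 'n::finite) atlas \<Rightarrow> nat \<Rightarrow> ('m, 'n) dform \<Rightarrow> bool" where
  "locally_homogeneous A k \<Omega> \<longleftrightarrow> (\<forall>x. locally_homogeneous_at A k \<Omega> x)"


section \<open>Groups of diffeomorphisms\<close>

definition automorphisms :: "('m::topological_space, 'n::finite) atlas \<Rightarrow> nat \<Rightarrow> ('m, 'n) dform \<Rightarrow> ('m \<Rightarrow> 'm) set" where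
  "automorphisms A k \<Omega> = {\<phi>. diffeo A UNIV A UNIV \<phi> \<and>
     (\<forall>p. \<forall>vs\<in>tuples A p k. pullback A A \<phi> \<Omega> p vs = \<Omega> p vs)}"

text \<open>Joint smoothness of \<open>(t, q) \<mapsto> \<phi> t q\<close> on \<open>[0,1] \<times> M\<close>.  Since \<open>[0,1]\<close> has boundary, smoothness at
  a point means, as usual, that a coordinate expression of the map extends near that point to a
  smooth map on an open set.\<close>

definition smooth_isotopy :: "('m::topological_space, 'n::finite) atlas \<Rightarrow> (real \<Rightarrow> 'm \<Rightarrow> 'm) \<Rightarrow> bool" where
  "smooth_isotopy A \<phi> \<longleftrightarrow>
     (\<forall>t\<in>{0..1}. diffeo A UNIV A UNIV (\<phi> t)) \<and>
     (\<forall>c\<in>A. \<forall>c'\<in>A. \<forall>t\<in>{0..1}. \<forall>p\<in>fst c. \<phi> t p \<in> fst c' \<longrightarrow>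
        (\<exists>N g. open N \<and> (t, snd c p) \<in> N \<and> smooth_on N g \<and>
           (\<forall>s\<in>{0..1}. \<forall>q\<in>fst c. (s, snd c q) \<in> N \<longrightarrow>
              \<phi> s q \<in> fst c' \<and> snd c' (\<phi> s q) = g (s, snd c q))))"

text \<open>Neighborhoods are taken to be open.\<close>

definition strongly_locally_transitive :: "('m::topological_space, 'n::finite) atlas \<Rightarrow> ('m \<Rightarrow> 'm) set \<Rightarrow> bool" where
  "strongly_locally_transitive A G \<longleftrightarrow>
     (\<forall>x U. open U \<and> x \<in> U \<longrightarrow>
        (\<exists>V W. open V \<and> x \<in> V \<and> open W \<and> x \<in> W \<and>
           closure V \<subseteq> W \<and> closure W \<subseteq> U \<and> compact (closure W) \<and>
           (\<forall>y\<in>V. \<exists>\<phi>. smooth_isotopy A \<phi> \<and> (\<forall>t\<in>{0..1}. \<phi> t \<in> G) \<and>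
              \<phi> 0 = id \<and> \<phi> 1 x = y \<and> (\<forall>t\<in>{0..1}. \<forall>z. z \<notin> closure W \<longrightarrow> \<phi> t z = z))))"

section \<open>Consistency of the chart-based definitions\<close>

lemma smooth_on_differentiable: "smooth_on S f \<Longrightarrow> x \<in> S \<Longrightarrow> f differentiable (at x)"
  unfolding smooth_on_def by (metis Ck_on.simps(2))

lemma chart_inv_chart: "is_chart c \<Longrightarrow> p \<in> fst c \<Longrightarrow> chart_inv c (snd c p) = p"
  unfolding is_chart_def homeomorphism_def by blast

lemma chart_image_open:
  assumes "is_chart c" "open S"
  shows "open (snd c ` (S \<inter> fst c))"
proof -
  have h: "homeomorphism (fst c) (snd c ` fst c) (snd c) (chart_inv c)"
    and o: "open (fst c)" "open (snd c ` fst c)"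
    using assms by (auto simp: is_chart_def)
  have "openin (top_of_set (fst c)) (S \<inter> fst c)"
    using assms(2) openin_open_Int[of S "fst c"] by (simp add: Int_commute)
  then have "openin (top_of_set (snd c ` fst c)) (snd c ` (S \<inter> fst c))"
    using homeomorphism_imp_open_map[OF h] by blast
  then show ?thesis using o(2) openin_open_eq by blast
qed

lemma derivative_chart_change:
  assumes "smooth_atlas A" "c0 \<in> A" "c \<in> A" "p \<in> fst c0" "p \<in> fst c"
    and F: "(F \<circ> chart_inv c) differentiable (at (snd c p))"
  shows "frechet_derivative (F \<circ> chart_inv c0) (at (snd c0 p)) u =
    frechet_derivative (F \<circ> chart_inv c) (at (snd c p))
      (frechet_derivative (snd c \<circ> chart_inv c0) (at (snd c0 p)) u)"
proof -
  have ch: "is_chart c" "is_chart c0" using assms by (auto simp: smooth_atlas_def)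
  let ?T = "snd c \<circ> chart_inv c0" and ?G = "F \<circ> chart_inv c" and ?z = "snd c0 p"
  let ?N = "snd c0 ` (fst c \<inter> fst c0)"
  have oN: "open ?N" using chart_image_open[OF ch(2)] ch(1) by (auto simp: is_chart_def)
  have zN: "?z \<in> ?N" using assms by blast
  have "smooth_on (snd c0 ` (fst c0 \<inter> fst c)) ?T"
    using assms by (auto simp: smooth_atlas_def)
  then have T: "?T differentiable (at ?z)"
    using zN by (auto simp: Int_commute intro: smooth_on_differentiable)
  have Tz: "?T ?z = snd c p" using chart_inv_chart[OF ch(2)] assms by simp
  have dT: "(?T has_derivative frechet_derivative ?T (at ?z)) (at ?z)"
    using T by (simp add: frechet_derivative_works)
  have dG: "(?G has_derivative frechet_derivative ?G (at (snd c p))) (at (?T ?z))"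
    unfolding Tz using F by (simp add: frechet_derivative_works)
  have d: "((?G \<circ> ?T) has_derivative
      (frechet_derivative ?G (at (snd c p)) \<circ> frechet_derivative ?T (at ?z))) (at ?z)"
    by (rule diff_chain_at[OF dT dG])
  have eq: "(?G \<circ> ?T) w = (F \<circ> chart_inv c0) w" if "w \<in> ?N" for w
    using that chart_inv_chart[OF ch(1)] chart_inv_chart[OF ch(2)] by auto
  have "((F \<circ> chart_inv c0) has_derivative
      (frechet_derivative ?G (at (snd c p)) \<circ> frechet_derivative ?T (at ?z))) (at ?z)"
    by (rule has_derivative_transform_within_open[OF d oN zN eq])
  from frechet_derivative_at[OF this, symmetric] show ?thesis by simp
qed

lemma transition_differentiable:
  assumes "smooth_atlas A" "c \<in> A" "c' \<in> A" "p \<in> fst c" "p \<in> fst c'"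
  shows "(snd c' \<circ> chart_inv c) differentiable (at (snd c p))"
proof -
  have "smooth_on (snd c ` (fst c \<inter> fst c')) (snd c' \<circ> chart_inv c)"
    using assms by (simp add: smooth_atlas_def)
  then show ?thesis using assms by (auto intro: smooth_on_differentiable)
qed

lemma tvec_self:
  assumes "smooth_atlas A" "c \<in> A" "p \<in> fst c"
  shows "tvec A c p u c = u"
proof -
  have ch: "is_chart c" using assms by (auto simp: smooth_atlas_def)
  have o: "open (snd c ` fst c)" using ch by (simp add: is_chart_def)
  have "((snd c \<circ> chart_inv c) has_derivative (\<lambda>x. x)) (at (snd c p))"
    by (rule has_derivative_transform_within_open[OF has_derivative_ident o])
      (use assms chart_inv_chart[OF ch] in auto)
  then have "frechet_derivative (snd c \<circ> chart_inv c) (at (snd c p)) = (\<lambda>x. x)"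
    by (rule frechet_derivative_at[symmetric])
  then show ?thesis using assms by (simp add: tvec_def)
qed

lemma tvec_in_tangent_space:
  assumes "smooth_atlas A" "c \<in> A" "p \<in> fst c"
  shows "tvec A c p u \<in> tangent_space A p"
  unfolding tangent_space_def
proof (intro CollectI conjI ballI allI impI)
  fix c1 c2 assume *: "c1 \<in> A" "c2 \<in> A" "p \<in> fst c1" "p \<in> fst c2"
  show "tvec A c p u c2 = frechet_derivative (snd c2 \<circ> chart_inv c1) (at (snd c1 p)) (tvec A c p u c1)"
    using derivative_chart_change[OF assms(1,2) *(1) assms(3) *(3)
        transition_differentiable[OF assms(1) *]] *
    by (simp add: tvec_def)
next
  fix c' assume "\<not> (c' \<in> A \<and> p \<in> fst c')"
  then show "tvec A c p u c' = 0" unfolding tvec_def by (rule if_not_P)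
qed

lemma tangent_space_change:
  assumes "v \<in> tangent_space A p" "c \<in> A" "c' \<in> A" "p \<in> fst c" "p \<in> fst c'"
  shows "v c' = frechet_derivative (snd c' \<circ> chart_inv c) (at (snd c p)) (v c)"
  using assms unfolding tangent_space_def by blast

lemma tangent_space_outside:
  "v \<in> tangent_space A p \<Longrightarrow> \<not> (c \<in> A \<and> p \<in> fst c) \<Longrightarrow> v c = 0"
  unfolding tangent_space_def by blast

lemma tvec_component:
  assumes "c \<in> A" "p \<in> fst c" "v \<in> tangent_space A p"
  shows "tvec A c p (v c) = v"
proof
  fix c'
  show "tvec A c p (v c) c' = v c'"
  proof (cases "c' \<in> A \<and> p \<in> fst c'")
    case True
    have "v c' = frechet_derivative (snd c' \<circ> chart_inv c) (at (snd c p)) (v c)"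
      using True assms by (intro tangent_space_change) auto
    then show ?thesis unfolding tvec_def if_P[OF True] by (rule sym)
  next
    case False
    from tangent_space_outside[OF assms(3) False] show ?thesis
      unfolding tvec_def if_not_P[OF False] by (rule sym)
  qed
qed

lemma tangent_map_eq:
  assumes A: "smooth_atlas A" and B: "smooth_atlas B"
    and S: "open S" "p \<in> S" and \<phi>: "smooth_map A S B \<phi>"
    and v: "v \<in> tangent_space A p"
    and c: "c \<in> A" "p \<in> fst c" and c': "c' \<in> B" "\<phi> p \<in> fst c'"
  shows "tangent_map A B \<phi> p v c' =
    frechet_derivative (snd c' \<circ> \<phi> \<circ> chart_inv c) (at (snd c p)) (v c)"
proof -
  let ?c0 = "chart_at A p"
  have c0: "?c0 \<in> A" "p \<in> fst ?c0"
    using someI[of "\<lambda>c. c \<in> A \<and> p \<in> fst c"] c by (auto simp: chart_at_def)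
  have "smooth_on (snd c ` (S \<inter> fst c \<inter> \<phi> -` fst c')) (snd c' \<circ> \<phi> \<circ> chart_inv c)"
    using \<phi> c c' by (auto simp: smooth_map_def)
  then have "(snd c' \<circ> \<phi> \<circ> chart_inv c) differentiable (at (snd c p))"
    using S c c' by (auto intro: smooth_on_differentiable)
  from derivative_chart_change[OF A c0(1) c(1) c0(2) c(2) this]
  have "frechet_derivative (snd c' \<circ> \<phi> \<circ> chart_inv ?c0) (at (snd ?c0 p)) (v ?c0) =
    frechet_derivative (snd c' \<circ> \<phi> \<circ> chart_inv c) (at (snd c p))
      (frechet_derivative (snd c \<circ> chart_inv ?c0) (at (snd ?c0 p)) (v ?c0))" .
  moreover have "frechet_derivative (snd c \<circ> chart_inv ?c0) (at (snd ?c0 p)) (v ?c0) = v c"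
    by (rule tangent_space_change[OF v c0(1) c(1) c0(2) c(2), symmetric])
  ultimately show ?thesis using c' by (simp add: tangent_map_def Let_def)
qed

end

theory Submission
  imports Defs
begin

text \<open>
  The hypothesis is much stronger than it looks: local homogeneity forces \<open>\<Omega>\<close> to be a volume form,
  \<open>k = dim M\<close> (\<open>locally_homogeneous_top_degree\<close>). For a volume form, strong local transitivity is
  elementary and can be shown by writing down volume preserving isotopies.

  Why \<open>k = n\<close>. Let \<open>\<Delta>\<close> be a local Euler-like field supported in one chart, with
  \<open>L(\<Delta>) \<Omega> = f \<Omega>\<close>. As \<open>\<Omega>\<close> is closed, \<open>f \<Omega> = d (i(\<Delta>) \<Omega>)\<close>, hence \<open>df \<and> \<Omega> = 0\<close>
  (\<open>differential_wedge_zero\<close>). In the linearising coordinates the field is \<open>x\<^sup>i \<partial>/\<partial>x\<^sup>i\<close>, and along each ray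
  through the origin all coefficients of \<open>\<Omega>\<close> satisfy the same equation \<open>s g' = (f - k) g\<close>; in particular
  \<open>f = k\<close> at the origin, and a coefficient vanishes everywhere on the ray or nowhere
  (\<open>singular_ode_zero_iff\<close>). If \<open>k < n\<close>, some vector \<open>v \<noteq> 0\<close> is annihilated by every covector \<open>\<alpha>\<close> with
  \<open>\<alpha> \<and> \<Omega> = 0\<close> at the origin, and then at all points of the ray through \<open>v\<close>; so \<open>df(v) = 0\<close> there and
  \<open>f = k\<close> on the whole ray (\<open>constant_factor_along_ray\<close>). But the ray accumulates at the frontier of the
  support of \<open>\<Delta>\<close>, where \<open>f = 0\<close> because \<open>f \<Omega> = 0\<close> outside the support. If \<open>k > n\<close>, then \<open>\<Omega> = 0\<close>,
  against nondegeneracy.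

  Why volume forms suffice. Replacing one coordinate by a primitive of the density gives coordinates
  near \<open>x\<close> in which \<open>\<Omega>\<close> is the standard volume form (\<open>straighten_density\<close>). For close points \<open>p\<close> and \<open>q\<close>
  of \<open>\<real>\<^sup>n\<close>, \<open>n \<ge> 2\<close>, rotate the spheres around their midpoint in a plane through both of them, by an angle
  that depends on the radius, is a half turn at \<open>p\<close> and \<open>q\<close> and vanishes for large radii. This is a volume
  preserving flow with compact support that moves \<open>p\<close> to \<open>q\<close> (\<open>volume_preserving_flow\<close>). Extended by the
  identity, it is the isotopy sought (\<open>transported_preserves_top_form\<close>).
\<close>


section \<open>Calculus of smooth maps\<close>

abbreviation fderiv :: "('a::real_normed_vector \<Rightarrow> 'b::real_normed_vector) \<Rightarrow> 'a \<Rightarrow> 'a \<Rightarrow> 'b" where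
  "fderiv f x \<equiv> frechet_derivative f (at x)"

lemma fderiv_eq: "(f has_derivative f') (at x) \<Longrightarrow> fderiv f x = f'"
  by (rule frechet_derivative_at[symmetric])

lemma fderiv_works: "f differentiable (at x) \<Longrightarrow> (f has_derivative fderiv f x) (at x)"
  by (simp add: frechet_derivative_works)

lemma differentiable_cong_open:
  assumes "open S" "x \<in> S" "\<And>y. y \<in> S \<Longrightarrow> f y = g y" "f differentiable (at x)"
  shows "g differentiable (at x)"
  using assms has_derivative_transform_within_open unfolding differentiable_def by metis

lemma fderiv_cong_open:
  assumes "open S" "x \<in> S" "\<And>y. y \<in> S \<Longrightarrow> f y = g y"
  shows "fderiv f x = fderiv g x"
proof -
  have "(f has_derivative D) (at x) \<longleftrightarrow> (g has_derivative D) (at x)" for D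
    using has_derivative_transform_within_open[of f D x UNIV S g]
      has_derivative_transform_within_open[of g D x UNIV S f] assms by auto
  then show ?thesis unfolding frechet_derivative_def by simp
qed

lemma Ck_on_cong:
  assumes "open S" "\<And>x. x \<in> S \<Longrightarrow> f x = g x" "Ck_on r S f"
  shows "Ck_on r S g"
  using assms(2,3)
proof (induction r arbitrary: f g)
  case 0
  then show ?case using continuous_on_cong by (metis Ck_on.simps(1))
next
  case (Suc r)
  have "fderiv f x = fderiv g x" if "x \<in> S" for x
    using Suc.prems(1) assms(1) that by (intro fderiv_cong_open[of S])
  moreover have "g differentiable (at x)" if "x \<in> S" for x
    using differentiable_cong_open[OF assms(1) that Suc.prems(1)] Suc.prems(2) that by auto
  ultimately show ?case
    using Suc.prems Suc.IH[of "\<lambda>x. fderiv f x v" "\<lambda>x. fderiv g x v" for v] by simp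
qed

lemma Ck_on_subset: "Ck_on r S f \<Longrightarrow> T \<subseteq> S \<Longrightarrow> Ck_on r T f"
  by (induction r arbitrary: f) (auto intro: continuous_on_subset)

lemma Ck_on_continuous: "Ck_on r S f \<Longrightarrow> continuous_on S f"
  by (cases r) (auto intro!: continuous_at_imp_continuous_on simp: differentiable_imp_continuous_within)

lemma Ck_on_Suc_imp: "Ck_on (Suc r) S f \<Longrightarrow> Ck_on r S f"
proof (induction r arbitrary: f)
  case 0
  then show ?case using Ck_on_continuous[OF 0] by simp
next
  case (Suc r)
  then show ?case unfolding Ck_on.simps(2)[of "Suc r" S f] Ck_on.simps(2)[of r S f] by blast
qed

lemma Ck_on_SucI:
  assumes "open S" "\<And>x. x \<in> S \<Longrightarrow> (f has_derivative F x) (at x)" "\<And>v. Ck_on r S (\<lambda>x. F x v)"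
  shows "Ck_on (Suc r) S f"
proof -
  have "Ck_on r S (\<lambda>x. fderiv f x v)" for v
    by (rule Ck_on_cong[OF assms(1) _ assms(3)[of v]]) (simp add: fderiv_eq[OF assms(2)])
  moreover have "\<forall>x\<in>S. f differentiable (at x)" using assms(2) differentiable_def by blast
  ultimately show ?thesis by simp
qed

lemma Ck_on_local:
  assumes "\<And>x. x \<in> S \<Longrightarrow> \<exists>N. open N \<and> x \<in> N \<and> Ck_on r N f"
  shows "Ck_on r S f"
  using assms
proof (induction r arbitrary: f)
  case 0
  then have "\<forall>x\<in>S. isCont f x"
    by (metis Ck_on.simps(1) continuous_on_eq_continuous_at)
  then show ?case by (simp add: continuous_at_imp_continuous_on)
next
  case (Suc r)
  have "\<forall>x\<in>S. f differentiable (at x)" using Suc.prems by (metis Ck_on.simps(2))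
  moreover have "Ck_on r S (\<lambda>x. fderiv f x v)" for v
    by (rule Suc.IH) (use Suc.prems in \<open>fastforce\<close>)
  ultimately show ?case by simp
qed

lemma smooth_on_cong:
  "open S \<Longrightarrow> (\<And>x. x \<in> S \<Longrightarrow> f x = g x) \<Longrightarrow> smooth_on S f \<Longrightarrow> smooth_on S g"
  unfolding smooth_on_def using Ck_on_cong by blast

lemma smooth_on_subset: "smooth_on S f \<Longrightarrow> T \<subseteq> S \<Longrightarrow> smooth_on T f"
  unfolding smooth_on_def using Ck_on_subset by blast

lemma smooth_on_continuous: "smooth_on S f \<Longrightarrow> continuous_on S f"
  unfolding smooth_on_def using Ck_on_continuous by blast

lemma smooth_on_local:
  assumes "\<And>x. x \<in> S \<Longrightarrow> \<exists>N. open N \<and> x \<in> N \<and> smooth_on N f"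
  shows "smooth_on S f"
  unfolding smooth_on_def
proof
  fix r
  show "Ck_on r S f"
    by (rule Ck_on_local) (use assms smooth_on_def in blast)
qed

lemma smooth_on_fderiv: "smooth_on S f \<Longrightarrow> smooth_on S (\<lambda>x. fderiv f x v)"
  unfolding smooth_on_def by (metis Ck_on.simps(2))

lemma smooth_on_has_derivative:
  "smooth_on S f \<Longrightarrow> x \<in> S \<Longrightarrow> (f has_derivative fderiv f x) (at x)"
  using smooth_on_differentiable fderiv_works by blast

lemma fderiv_bounded_linear:
  "smooth_on S f \<Longrightarrow> x \<in> S \<Longrightarrow> bounded_linear (fderiv f x)"
  using smooth_on_has_derivative has_derivative_bounded_linear by blast

lemma Ck_on_const: "Ck_on r S (\<lambda>x. c)"
proof (induction r arbitrary: c)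
  case (Suc r)
  have "fderiv (\<lambda>x. c) x v = 0" for x v by (simp add: frechet_derivative_const)
  then show ?case using Suc[of 0] by simp
qed simp

lemma Ck_on_bounded_linear:
  assumes "bounded_linear L"
  shows "Ck_on r S L"
proof (cases r)
  case 0
  then show ?thesis using assms by (simp add: linear_continuous_on)
next
  case (Suc q)
  have "fderiv L x = L" for x
    using assms by (intro fderiv_eq bounded_linear_imp_has_derivative)
  then show ?thesis
    using Suc assms bounded_linear_imp_differentiable Ck_on_const by (auto)
qed

lemma Ck_on_add:
  assumes "open S"
  shows "Ck_on r S f \<Longrightarrow> Ck_on r S g \<Longrightarrow> Ck_on r S (\<lambda>x. f x + g x)"
proof (induction r arbitrary: f g)
  case (Suc r)
  show ?case
    by (rule Ck_on_SucI[OF assms has_derivative_add[OF fderiv_works fderiv_works]])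
      (use Suc in auto)
qed (auto intro: continuous_on_add)

lemma Ck_on_bounded_bilinear:
  assumes "open S" "bounded_bilinear B"
  shows "Ck_on r S f \<Longrightarrow> Ck_on r S g \<Longrightarrow> Ck_on r S (\<lambda>x. B (f x) (g x))"
proof (induction r arbitrary: f g)
  case 0
  then show ?case using assms(2) by (simp add: bounded_bilinear.continuous_on)
next
  case (Suc r)
  show ?case
  proof (rule Ck_on_SucI[OF assms(1)])
    fix x assume "x \<in> S"
    then show "((\<lambda>x. B (f x) (g x)) has_derivative (\<lambda>h. B (f x) (fderiv g x h) + B (fderiv f x h) (g x))) (at x)"
      using Suc.prems by (intro bounded_bilinear.FDERIV[OF assms(2)] fderiv_works) auto
  next
    fix v
    show "Ck_on r S (\<lambda>x. B (f x) (fderiv g x v) + B (fderiv f x v) (g x))"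
      using Suc.prems Ck_on_Suc_imp[OF Suc.prems(1)] Ck_on_Suc_imp[OF Suc.prems(2)]
      by (intro Ck_on_add[OF assms(1)] Suc.IH) simp_all
  qed
qed

lemma Ck_on_sum:
  assumes "open S" "\<And>i. i \<in> I \<Longrightarrow> Ck_on r S (f i)"
  shows "Ck_on r S (\<lambda>x. \<Sum>i\<in>I. f i x)"
proof (cases "finite I")
  case True
  then show ?thesis using assms(2)
    by (induction I rule: finite_induct) (auto intro: Ck_on_add[OF assms(1)] Ck_on_const)
qed (simp add: Ck_on_const)

text \<open>The derivative of a composition is expanded in the orthonormal basis of the middle space, so
  that it becomes a finite sum of products, to which the induction hypothesis applies.\<close>

lemma Ck_on_compose:
  fixes f :: "'b::euclidean_space \<Rightarrow> 'c::real_normed_vector"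
  assumes "open S" "open T"
  shows "Ck_on r T f \<Longrightarrow> Ck_on r S g \<Longrightarrow> g ` S \<subseteq> T \<Longrightarrow> Ck_on r S (\<lambda>x. f (g x))"
proof (induction r arbitrary: f)
  case 0
  then show ?case by (auto intro: continuous_on_compose2)
next
  case (Suc r)
  have df: "(f has_derivative fderiv f (g x)) (at (g x))" if "x \<in> S" for x
    using Suc.prems that by (intro fderiv_works) auto
  have lin: "fderiv f (g x) w = (\<Sum>b\<in>Basis. (w \<bullet> b) *\<^sub>R fderiv f (g x) b)" if "x \<in> S" for x w
  proof -
    have "linear (fderiv f (g x))" using df[OF that] has_derivative_linear by blast
    then have "fderiv f (g x) (\<Sum>b\<in>Basis. (w \<bullet> b) *\<^sub>R b) = (\<Sum>b\<in>Basis. (w \<bullet> b) *\<^sub>R fderiv f (g x) b)"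
      by (simp add: linear_sum linear_cmul)
    then show ?thesis by (simp add: euclidean_representation)
  qed
  show ?case
  proof (rule Ck_on_SucI[OF assms(1)])
    fix x assume x: "x \<in> S"
    have "(g has_derivative fderiv g x) (at x)" using Suc.prems x by (intro fderiv_works) auto
    from has_derivative_compose[OF this df[OF x]]
    show "((\<lambda>x. f (g x)) has_derivative (\<lambda>v. \<Sum>b\<in>Basis. (fderiv g x v \<bullet> b) *\<^sub>R fderiv f (g x) b)) (at x)"
      by (simp flip: lin[OF x])
  next
    fix v
    show "Ck_on r S (\<lambda>x. \<Sum>b\<in>Basis. (fderiv g x v \<bullet> b) *\<^sub>R fderiv f (g x) b)"
    proof (intro Ck_on_sum[OF assms(1)] Ck_on_bounded_bilinear[OF assms(1) bounded_bilinear_scaleR])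
      fix b :: 'b
      have "Ck_on r S (\<lambda>x. fderiv g x v)" using Suc.prems by simp
      then show "Ck_on r S (\<lambda>x. fderiv g x v \<bullet> b)"
        by (intro Ck_on_bounded_bilinear[OF assms(1) bounded_bilinear_inner] Ck_on_const)
      show "Ck_on r S (\<lambda>x. fderiv f (g x) b)"
        using Suc.prems Ck_on_Suc_imp[of r S g] by (intro Suc.IH[of "\<lambda>y. fderiv f y b"]) auto
    qed
  qed
qed

lemma smooth_on_const: "smooth_on S (\<lambda>x. c)"
  by (simp add: smooth_on_def Ck_on_const)

lemma smooth_on_bounded_linear: "bounded_linear L \<Longrightarrow> smooth_on S L"
  by (simp add: smooth_on_def Ck_on_bounded_linear)

lemma smooth_on_id: "smooth_on S (\<lambda>x. x)"
  by (rule smooth_on_bounded_linear[OF bounded_linear_ident])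

lemma smooth_on_add: "open S \<Longrightarrow> smooth_on S f \<Longrightarrow> smooth_on S g \<Longrightarrow> smooth_on S (\<lambda>x. f x + g x)"
  by (simp add: smooth_on_def Ck_on_add)

lemma smooth_on_scaleR:
  "open S \<Longrightarrow> smooth_on S f \<Longrightarrow> smooth_on S g \<Longrightarrow> smooth_on S (\<lambda>x. f x *\<^sub>R g x)"
  by (simp add: smooth_on_def Ck_on_bounded_bilinear[OF _ bounded_bilinear_scaleR])

lemma smooth_on_mult:
  fixes f g :: "'a::real_normed_vector \<Rightarrow> real"
  shows "open S \<Longrightarrow> smooth_on S f \<Longrightarrow> smooth_on S g \<Longrightarrow> smooth_on S (\<lambda>x. f x * g x)"
  by (simp add: smooth_on_def Ck_on_bounded_bilinear[OF _ bounded_bilinear_mult])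

lemma smooth_on_inner:
  fixes f g :: "'a::real_normed_vector \<Rightarrow> 'b::real_inner"
  shows "open S \<Longrightarrow> smooth_on S f \<Longrightarrow> smooth_on S g \<Longrightarrow> smooth_on S (\<lambda>x. f x \<bullet> g x)"
  by (simp add: smooth_on_def Ck_on_bounded_bilinear[OF _ bounded_bilinear_inner])

lemma smooth_on_sum:
  "open S \<Longrightarrow> (\<And>i. i \<in> I \<Longrightarrow> smooth_on S (f i)) \<Longrightarrow> smooth_on S (\<lambda>x. \<Sum>i\<in>I. f i x)"
  by (simp add: smooth_on_def Ck_on_sum)

lemma smooth_on_compose:
  fixes f :: "'b::euclidean_space \<Rightarrow> 'c::real_normed_vector"
  shows "open S \<Longrightarrow> open T \<Longrightarrow> smooth_on T f \<Longrightarrow> smooth_on S g \<Longrightarrow> g ` S \<subseteq> T \<Longrightarrow> smooth_on S (\<lambda>x. f (g x))"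
  unfolding smooth_on_def using Ck_on_compose by blast

lemma smooth_on_linear_compose:
  fixes L :: "'b::euclidean_space \<Rightarrow> 'c::real_normed_vector"
  shows "open S \<Longrightarrow> bounded_linear L \<Longrightarrow> smooth_on S g \<Longrightarrow> smooth_on S (\<lambda>x. L (g x))"
  by (rule smooth_on_compose[of S UNIV L g]) (auto intro: smooth_on_bounded_linear)

lemma smooth_on_minus:
  assumes "open S" "smooth_on S f" "smooth_on S g"
  shows "smooth_on S (\<lambda>x. f x - g x)"
  using smooth_on_add[OF assms(1,2) smooth_on_scaleR[OF assms(1) smooth_on_const assms(3), of "-1"]]
  by simp

lemma smooth_on_Pair:
  fixes f :: "'a::real_normed_vector \<Rightarrow> 'b::real_normed_vector" and g :: "'a \<Rightarrow> 'c::real_normed_vector"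
  assumes "open S" "smooth_on S f" "smooth_on S g"
  shows "smooth_on S (\<lambda>x. (f x, g x))"
proof -
  have "Ck_on r S f \<Longrightarrow> Ck_on r S g \<Longrightarrow> Ck_on r S (\<lambda>x. (f x, g x))"
    for r and f :: "'a \<Rightarrow> 'b" and g :: "'a \<Rightarrow> 'c"
  proof (induction r arbitrary: f g)
    case (Suc r)
    show ?case
      by (rule Ck_on_SucI[OF assms(1) has_derivative_Pair[OF fderiv_works fderiv_works]])
        (use Suc in auto)
  qed (auto intro: continuous_on_Pair)
  then show ?thesis using assms by (simp add: smooth_on_def)
qed

lemma smooth_on_inverse:
  fixes f :: "'a::real_normed_vector \<Rightarrow> real"
  assumes "open S" "smooth_on S f" "\<And>x. x \<in> S \<Longrightarrow> f x \<noteq> 0"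
  shows "smooth_on S (\<lambda>x. inverse (f x))"
proof -
  have o: "open (- {0::real})" by (intro open_Compl closed_singleton)
  have "Ck_on r (- {0}) (inverse :: real \<Rightarrow> real)" for r
  proof (induction r)
    case (Suc r)
    show ?case
    proof (rule Ck_on_SucI[OF o])
      fix x :: real assume "x \<in> - {0}"
      then show "(inverse has_derivative (\<lambda>h. - (inverse x * h * inverse x))) (at x)"
        by (intro has_derivative_inverse') auto
    next
      fix v :: real
      have "Ck_on r (- {0}) (\<lambda>x::real. (- v) * (inverse x * inverse x))"
        by (intro Ck_on_bounded_bilinear[OF o bounded_bilinear_mult] Ck_on_const Suc)
      then show "Ck_on r (- {0}) (\<lambda>x::real. - (inverse x * v * inverse x))"
        by (rule Ck_on_cong[OF o, rotated]) simp
    qed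
  qed (simp add: continuous_on_inverse)
  then have "smooth_on (- {0}) (inverse :: real \<Rightarrow> real)" by (simp add: smooth_on_def)
  then show ?thesis by (rule smooth_on_compose[OF assms(1) o _ assms(2)]) (use assms(3) in auto)
qed

lemma smooth_on_sin_cos: "smooth_on S (sin :: real \<Rightarrow> real)" "smooth_on S (cos :: real \<Rightarrow> real)"
proof -
  have "Ck_on r UNIV (sin :: real \<Rightarrow> real) \<and> Ck_on r UNIV (cos :: real \<Rightarrow> real)" for r
  proof (induction r)
    case (Suc r)
    have "Ck_on (Suc r) UNIV (sin :: real \<Rightarrow> real)"
    proof (rule Ck_on_SucI)
      fix x :: real
      show "(sin has_derivative (\<lambda>h. h * cos x)) (at x)"
        using DERIV_sin[of x] by (simp add: has_field_derivative_def mult_commute_abs)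
    qed (use Suc in \<open>auto intro!: Ck_on_bounded_bilinear[OF _ bounded_bilinear_mult] Ck_on_const\<close>)
    moreover have "Ck_on (Suc r) UNIV (cos :: real \<Rightarrow> real)"
    proof (rule Ck_on_SucI)
      fix x :: real
      show "(cos has_derivative (\<lambda>h. (- h) * sin x)) (at x)"
        by (auto intro!: derivative_eq_intros)
      fix v :: real
      show "Ck_on r UNIV (\<lambda>x. (- v) * sin x)"
        using Suc by (intro Ck_on_bounded_bilinear[OF _ bounded_bilinear_mult] Ck_on_const) auto
    qed simp
    ultimately show ?case by blast
  qed (auto intro: continuous_intros)
  then show "smooth_on S (sin :: real \<Rightarrow> real)" "smooth_on S (cos :: real \<Rightarrow> real)"
    unfolding smooth_on_def by (meson Ck_on_subset subset_UNIV)+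
qed

text \<open>Both mixed second derivatives are limits of the same second difference: by two applications
  of the mean value theorem, it is a second derivative at a nearby point.\<close>

lemma second_difference:
  fixes f :: "'a::real_normed_vector \<Rightarrow> real"
  assumes "smooth_on S f" "0 < e"
    and inS: "\<And>s t. 0 \<le> s \<Longrightarrow> s \<le> e \<Longrightarrow> 0 \<le> t \<Longrightarrow> t \<le> e \<Longrightarrow> x + s *\<^sub>R u + t *\<^sub>R v \<in> S"
  obtains s t where "0 \<le> s" "s \<le> e" "0 \<le> t" "t \<le> e"
    "f (x + e *\<^sub>R u + e *\<^sub>R v) - f (x + e *\<^sub>R u) - f (x + e *\<^sub>R v) + f x
      = e * (e * fderiv (\<lambda>y. fderiv f y u) (x + s *\<^sub>R u + t *\<^sub>R v) v)"
proof -
  have along: "((\<lambda>s. g (p + s *\<^sub>R w)) has_real_derivative fderiv g (p + s *\<^sub>R w) w) (at s)"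
    if "smooth_on S g" "p + s *\<^sub>R w \<in> S" for g :: "'a \<Rightarrow> real" and p s w
  proof -
    have d: "((\<lambda>s. p + s *\<^sub>R w) has_derivative (\<lambda>h. h *\<^sub>R w)) (at s)"
      by (auto intro!: derivative_eq_intros)
    have g: "(g has_derivative fderiv g (p + s *\<^sub>R w)) (at (p + s *\<^sub>R w))"
      using that by (rule smooth_on_has_derivative)
    have "fderiv g (p + s *\<^sub>R w) (h *\<^sub>R w) = fderiv g (p + s *\<^sub>R w) w * h" for h
      using g has_derivative_linear linear_cmul by fastforce
    then show ?thesis using has_derivative_compose[OF d g]
      by (simp add: has_field_derivative_def mult_commute_abs)
  qed
  let ?\<phi> = "\<lambda>s. f ((x + e *\<^sub>R v) + s *\<^sub>R u) - f (x + s *\<^sub>R u)"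
  have "(?\<phi> has_real_derivative
      (fderiv f ((x + e *\<^sub>R v) + s *\<^sub>R u) u - fderiv f (x + s *\<^sub>R u) u)) (at s)"
    if "0 \<le> s" "s \<le> e" for s
    using inS[OF that, of e] inS[OF that, of 0] assms
    by (intro DERIV_diff along) (auto simp: add_ac)
  from MVT2[OF assms(2) this] obtain s where s: "0 < s" "s < e" and
    1: "?\<phi> e - ?\<phi> 0 = (e - 0) * (fderiv f ((x + e *\<^sub>R v) + s *\<^sub>R u) u - fderiv f (x + s *\<^sub>R u) u)" by blast
  let ?g = "\<lambda>y. fderiv f y u"
  have "((\<lambda>t. ?g ((x + s *\<^sub>R u) + t *\<^sub>R v)) has_real_derivative fderiv ?g ((x + s *\<^sub>R u) + t *\<^sub>R v) v) (at t)"
    if "0 \<le> t" "t \<le> e" for t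
    using inS[of s t] s that assms by (intro along smooth_on_fderiv) auto
  from MVT2[OF assms(2) this] obtain t where t: "0 < t" "t < e" and
    2: "?g ((x + s *\<^sub>R u) + e *\<^sub>R v) - ?g ((x + s *\<^sub>R u) + 0 *\<^sub>R v) = (e - 0) * fderiv ?g ((x + s *\<^sub>R u) + t *\<^sub>R v) v"
    by blast
  show thesis
    by (rule that[of s t]) (use s t 1 2 in \<open>auto simp: add_ac\<close>)
qed

lemma fderiv_symmetric:
  fixes f :: "'a::real_normed_vector \<Rightarrow> real"
  assumes "smooth_on S f" "open S" "x \<in> S"
  shows "fderiv (\<lambda>y. fderiv f y u) x v = fderiv (\<lambda>y. fderiv f y v) x u"
proof (rule ccontr)
  let ?a = "\<lambda>y. fderiv (\<lambda>y. fderiv f y u) y v" and ?b = "\<lambda>y. fderiv (\<lambda>y. fderiv f y v) y u"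
  assume "?a x \<noteq> ?b x"
  then have d: "dist (?a x) (?b x) / 2 > 0" (is "?d > 0") by simp
  have "continuous_on S ?a" "continuous_on S ?b"
    using assms smooth_on_fderiv smooth_on_continuous by blast+
  then have "isCont ?a x" "isCont ?b x" using assms by (simp_all add: continuous_on_eq_continuous_at)
  then have "\<exists>r>0. \<forall>y. dist y x < r \<longrightarrow> dist (?a y) (?a x) < ?d"
    "\<exists>r>0. \<forall>y. dist y x < r \<longrightarrow> dist (?b y) (?b x) < ?d"
    using d by (simp_all only: continuous_at_eps_delta)
  then obtain r1 r2 where r: "r1 > 0" "r2 > 0"
    "\<And>y. dist y x < r1 \<Longrightarrow> dist (?a y) (?a x) < ?d" "\<And>y. dist y x < r2 \<Longrightarrow> dist (?b y) (?b x) < ?d"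
    by auto
  obtain r3 where r3: "r3 > 0" "ball x r3 \<subseteq> S" using assms open_contains_ball by blast
  define q where "q = min r3 (min r1 r2)"
  define e where "e = q / (2 * (norm u + norm v + 1))"
  have q: "q > 0" using r r3 by (simp add: q_def)
  have e: "e > 0" using q by (auto simp: e_def intro!: divide_pos_pos add_nonneg_pos)
  have e2: "e * (norm u + norm v) < q"
  proof -
    have "e * (norm u + norm v) \<le> e * (norm u + norm v + 1)" using e by (simp add: mult_left_mono)
    also have "\<dots> = q / 2" unfolding e_def by (simp add: field_simps add_nonneg_eq_0_iff)
    finally show ?thesis using q by simp
  qed
  have near: "dist (x + s *\<^sub>R u + t *\<^sub>R v) x < q" if "0 \<le> s" "s \<le> e" "0 \<le> t" "t \<le> e" for s t
  proof -
    have "dist (x + s *\<^sub>R u + t *\<^sub>R v) x = norm (s *\<^sub>R u + t *\<^sub>R v)" by (simp add: dist_norm add.assoc)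
    also have "\<dots> \<le> s * norm u + t * norm v" using norm_triangle_ineq[of "s *\<^sub>R u" "t *\<^sub>R v"] that by simp
    also have "\<dots> \<le> e * norm u + e * norm v" using that by (intro add_mono mult_right_mono) auto
    finally show ?thesis using e2 by (simp add: algebra_simps)
  qed
  have inS: "x + s *\<^sub>R u + t *\<^sub>R v \<in> S" if "0 \<le> s" "s \<le> e" "0 \<le> t" "t \<le> e" for s t
    using near[OF that] r3 by (auto simp: q_def dist_commute subset_iff)
  then have inS': "x + t *\<^sub>R v + s *\<^sub>R u \<in> S" if "0 \<le> t" "t \<le> e" "0 \<le> s" "s \<le> e" for s t
    using that by (metis add.assoc add.commute)
  obtain s t where st: "0 \<le> s" "s \<le> e" "0 \<le> t" "t \<le> e" and
    1: "f (x + e *\<^sub>R u + e *\<^sub>R v) - f (x + e *\<^sub>R u) - f (x + e *\<^sub>R v) + f x = e * (e * ?a (x + s *\<^sub>R u + t *\<^sub>R v))"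
    by (rule second_difference[OF assms(1) e, of x u v]) (use inS in \<open>blast+\<close>)
  obtain s' t' where st': "0 \<le> s'" "s' \<le> e" "0 \<le> t'" "t' \<le> e" and
    2: "f (x + e *\<^sub>R v + e *\<^sub>R u) - f (x + e *\<^sub>R v) - f (x + e *\<^sub>R u) + f x = e * (e * ?b (x + s' *\<^sub>R v + t' *\<^sub>R u))"
    by (rule second_difference[OF assms(1) e, of x v u]) (use inS' in \<open>blast+\<close>)
  have "e * (e * ?a (x + s *\<^sub>R u + t *\<^sub>R v)) = e * (e * ?b (x + s' *\<^sub>R v + t' *\<^sub>R u))"
  proof -
    have "x + e *\<^sub>R v + e *\<^sub>R u = x + e *\<^sub>R u + e *\<^sub>R v" by (simp add: add_ac)
    then show ?thesis using 1 2 by (simp only:)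
  qed
  then have eq: "?a (x + s *\<^sub>R u + t *\<^sub>R v) = ?b (x + t' *\<^sub>R u + s' *\<^sub>R v)" using e by (simp add: add_ac)
  have "dist (?a (x + s *\<^sub>R u + t *\<^sub>R v)) (?a x) < ?d" using r(3) near[OF st] by (simp add: q_def)
  moreover have "dist (?b (x + t' *\<^sub>R u + s' *\<^sub>R v)) (?b x) < ?d"
    using r(4) near[OF st'(3,4,1,2)] by (simp add: q_def)
  ultimately have "dist (?a x) (?b x) < ?d + ?d"
    unfolding dist_real_def using eq by linarith
  then show False by simp
qed

lemma has_derivative_vec_nth [derivative_intros]:
  "(f has_derivative f') F \<Longrightarrow> ((\<lambda>x. f x $ i) has_derivative (\<lambda>h. f' h $ i)) F"
  by (rule bounded_linear.has_derivative[OF bounded_linear_vec_nth])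


section \<open>Multilinear and alternating forms\<close>

definition multilinear_form :: "nat \<Rightarrow> ('a::real_vector list \<Rightarrow> real) \<Rightarrow> bool" where
  "multilinear_form k w \<longleftrightarrow> (\<forall>us i u v a b. length us = k \<longrightarrow> i < k \<longrightarrow>
     w (us[i := a *\<^sub>R u + b *\<^sub>R v]) = a * w (us[i := u]) + b * w (us[i := v]))"

definition alternating :: "nat \<Rightarrow> ('a::real_vector list \<Rightarrow> real) \<Rightarrow> bool" where
  "alternating k w \<longleftrightarrow> multilinear_form k w \<and> (\<forall>us. length us = k \<longrightarrow> \<not> distinct us \<longrightarrow> w us = 0)"

lemma multilinear_form_linear:
  assumes "multilinear_form k w" "length us = k" "i < k"
  shows "linear (\<lambda>u. w (us[i := u]))"
proof
  fix u v
  show "w (us[i := u + v]) = w (us[i := u]) + w (us[i := v])"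
    using assms unfolding multilinear_form_def by (metis mult_1 scaleR_one)
next
  fix c u
  have "w (us[i := c *\<^sub>R u + 0 *\<^sub>R u]) = c * w (us[i := u]) + 0 * w (us[i := u])"
    using assms unfolding multilinear_form_def by blast
  then show "w (us[i := c *\<^sub>R u]) = c *\<^sub>R w (us[i := u])" by simp
qed

lemma multilinear_form_linear_hd:
  assumes "multilinear_form (Suc k) w" "length us = k"
  shows "linear (\<lambda>u. w (u # us))"
  using multilinear_form_linear[OF assms(1), of "0 # us" 0] assms(2) by simp

lemma multilinear_form_Cons:
  assumes "multilinear_form (Suc k) w"
  shows "multilinear_form k (\<lambda>us. w (u # us))"
  unfolding multilinear_form_def
proof (intro allI impI)
  fix us :: "'a list" and i x y and a b :: real assume "length us = k" "i < k"
  then show "w (u # us[i := a *\<^sub>R x + b *\<^sub>R y]) = a * w (u # us[i := x]) + b * w (u # us[i := y])"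
    using assms[unfolded multilinear_form_def, rule_format, of "u # us" "Suc i" a x b y] by simp
qed

lemma linear_euclidean_sum:
  fixes f :: "'a::euclidean_space \<Rightarrow> real"
  assumes "linear f"
  shows "f u = (\<Sum>b\<in>Basis. (u \<bullet> b) * f b)"
proof -
  have "f (\<Sum>b\<in>Basis. (u \<bullet> b) *\<^sub>R b) = (\<Sum>b\<in>Basis. (u \<bullet> b) * f b)"
    using assms by (simp add: linear_sum linear_cmul)
  then show ?thesis by (simp add: euclidean_representation)
qed

text \<open>Expanding the arguments in the basis one position after the other; \<open>j\<close> counts the
  positions that are still arbitrary.\<close>

lemma multilinear_form_eq_0:
  fixes w :: "'a::euclidean_space list \<Rightarrow> real"
  assumes w: "multilinear_form k w"
    and basis: "\<And>bs. length bs = k \<Longrightarrow> set bs \<subseteq> Basis \<Longrightarrow> w bs = 0"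
    and us: "length us = k"
  shows "w us = 0"
proof -
  have "\<forall>us. length us = k \<longrightarrow> set (drop j us) \<subseteq> Basis \<longrightarrow> w us = 0" for j
  proof (induction j)
    case 0
    then show ?case using basis by auto
  next
    case (Suc j)
    show ?case
    proof (intro allI impI)
      fix us :: "'a list" assume us: "length us = k" "set (drop (Suc j) us) \<subseteq> Basis"
      show "w us = 0"
      proof (cases "j < k")
        case False
        then show ?thesis using Suc us by auto
      next
        case True
        have "w (us[j := b]) = 0" if "b \<in> Basis" for b
        proof -
          have "drop j (us[j := b]) = b # drop (Suc j) us"
            using True us by (simp add: drop_update_swap flip: Cons_nth_drop_Suc)
          then show ?thesis using Suc us that by auto
        qed
        then have "w (us[j := us ! j]) = 0"
          using linear_euclidean_sum[OF multilinear_form_linear[OF w us(1) True]]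
          by (metis (mono_tags, lifting) mult_zero_right sum.neutral)
        then show ?thesis by simp
      qed
    qed
  qed
  from this[of k] us show ?thesis by simp
qed

lemma alternating_swap:
  assumes w: "alternating k w" and us: "length us = k" and ij: "i < k" "j < k" "i \<noteq> j"
  shows "w (us[i := us ! j, j := us ! i]) = - w us"
proof -
  have lin: "linear (\<lambda>u. w (xs[l := u]))" if "length xs = k" "l < k" for xs l
    using multilinear_form_linear[OF _ that] w by (simp add: alternating_def)
  have rep: "w (us[i := x, j := x]) = 0" for x
  proof -
    have "us[i := x, j := x] ! i = us[i := x, j := x] ! j" using us ij by simp
    then have "\<not> distinct (us[i := x, j := x])" using us ij nth_eq_iff_index_eq by fastforce
    then show ?thesis using w us by (simp add: alternating_def)
  qed
  let ?u = "us ! i" and ?v = "us ! j"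
  have split: "w (us[i := x, j := ?u + ?v]) = w (us[i := x, j := ?u]) + w (us[i := x, j := ?v])" for x
    using linear_add[OF lin[of "us[i := x]" j]] us ij by simp
  have split': "w (us[i := ?u + ?v, j := x]) = w (us[i := ?u, j := x]) + w (us[i := ?v, j := x])" for x
    using linear_add[OF lin[of "us[j := x]" i]] us ij by (simp add: list_update_swap)
  have "0 = w (us[i := ?u + ?v, j := ?u + ?v])" using rep by simp
  also have "\<dots> = w (us[i := ?u, j := ?v]) + w (us[i := ?v, j := ?u])"
    unfolding split split' using rep[of ?u] rep[of ?v] by linarith
  also have "us[i := ?u, j := ?v] = us" by simp
  finally show ?thesis by simp
qed

text \<open>Putting the entries into their places from the last position to the first takes one
  transposition per position, and each transposition changes only the sign.\<close>

lemma alternating_mset: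
  assumes w: "alternating k w"
    and "length xs = k" "mset xs = mset ys"
  shows "\<bar>w xs\<bar> = \<bar>w ys\<bar>"
proof -
  have "\<forall>xs ys. length xs = k \<longrightarrow> mset xs = mset ys \<longrightarrow> drop j xs = drop j ys \<longrightarrow> \<bar>w xs\<bar> = \<bar>w ys\<bar>" for j
  proof (induction j)
    case (Suc j)
    show ?case
    proof (intro allI impI)
      fix xs ys :: "'a list"
      assume *: "length xs = k" "mset xs = mset ys" "drop (Suc j) xs = drop (Suc j) ys"
      have len: "length ys = k" using * by (metis mset_eq_length)
      show "\<bar>w xs\<bar> = \<bar>w ys\<bar>"
      proof (cases "j < k")
        case False
        then have "drop j xs = drop j ys" using *(1) len by simp
        then show ?thesis using Suc *(1,2) by blast
      next
        case j: True
        have "mset (take (Suc j) xs) = mset (take (Suc j) ys)"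
          using *(2,3) by (metis add_right_cancel append_take_drop_id mset_append)
        then have "set (take (Suc j) xs) = set (take (Suc j) ys)" by (rule mset_eq_setD)
        moreover have "ys ! j \<in> set (take (Suc j) ys)" using j len by (simp add: take_Suc_conv_app_nth)
        ultimately have "ys ! j \<in> set (take (Suc j) xs)" by simp
        then obtain i where i: "i < Suc j" "xs ! i = ys ! j"
          by (auto simp only: in_set_conv_nth length_take min_less_iff_conj nth_take)
        let ?zs = "xs[i := xs ! j, j := xs ! i]"
        have "mset ?zs = mset ys" using mset_swap[of j xs i] *(1,2) i j by simp
        moreover have "drop j ?zs = drop j ys"
          using *(1,3) len i j by (simp add: drop_update_swap flip: Cons_nth_drop_Suc)
        ultimately have "\<bar>w ?zs\<bar> = \<bar>w ys\<bar>"
          using Suc[rule_format, of ?zs ys] *(1) by simp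
        moreover have "\<bar>w ?zs\<bar> = \<bar>w xs\<bar>"
        proof (cases "i = j")
          case True
          then show ?thesis by (simp only: list_update_id)
        next
          case False
          then show ?thesis using alternating_swap[OF w *(1), of i j] i(1) j by simp
        qed
        ultimately show ?thesis by simp
      qed
    qed
  qed simp
  then show ?thesis using assms(2,3) mset_eq_length by (metis drop_all order_refl)
qed

text \<open>Moving the \<open>i\<close>-th argument to the front past \<open>i\<close> others costs \<open>i\<close> sign changes.\<close>

lemma alternating_hd:
  assumes w: "alternating k w" and us: "length us = k" and "i < k"
  shows "w (v # take i us @ drop (Suc i) us) = (-1) ^ i * w (us[i := v])"
  using assms(3) us
proof (induction i arbitrary: us)
  case 0
  then show ?case by (cases us) auto
next
  case (Suc i)
  let ?xs = "us[Suc i := us ! i]"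
  have i: "i < length us" "Suc i < length us" using Suc.prems by simp_all
  have "take i ?xs @ drop (Suc i) ?xs = take (Suc i) us @ drop (Suc (Suc i)) us"
    using i by (simp add: take_Suc_conv_app_nth drop_update_swap flip: Cons_nth_drop_Suc)
  then have "w (v # take (Suc i) us @ drop (Suc (Suc i)) us) = (-1) ^ i * w (?xs[i := v])"
    using Suc.IH[of ?xs] Suc.prems by simp
  also have "?xs[i := v] = us[Suc i := v, i := us[Suc i := v] ! Suc i, Suc i := us[Suc i := v] ! i]"
    using i by (simp add: list_update_swap)
  also have "w \<dots> = - w (us[Suc i := v])"
    using alternating_swap[OF w, of "us[Suc i := v]" i "Suc i"] Suc.prems by simp
  finally show ?case by simp
qed

lemma alternating_eq_0_degree:
  fixes w :: "'a::euclidean_space list \<Rightarrow> real"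
  assumes w: "alternating k w" and "DIM('a) < k" and us: "length us = k"
  shows "w us = 0"
proof (rule multilinear_form_eq_0[OF _ _ us])
  fix bs :: "'a list" assume bs: "length bs = k" "set bs \<subseteq> Basis"
  have "card (set bs) \<le> DIM('a)" using bs(2) by (intro card_mono) auto
  then have "\<not> distinct bs" using assms(2) bs(1) distinct_card by fastforce
  then show "w bs = 0" using w bs by (simp add: alternating_def)
qed (use w alternating_def in auto)

text \<open>Forms take lists of vectors, whereas determinants are indexed by the type \<open>'n\<close>. An arbitrary
  enumeration of \<open>'n\<close> links the two.\<close>

definition index_list :: "'n::finite list" where
  "index_list = (SOME xs. distinct xs \<and> set xs = UNIV)"

lemma index_list: "distinct (index_list :: 'n::finite list)" "set (index_list :: 'n list) = UNIV"
proof -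
  obtain xs :: "'n list" where "set xs = UNIV" "distinct xs"
    using finite_distinct_list[OF finite] by blast
  then have "\<exists>xs :: 'n list. distinct xs \<and> set xs = UNIV" by blast
  from someI_ex[OF this] have "distinct (index_list :: 'n list) \<and> set (index_list :: 'n list) = UNIV"
    by (simp only: index_list_def)
  then show "distinct (index_list :: 'n list)" "set (index_list :: 'n list) = UNIV" by auto
qed

lemma length_index_list: "length (index_list :: 'n::finite list) = CARD('n)"
  using distinct_card[OF index_list(1)] index_list(2) by metis

definition std_basis_list :: "(real ^ 'n::finite) list" where
  "std_basis_list = map (\<lambda>i. axis i 1) index_list"

definition position :: "'n::finite \<Rightarrow> nat" where
  "position i = (THE l. l < CARD('n) \<and> index_list ! l = i)"

lemma position: "position (i::'n::finite) < CARD('n)" "index_list ! position i = (i::'n)"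
proof -
  have "\<exists>!l. l < CARD('n) \<and> index_list ! l = i"
    using distinct_Ex1[OF index_list(1), of i] index_list(2)[where 'n='n] length_index_list[where 'n='n] by simp
  from theI'[OF this] show "position i < CARD('n)" "index_list ! position i = i"
    by (auto simp: position_def)
qed

lemma position_nth: "l < CARD('n) \<Longrightarrow> position (index_list ! l :: 'n::finite) = l"
  using position[of "index_list ! l :: 'n"] index_list(1) length_index_list[where 'n='n]
  by (metis nth_eq_iff_index_eq)

definition list_det :: "(real ^ 'n::finite) list \<Rightarrow> real" where
  "list_det us = det (\<chi> i. us ! position i)"

lemma alternating_list_det: "alternating CARD('n) (list_det :: (real ^ 'n::finite) list \<Rightarrow> real)"
  unfolding alternating_def multilinear_form_def
proof (intro conjI allI impI)
  fix us :: "(real ^ 'n) list" and l and u v :: "real ^ 'n" and a b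
  assume us: "length us = CARD('n)" and l: "l < CARD('n)"
  let ?l = "index_list ! l :: 'n"
  have upd: "(\<chi> i. us[l := x] ! position i) = (\<chi> i. if i = ?l then x else us ! position i)" for x
  proof -
    have "position i = l \<longleftrightarrow> i = ?l" for i :: 'n
      using position(2)[of i] position_nth[OF l] by metis
    then show ?thesis using us l by (simp add: vec_eq_iff nth_list_update eq_commute[of l])
  qed
  show "list_det (us[l := a *\<^sub>R u + b *\<^sub>R v]) = a * list_det (us[l := u]) + b * list_det (us[l := v])"
    unfolding list_det_def upd scalar_mult_eq_scaleR[symmetric] using det_row_add[of ?l "\<lambda>_. a *s u" "\<lambda>_. b *s v" "\<lambda>i. us ! position i"]
      det_row_mul[of ?l a "\<lambda>_. u" "\<lambda>i. us ! position i"] det_row_mul[of ?l b "\<lambda>_. v" "\<lambda>i. us ! position i"]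
    by simp
next
  fix us :: "(real ^ 'n) list" assume us: "length us = CARD('n)" and "\<not> distinct us"
  then obtain l m where lm: "l < CARD('n)" "m < CARD('n)" "l \<noteq> m" "us ! l = us ! m"
    unfolding distinct_conv_nth by auto
  have "(index_list ! l :: 'n) \<noteq> index_list ! m" using lm position_nth by metis
  then show "list_det us = 0"
    unfolding list_det_def using lm
    by (intro det_identical_rows[of "index_list ! l" "index_list ! m"]) (auto simp: row_def position_nth)
qed

lemma list_det_std_basis: "list_det (std_basis_list :: (real ^ 'n::finite) list) = 1"
proof -
  have "(\<chi> i. std_basis_list ! position i) = (mat 1 :: real ^ 'n ^ 'n)"
    using position[where 'n='n]
    by (auto simp: vec_eq_iff std_basis_list_def length_index_list mat_def axis_def)
  then show ?thesis by (simp add: list_det_def)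
qed

text \<open>The difference of the two sides is an alternating form, so it suffices to test it on lists of
  basis vectors. Those without repetition are rearrangements of \<open>std_basis_list\<close>, where it vanishes.\<close>

lemma alternating_top_degree:
  fixes w :: "(real ^ 'n::finite) list \<Rightarrow> real"
  assumes w: "alternating CARD('n) w" and us: "length us = CARD('n)"
  shows "w us = w std_basis_list * list_det us"
proof -
  let ?w = "\<lambda>us. w us - w std_basis_list * list_det us"
  have alt: "alternating CARD('n) ?w"
    using w alternating_list_det[where 'n='n] unfolding alternating_def multilinear_form_def
    by (auto simp: algebra_simps)
  have "?w us = 0"
  proof (rule multilinear_form_eq_0[OF _ _ us])
    show "multilinear_form CARD('n) ?w" using alt by (simp add: alternating_def)
    fix bs :: "(real ^ 'n) list" assume bs: "length bs = CARD('n)" "set bs \<subseteq> Basis"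
    show "?w bs = 0"
    proof (cases "distinct bs")
      case True
      have d: "distinct (std_basis_list :: (real ^ 'n) list)"
        using index_list(1) by (auto simp: std_basis_list_def distinct_map inj_on_def axis_eq_axis)
      have "set bs = Basis" using True bs distinct_card[OF True] by (intro card_subset_eq) auto
      also have "\<dots> = set (std_basis_list :: (real ^ 'n) list)"
        using index_list(2) by (auto simp: std_basis_list_def Basis_vec_def)
      finally have "mset bs = mset std_basis_list" using True d set_eq_iff_mset_eq_distinct by blast
      from alternating_mset[OF alt bs(1) this] show ?thesis by (simp add: list_det_std_basis)
    qed (use alt bs(1) in \<open>unfold alternating_def, blast\<close>)
  qed
  then show ?thesis by (simp only: right_minus_eq)
qed

text \<open>With the previous lemma: pulling back a form of top degree by \<open>L\<close> multiplies it by the determinant.\<close>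

lemma list_det_map:
  fixes L :: "real ^ 'n::finite \<Rightarrow> real ^ 'n"
  assumes "linear L" "length us = CARD('n)"
  shows "list_det (map L us) = det (matrix L) * list_det us"
proof -
  have "(\<chi> i::'n. map L us ! position i) = (\<chi> i. us ! position i) ** transpose (matrix L)"
  proof -
    have "map L us ! position i = (\<Sum>j\<in>UNIV. us ! position i $ j *\<^sub>R L (axis j 1))" for i :: 'n
    proof -
      let ?u = "us ! position i"
      have "?u = (\<Sum>j\<in>UNIV. ?u $ j *\<^sub>R axis j 1)"
        using basis_expansion[of ?u] by (simp add: scalar_mult_eq_scaleR)
      then have "L ?u = L (\<Sum>j\<in>UNIV. ?u $ j *\<^sub>R axis j 1)" by (rule arg_cong)
      also have "\<dots> = (\<Sum>j\<in>UNIV. ?u $ j *\<^sub>R L (axis j 1))"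
        by (simp only: linear_sum[OF assms(1)] linear_cmul[OF assms(1)])
      finally show ?thesis using position(1)[of i] assms(2) by simp
    qed
    then show ?thesis
      by (simp add: vec_eq_iff matrix_matrix_mult_def transpose_def matrix_def)
  qed
  then show ?thesis by (simp add: list_det_def det_mul)
qed

text \<open>Expanding the first argument in the basis reduces the degree. The rule serves twice: to
  differentiate a contraction with a vector field, and to follow a form along a curve.\<close>

lemma has_derivative_multilinear_form:
  fixes w :: "'z::real_normed_vector \<Rightarrow> 'a::euclidean_space list \<Rightarrow> real"
    and \<gamma> :: "'p::real_normed_vector \<Rightarrow> 'z"
  assumes S: "open S" and P: "open P" "p \<in> P" "\<gamma> ` P \<subseteq> S" and \<gamma>: "(\<gamma> has_derivative \<gamma>') (at p)"
    and w: "\<And>z. z \<in> S \<Longrightarrow> multilinear_form k (w z)"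
    and dw: "\<And>us. length us = k \<Longrightarrow> (\<lambda>z. w z us) differentiable (at (\<gamma> p))"
    and Us: "length Us = k" "length Us' = k"
      "\<And>i. i < k \<Longrightarrow> ((Us ! i) has_derivative (Us' ! i)) (at p)"
  shows "((\<lambda>q. w (\<gamma> q) (map (\<lambda>U. U q) Us)) has_derivative
    (\<lambda>h. fderiv (\<lambda>z. w z (map (\<lambda>U. U p) Us)) (\<gamma> p) (\<gamma>' h) +
       (\<Sum>i<k. w (\<gamma> p) ((map (\<lambda>U. U p) Us)[i := (Us' ! i) h])))) (at p)"
  using w dw Us
proof (induction k arbitrary: w Us Us')
  case 0
  then show ?case
    using has_derivative_compose[OF \<gamma> fderiv_works[OF 0(2)[of "[]"]]] by simp
next
  case (Suc k)
  obtain U Vs where U: "Us = U # Vs" using Suc.prems by (cases Us) auto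
  obtain U' Vs' where U': "Us' = U' # Vs'" using Suc.prems by (cases Us') auto
  let ?us = "map (\<lambda>U. U p) Vs"
  have len: "length Vs = k" "length Vs' = k" using Suc.prems U U' by auto
  have pS: "\<gamma> p \<in> S" using P by auto
  have dU: "(U has_derivative U') (at p)" using Suc.prems(5)[of 0] U U' by simp
  have lin: "w z (u # us) = (\<Sum>b\<in>Basis. (u \<bullet> b) * w z (b # us))" if "z \<in> S" "length us = k" for z u us
    by (rule linear_euclidean_sum[OF multilinear_form_linear_hd[OF Suc.prems(1)[OF that(1)] that(2)]])
  have IH: "((\<lambda>q. w (\<gamma> q) (b # map (\<lambda>U. U q) Vs)) has_derivative
    (\<lambda>h. fderiv (\<lambda>z. w z (b # ?us)) (\<gamma> p) (\<gamma>' h) + (\<Sum>i<k. w (\<gamma> p) (b # ?us[i := (Vs' ! i) h])))) (at p)" for b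
  proof (rule Suc.IH[where w = "\<lambda>z us. w z (b # us)"])
    fix z assume "z \<in> S" then show "multilinear_form k (\<lambda>us. w z (b # us))"
      by (rule multilinear_form_Cons[OF Suc.prems(1)])
  next
    fix i assume "i < k" then show "(Vs ! i has_derivative Vs' ! i) (at p)"
      using Suc.prems(5)[of "Suc i"] U U' by simp
  qed (use Suc.prems len in auto)
  have "((\<lambda>q. \<Sum>b\<in>Basis. (U q \<bullet> b) * w (\<gamma> q) (b # map (\<lambda>U. U q) Vs)) has_derivative
    (\<lambda>h. \<Sum>b\<in>Basis. (U p \<bullet> b) * (fderiv (\<lambda>z. w z (b # ?us)) (\<gamma> p) (\<gamma>' h) +
        (\<Sum>i<k. w (\<gamma> p) (b # ?us[i := (Vs' ! i) h]))) + (U' h \<bullet> b) * w (\<gamma> p) (b # ?us))) (at p)"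
    by (intro has_derivative_sum has_derivative_mult IH has_derivative_inner_left dU)
  then have d: "((\<lambda>q. w (\<gamma> q) (map (\<lambda>U. U q) Us)) has_derivative
    (\<lambda>h. \<Sum>b\<in>Basis. (U p \<bullet> b) * (fderiv (\<lambda>z. w z (b # ?us)) (\<gamma> p) (\<gamma>' h) +
        (\<Sum>i<k. w (\<gamma> p) (b # ?us[i := (Vs' ! i) h]))) + (U' h \<bullet> b) * w (\<gamma> p) (b # ?us))) (at p)"
  proof (rule has_derivative_transform_within_open[OF _ P(1,2)])
    fix q assume "q \<in> P"
    then show "(\<Sum>b\<in>Basis. (U q \<bullet> b) * w (\<gamma> q) (b # map (\<lambda>U. U q) Vs)) = w (\<gamma> q) (map (\<lambda>U. U q) Us)"
      using lin[of "\<gamma> q" "map (\<lambda>U. U q) Vs" "U q"] P(3) len U by auto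
  qed
  have hd: "fderiv (\<lambda>z. w z (U p # ?us)) (\<gamma> p) x = (\<Sum>b\<in>Basis. (U p \<bullet> b) * fderiv (\<lambda>z. w z (b # ?us)) (\<gamma> p) x)" for x
  proof -
    have "((\<lambda>z. \<Sum>b\<in>Basis. (U p \<bullet> b) * w z (b # ?us)) has_derivative
      (\<lambda>x. \<Sum>b\<in>Basis. (U p \<bullet> b) * fderiv (\<lambda>z. w z (b # ?us)) (\<gamma> p) x)) (at (\<gamma> p))"
      using Suc.prems(2) len by (intro has_derivative_sum has_derivative_mult_right fderiv_works) simp
    from has_derivative_transform_within_open[OF this S pS, of "\<lambda>z. w z (U p # ?us)"]
    have "((\<lambda>z. w z (U p # ?us)) has_derivative
      (\<lambda>x. \<Sum>b\<in>Basis. (U p \<bullet> b) * fderiv (\<lambda>z. w z (b # ?us)) (\<gamma> p) x)) (at (\<gamma> p))"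
      using lin len by simp
    from fderiv_eq[OF this] show ?thesis by simp
  qed
  have tl: "w (\<gamma> p) (u # ?us[i := x]) = (\<Sum>b\<in>Basis. (u \<bullet> b) * w (\<gamma> p) (b # ?us[i := x]))" for u i x
    by (rule lin[OF pS]) (simp add: len)
  show ?case
  proof (rule has_derivative_eq_rhs[OF d], rule ext)
    fix h
    have "(\<Sum>i<Suc k. w (\<gamma> p) ((map (\<lambda>U. U p) Us)[i := (Us' ! i) h])) =
       w (\<gamma> p) (U' h # ?us) + (\<Sum>i<k. w (\<gamma> p) (U p # ?us[i := (Vs' ! i) h]))"
      unfolding sum.lessThan_Suc_shift by (simp add: U U')
    also have "w (\<gamma> p) (U' h # ?us) = (\<Sum>b\<in>Basis. (U' h \<bullet> b) * w (\<gamma> p) (b # ?us))"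
      by (rule lin[OF pS]) (simp add: len)
    also have "(\<Sum>i<k. w (\<gamma> p) (U p # ?us[i := (Vs' ! i) h])) =
        (\<Sum>b\<in>Basis. (U p \<bullet> b) * (\<Sum>i<k. w (\<gamma> p) (b # ?us[i := (Vs' ! i) h])))"
      by (subst tl, subst sum.swap) (simp add: sum_distrib_left)
    finally show "(\<Sum>b\<in>Basis. (U p \<bullet> b) * (fderiv (\<lambda>z. w z (b # ?us)) (\<gamma> p) (\<gamma>' h) +
        (\<Sum>i<k. w (\<gamma> p) (b # ?us[i := (Vs' ! i) h]))) + (U' h \<bullet> b) * w (\<gamma> p) (b # ?us)) =
      fderiv (\<lambda>z. w z (map (\<lambda>U. U p) Us)) (\<gamma> p) (\<gamma>' h) +
       (\<Sum>i<Suc k. w (\<gamma> p) ((map (\<lambda>U. U p) Us)[i := (Us' ! i) h]))"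
      using hd by (simp add: U sum.distrib distrib_left)
  qed
qed


section \<open>Closed forms and Euler-like fields in a chart\<close>

abbreviation omit :: "nat \<Rightarrow> 'a list \<Rightarrow> 'a list" where
  "omit i us \<equiv> take i us @ drop (Suc i) us"

text \<open>The formula for \<open>d\<close> on arguments with constant components, for a form on an open subset of a
  vector space.\<close>

definition coord_ext_deriv :: "('a::real_normed_vector \<Rightarrow> 'a list \<Rightarrow> real) \<Rightarrow> 'a \<Rightarrow> 'a list \<Rightarrow> real" where
  "coord_ext_deriv w z us =
     (\<Sum>i<length us. (-1) ^ i * fderiv (\<lambda>z. w z (omit i us)) z (us ! i))"

lemma omit_omit: "i \<le> j \<Longrightarrow> Suc j < length us \<Longrightarrow> omit i (omit (Suc j) us) = omit j (omit i us)"
  by (rule nth_equalityI) (auto simp: nth_append min_def)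

lemma fderiv_symmetric_vector:
  fixes f :: "'a::real_normed_vector \<Rightarrow> 'b::euclidean_space"
  assumes f: "smooth_on S f" and S: "open S" "x \<in> S"
  shows "fderiv (\<lambda>y. fderiv f y u) x v = fderiv (\<lambda>y. fderiv f y v) x u"
proof (rule euclidean_eqI)
  fix c :: 'b
  have 1: "fderiv (\<lambda>y. g y \<bullet> c) y u = fderiv g y u \<bullet> c" if "smooth_on S g" "y \<in> S" for g :: "'a \<Rightarrow> 'b" and y u
  proof -
    have "((\<lambda>y. g y \<bullet> c) has_derivative (\<lambda>h. fderiv g y h \<bullet> c)) (at y)"
      by (intro has_derivative_inner_left smooth_on_has_derivative[OF that])
    from fderiv_eq[OF this] show ?thesis by simp
  qed
  have 2: "fderiv (\<lambda>y. fderiv f y u) x v \<bullet> c = fderiv (\<lambda>y. fderiv (\<lambda>y. f y \<bullet> c) y u) x v" for u v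
  proof -
    have "fderiv (\<lambda>y. fderiv f y u) x v \<bullet> c = fderiv (\<lambda>y. fderiv f y u \<bullet> c) x v"
      using 1[OF smooth_on_fderiv[OF f] S(2)] by simp
    also have "\<dots> = fderiv (\<lambda>y. fderiv (\<lambda>y. f y \<bullet> c) y u) x v"
      using 1[OF f] by (intro fun_cong[OF fderiv_cong_open[OF S]]) simp
    finally show ?thesis .
  qed
  have "smooth_on S (\<lambda>y. f y \<bullet> c)" by (intro smooth_on_inner f S smooth_on_const)
  from fderiv_symmetric[OF this S]
  show "fderiv (\<lambda>y. fderiv f y u) x v \<bullet> c = fderiv (\<lambda>y. fderiv f y v) x u \<bullet> c"
    by (simp add: 2)
qed

text \<open>Omitting two arguments in either order gives the same second derivative with opposite signs.\<close>

lemma coord_ext_deriv_twice: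
  assumes S: "open S" "z \<in> S" and w: "\<And>us. length us = k \<Longrightarrow> smooth_on S (\<lambda>z. w z us)"
    and us: "length us = Suc (Suc k)"
  shows "coord_ext_deriv (coord_ext_deriv w) z us = 0"
proof -
  define H where "H x a b = fderiv (\<lambda>z. fderiv (\<lambda>z. w z x) z a) z b" for x a b
  define T where "T = (\<lambda>(i, j). (-1) ^ (i + j) * H (omit j (omit i us)) (omit i us ! j) (us ! i))"
  let ?I = "{..<Suc (Suc k)} \<times> {..<Suc k}"
  let ?L = "{(i, j) \<in> ?I. i \<le> j}" and ?U = "{(i, j) \<in> ?I. j < i}"
  have len: "length (omit i us) = Suc k" if "i < Suc (Suc k)" for i using that us by auto
  have len2: "length (omit j (omit i us)) = k" if "i < Suc (Suc k)" "j < Suc k" for i j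
    using that us by auto
  have inner: "fderiv (\<lambda>z. coord_ext_deriv w z (omit i us)) z (us ! i)
      = (\<Sum>j<Suc k. (-1) ^ j * H (omit j (omit i us)) (omit i us ! j) (us ! i))"
    if i: "i < Suc (Suc k)" for i
  proof -
    have "((\<lambda>z. \<Sum>j<Suc k. (-1) ^ j * fderiv (\<lambda>z. w z (omit j (omit i us))) z (omit i us ! j)) has_derivative
      (\<lambda>h. \<Sum>j<Suc k. (-1) ^ j * fderiv (\<lambda>z. fderiv (\<lambda>z. w z (omit j (omit i us))) z (omit i us ! j)) z h)) (at z)"
      by (intro has_derivative_sum has_derivative_mult_right
          smooth_on_has_derivative[OF smooth_on_fderiv[OF w] S(2)] len2 i) simp
    from fderiv_eq[OF this] show ?thesis unfolding coord_ext_deriv_def len[OF i] H_def by simp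
  qed
  have "coord_ext_deriv (coord_ext_deriv w) z us
      = (\<Sum>i<Suc (Suc k). \<Sum>j<Suc k. T (i, j))"
    unfolding coord_ext_deriv_def[of "coord_ext_deriv w"] us T_def
    by (intro sum.cong refl) (simp only: inner lessThan_iff sum_distrib_left power_add case_prod_conv mult.assoc)
  also have "\<dots> = sum T ?I" by (simp only: sum.cartesian_product case_prod_eta)
  also have "\<dots> = sum T (?L \<union> ?U)" by (rule sum.cong) auto
  also have "\<dots> = sum T ?L + sum T ?U" by (rule sum.union_disjoint) (auto intro: finite_subset[of _ ?I])
  also have "sum T ?U = sum (\<lambda>p. - T p) ?L"
  proof (rule sum.reindex_bij_witness[of _ "\<lambda>(i, j). (Suc j, i)" "\<lambda>(i, j). (j, i - 1)"])
    fix p assume "p \<in> ?U"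
    then obtain i j where p: "p = (Suc i, j)" "j \<le> i" "i < Suc k" by (cases p; case_tac a) auto
    have "H (omit j (omit (Suc i) us)) (omit (Suc i) us ! j) (us ! Suc i)
        = H (omit i (omit j us)) (omit j us ! i) (us ! j)"
    proof -
      have "omit (Suc i) us ! j = us ! j" "omit j us ! i = us ! Suc i"
        using p us by (auto simp: nth_append min_def)
      moreover have "omit j (omit (Suc i) us) = omit i (omit j us)"
        using p us by (intro omit_omit) auto
      moreover have "H x a b = H x b a" if "length x = k" for x a b
        unfolding H_def by (rule fderiv_symmetric[OF w[OF that] S])
      ultimately show ?thesis using len2[of j i] p by simp
    qed
    then show "- T (case p of (i, j) \<Rightarrow> (j, i - 1)) = T p" using p by (simp add: T_def add.commute)
  qed auto
  finally show ?thesis by (simp add: sum_negf)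
qed

text \<open>The picture in one chart of a closed form \<open>w\<close> and a vector field \<open>X\<close> with \<open>d (i\<^sub>X w) = f w\<close>.\<close>

locale homogeneous_form =
  fixes S :: "'a::euclidean_space set" and k :: nat
    and w :: "'a \<Rightarrow> 'a list \<Rightarrow> real" and X :: "'a \<Rightarrow> 'a" and f :: "'a \<Rightarrow> real"
  assumes open_S: "open S"
    and k_pos: "0 < k"
    and smooth_w: "length us = k \<Longrightarrow> smooth_on S (\<lambda>z. w z us)"
    and alternating_w: "z \<in> S \<Longrightarrow> alternating k (w z)"
    and closed_w: "z \<in> S \<Longrightarrow> length us = Suc k \<Longrightarrow> coord_ext_deriv w z us = 0"
    and smooth_X: "smooth_on S X"
    and smooth_f: "smooth_on S f"
    and homogeneous: "z \<in> S \<Longrightarrow> length us = k \<Longrightarrow>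
      coord_ext_deriv (\<lambda>z us. w z (X z # us)) z us = f z * w z us"
begin

lemma multilinear_w: "z \<in> S \<Longrightarrow> multilinear_form k (w z)"
  using alternating_w by (simp add: alternating_def)

lemma w_Cons_sum:
  assumes "z \<in> S" "length us = k - 1"
  shows "w z (u # us) = (\<Sum>b\<in>Basis. (u \<bullet> b) * w z (b # us))"
  using multilinear_w[OF assms(1)] assms(2) k_pos
  by (intro linear_euclidean_sum multilinear_form_linear_hd[of "k - 1"]) auto

lemma smooth_interior_product:
  assumes "length us = k - 1"
  shows "smooth_on S (\<lambda>z. w z (X z # us))"
proof (rule smooth_on_cong[OF open_S])
  show "smooth_on S (\<lambda>z. \<Sum>b\<in>Basis. (X z \<bullet> b) * w z (b # us))"
    using assms k_pos
    by (intro smooth_on_sum smooth_on_mult smooth_on_inner smooth_on_const smooth_X smooth_w open_S) auto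
qed (use w_Cons_sum assms in simp)

text \<open>As \<open>f w = d (i\<^sub>X w)\<close> is closed, \<open>df \<and> w = 0\<close>; this is its contraction with \<open>v\<close>.\<close>

lemma differential_wedge_zero:
  assumes z: "z \<in> S" and us: "length us = k"
  shows "fderiv f z v * w z us = (\<Sum>i<k. fderiv f z (us ! i) * w z (us[i := v]))"
proof -
  let ?us = "v # us"
  have len: "length (omit i ?us) = k" if "i < Suc k" for i using that us by auto
  have "0 = coord_ext_deriv (coord_ext_deriv (\<lambda>z us. w z (X z # us))) z ?us"
    using smooth_interior_product us k_pos z
    by (intro coord_ext_deriv_twice[OF open_S, of _ "k - 1", symmetric]) auto
  also have "\<dots> = coord_ext_deriv (\<lambda>z us. f z * w z us) z ?us"
    unfolding coord_ext_deriv_def[of "coord_ext_deriv _"] coord_ext_deriv_def[of "\<lambda>z us. f z * w z us"]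
    using us by (intro sum.cong refl arg_cong2[of _ _ _ _ "(*)"] fun_cong[OF fderiv_cong_open[OF open_S z]]
        homogeneous len) auto
  also have "\<dots> = (\<Sum>i<Suc k. f z * ((-1) ^ i * fderiv (\<lambda>z. w z (omit i ?us)) z (?us ! i))
      + (-1) ^ i * (fderiv f z (?us ! i) * w z (omit i ?us)))"
    unfolding coord_ext_deriv_def
  proof (rule sum.cong)
    fix i assume "i \<in> {..<Suc k}"
    then have i: "i < Suc k" by simp
    have "((\<lambda>z. f z * w z (omit i ?us)) has_derivative
       (\<lambda>h. f z * fderiv (\<lambda>z. w z (omit i ?us)) z h + fderiv f z h * w z (omit i ?us))) (at z)"
      by (intro has_derivative_mult smooth_on_has_derivative[OF smooth_f z]
          smooth_on_has_derivative[OF smooth_w[OF len[OF i]] z])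
    from fderiv_eq[OF this]
    show "(-1) ^ i * fderiv (\<lambda>z. f z * w z (omit i ?us)) z (?us ! i)
        = f z * ((-1) ^ i * fderiv (\<lambda>z. w z (omit i ?us)) z (?us ! i))
          + (-1) ^ i * (fderiv f z (?us ! i) * w z (omit i ?us))"
      by (simp add: algebra_simps)
  qed (use us in simp)
  also have "\<dots> = f z * coord_ext_deriv w z ?us + (\<Sum>i<Suc k. (-1) ^ i * (fderiv f z (?us ! i) * w z (omit i ?us)))"
    using us by (simp only: coord_ext_deriv_def sum.distrib sum_distrib_left length_Cons)
  also have "coord_ext_deriv w z ?us = 0" using z us by (intro closed_w) auto
  also have "(\<Sum>i<Suc k. (-1) ^ i * (fderiv f z (?us ! i) * w z (omit i ?us)))
      = fderiv f z v * w z us + (\<Sum>i<k. (-1) ^ Suc i * (fderiv f z (us ! i) * w z (v # omit i us)))"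
    unfolding sum.lessThan_Suc_shift by simp
  also have "(\<Sum>i<k. (-1) ^ Suc i * (fderiv f z (us ! i) * w z (v # omit i us)))
      = - (\<Sum>i<k. fderiv f z (us ! i) * w z (us[i := v]))"
    unfolding sum_negf[symmetric]
  proof (rule sum.cong)
    fix i assume "i \<in> {..<k}"
    then have "w z (v # omit i us) = (-1) ^ i * w z (us[i := v])"
      using alternating_hd[OF alternating_w[OF z] us] by simp
    then show "(-1) ^ Suc i * (fderiv f z (us ! i) * w z (v # omit i us))
        = - (fderiv f z (us ! i) * w z (us[i := v]))"
      by (simp add: power_mult_distrib[symmetric] mult.left_commute flip: mult.assoc)
  qed simp
  finally show ?thesis by simp
qed

text \<open>The product rule splits \<open>d (i\<^sub>X w)\<close> into derivatives of \<open>w\<close> and derivatives of \<open>X\<close>. Since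
  \<open>w\<close> is closed, the former combine to the derivative of \<open>w\<close> in the direction \<open>X\<close>.\<close>

lemma lie_derivative_formula:
  assumes z: "z \<in> S" and us: "length us = k"
  shows "fderiv (\<lambda>z. w z us) z (X z) + (\<Sum>i<k. w z (us[i := fderiv X z (us ! i)])) = f z * w z us"
proof -
  have product: "fderiv (\<lambda>z. w z (X z # xs)) z u
      = fderiv (\<lambda>y. w y (X z # xs)) z u + w z (fderiv X z u # xs)" if xs: "length xs = k - 1" for xs u
  proof -
    have "((\<lambda>q. w q (hd (map (\<lambda>U. U q) [X]) # xs)) has_derivative
      (\<lambda>h. fderiv (\<lambda>y. w y (hd (map (\<lambda>U. U z) [X]) # xs)) z h +
         (\<Sum>i<1. w z (hd ((map (\<lambda>U. U z) [X])[i := ([fderiv X z] ! i) h]) # xs)))) (at z)"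
    proof (rule has_derivative_multilinear_form[OF open_S open_S z _ has_derivative_ident,
          where w = "\<lambda>q ys. w q (hd ys # xs)" and k = 1])
      fix q assume q: "q \<in> S"
      have lin: "linear (\<lambda>u. w q (u # xs))"
        using multilinear_form_linear_hd[of "k - 1" "w q" xs] multilinear_w[OF q] k_pos xs by simp
      show "multilinear_form 1 (\<lambda>ys. w q (hd ys # xs))"
        by (auto simp: multilinear_form_def length_Suc_conv linear_add[OF lin] linear_cmul[OF lin])
    next
      fix ys :: "'a list"
      show "(\<lambda>q. w q (hd ys # xs)) differentiable (at z)"
        using xs k_pos by (intro smooth_on_differentiable[OF smooth_w z]) auto
    qed (use smooth_on_has_derivative[OF smooth_X z] in auto)
    from fderiv_eq[OF this] show ?thesis by simp
  qed
  have "f z * w z us = coord_ext_deriv (\<lambda>z us. w z (X z # us)) z us"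
    using homogeneous[OF assms] by simp
  also have "\<dots> = (\<Sum>i<k. (-1) ^ i * fderiv (\<lambda>y. w y (X z # omit i us)) z (us ! i))
      + (\<Sum>i<k. (-1) ^ i * w z (fderiv X z (us ! i) # omit i us))"
    unfolding coord_ext_deriv_def sum.distrib[symmetric] us
  proof (rule sum.cong[OF refl])
    fix i assume "i \<in> {..<k}"
    then have "length (omit i us) = k - 1" using us by auto
    from product[OF this]
    show "(-1) ^ i * fderiv (\<lambda>z. w z (X z # omit i us)) z (us ! i) =
      (-1) ^ i * fderiv (\<lambda>y. w y (X z # omit i us)) z (us ! i) + (-1) ^ i * w z (fderiv X z (us ! i) # omit i us)"
      by (simp add: distrib_left)
  qed
  also have "(\<Sum>i<k. (-1) ^ i * w z (fderiv X z (us ! i) # omit i us)) = (\<Sum>i<k. w z (us[i := fderiv X z (us ! i)]))"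
  proof (rule sum.cong)
    fix i assume "i \<in> {..<k}"
    then have "w z (fderiv X z (us ! i) # omit i us) = (-1) ^ i * w z (us[i := fderiv X z (us ! i)])"
      using alternating_hd[OF alternating_w[OF z] us] by simp
    then show "(-1) ^ i * w z (fderiv X z (us ! i) # omit i us) = w z (us[i := fderiv X z (us ! i)])"
      by (simp add: power_mult_distrib[symmetric] flip: mult.assoc)
  qed simp
  also have "(\<Sum>i<k. (-1) ^ i * fderiv (\<lambda>y. w y (X z # omit i us)) z (us ! i)) = fderiv (\<lambda>z. w z us) z (X z)"
  proof -
    have "0 = coord_ext_deriv w z (X z # us)" using z us by (simp add: closed_w)
    also have "\<dots> = fderiv (\<lambda>z. w z us) z (X z)
        + (\<Sum>i<k. (-1) ^ Suc i * fderiv (\<lambda>y. w y (X z # omit i us)) z (us ! i))"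
      unfolding coord_ext_deriv_def length_Cons us sum.lessThan_Suc_shift by simp
    finally show ?thesis by (simp add: sum_negf)
  qed
  finally show ?thesis by simp
qed

end

text \<open>Solutions of \<open>s g' = (\<phi> - \<phi> 0) g\<close> differ by the positive factor
  \<open>exp (\<integral> (\<phi> - \<phi> 0) / s)\<close> from their initial value; the integrand extends continuously to \<open>0\<close>.\<close>

lemma singular_ode_zero_iff:
  fixes g g' \<phi> \<phi>' :: "real \<Rightarrow> real"
  assumes g: "\<And>s. (g has_real_derivative g' s) (at s)"
    and \<phi>: "\<And>s. (\<phi> has_real_derivative \<phi>' s) (at s)"
    and ode: "\<And>s. s * g' s = (\<phi> s - \<phi> 0) * g s"
    and b: "0 \<le> b"
  shows "g b = 0 \<longleftrightarrow> g 0 = 0"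
proof (cases "b = 0")
  case False
  then have b: "0 < b" using b by simp
  define a where "a s = (if s = 0 then \<phi>' 0 else (\<phi> s - \<phi> 0) / s)" for s
  have "isCont a s" for s
  proof (cases "s = 0")
    case True
    have "((\<lambda>h. (\<phi> (0 + h) - \<phi> 0) / h) \<longlongrightarrow> \<phi>' 0) (at 0)" using \<phi>[of 0] by (simp add: DERIV_def)
    then have "(a \<longlongrightarrow> \<phi>' 0) (at 0)"
      by (rule Lim_transform_eventually) (auto simp: eventually_at_filter a_def)
    then show ?thesis using True by (simp add: isCont_def a_def)
  next
    case False
    have 1: "isCont (\<lambda>s. (\<phi> s - \<phi> 0) / s) s"
      using False DERIV_isCont[OF \<phi>] by (intro continuous_intros) auto
    have 2: "eventually (\<lambda>s. (\<phi> s - \<phi> 0) / s = a s) (nhds s)"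
      by (rule eventually_mono[OF t1_space_nhds[OF False]]) (simp add: a_def)
    show ?thesis using 1 isCont_cong[OF 2] by simp
  qed
  then have cont: "continuous_on {0..b} a" by (simp add: continuous_at_imp_continuous_on)
  define G where "G s = integral {0..s} a" for s
  have G: "(G has_real_derivative a s) (at s within {0..b})" if "s \<in> {0..b}" for s
    unfolding G_def using integral_has_real_derivative[OF cont that] .
  have contG: "continuous_on {0..b} G"
    using DERIV_continuous_on[of "{0..b}" G a] G by blast
  have "g b * exp (- G b) = g 0 * exp (- G 0)"
  proof (rule DERIV_isconst2[OF b, of "\<lambda>s. g s * exp (- G s)"])
    show "continuous_on {0..b} (\<lambda>s. g s * exp (- G s))"
      using DERIV_isCont[OF g] by (intro continuous_intros contG continuous_at_imp_continuous_on) auto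
  next
    fix s assume s: "0 < s" "s < b"
    have "(G has_real_derivative a s) (at s)"
      using G[of s] s at_within_Icc_at[of 0 s b] by simp
    then have "((\<lambda>s. g s * exp (- G s)) has_real_derivative
        g' s * exp (- G s) + g s * (exp (- G s) * (- a s))) (at s)"
      using g by (auto intro!: derivative_eq_intros)
    moreover have "g' s = a s * g s" using ode[of s] s by (simp add: a_def field_simps)
    ultimately show "((\<lambda>s. g s * exp (- G s)) has_real_derivative 0) (at s)" by (simp add: algebra_simps)
  qed (use b in auto)
  then show ?thesis by (metis exp_not_eq_zero mult_eq_0_iff)
qed simp

text \<open>If the degree is below the dimension, some direction \<open>v\<close> is annihilated by every covector \<open>\<alpha>\<close>
  with \<open>\<alpha> \<and> w = 0\<close> at the centre. The coefficients of \<open>w\<close> along the ray through \<open>v\<close> obey one and the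
  same linear equation, so this persists on the ray, and \<open>df \<and> w = 0\<close> gives \<open>df(v) = 0\<close> there.\<close>

lemma (in homogeneous_form) constant_factor_along_ray:
  fixes \<theta> :: "'a \<Rightarrow> 'a"
  assumes smooth_\<theta>: "smooth_on UNIV \<theta>" and range_\<theta>: "range \<theta> \<subseteq> S"
    and surj: "surj (fderiv \<theta> 0)"
    and euler: "\<And>z. X (\<theta> z) = fderiv \<theta> z z"
    and nonzero: "length us0 = k" "w (\<theta> 0) us0 \<noteq> 0"
    and degree: "k < DIM('a)"
  obtains v where "v \<noteq> 0" "\<And>s. 0 \<le> s \<Longrightarrow> f (\<theta> (s *\<^sub>R v)) = real k"
proof -
  have in_S: "\<theta> z \<in> S" for z using range_\<theta> by auto
  have lin_\<theta>: "linear (fderiv \<theta> z)" for z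
    using fderiv_bounded_linear[OF smooth_\<theta>] bounded_linear.linear by blast
  have d\<theta>: "(\<theta> has_derivative fderiv \<theta> z) (at z)" for z
    using smooth_on_has_derivative[OF smooth_\<theta>] by simp
  have dd\<theta>: "((\<lambda>y. fderiv \<theta> y u) has_derivative fderiv (\<lambda>y. fderiv \<theta> y u) z) (at z)" for u z
    using smooth_on_has_derivative[OF smooth_on_fderiv[OF smooth_\<theta>]] by simp
  \<comment> \<open>Differentiate \<open>X (\<theta> z) = D\<theta>\<^sub>z z\<close> in the direction \<open>u\<close> and use the symmetry of \<open>D\<^sup>2\<theta>\<close>.\<close>
  have second: "fderiv (\<lambda>y. fderiv \<theta> y u) z z = fderiv X (\<theta> z) (fderiv \<theta> z u) - fderiv \<theta> z u" for u z
  proof -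
    have expand: "L y = (\<Sum>b\<in>Basis. (y \<bullet> b) *\<^sub>R L b)" if "linear L" for L :: "'a \<Rightarrow> 'a" and y
    proof -
      have "L (\<Sum>b\<in>Basis. (y \<bullet> b) *\<^sub>R b) = (\<Sum>b\<in>Basis. (y \<bullet> b) *\<^sub>R L b)"
        using that by (simp add: linear_sum linear_cmul)
      then show ?thesis by (simp add: euclidean_representation)
    qed
    have eq: "(\<Sum>b\<in>Basis. (y \<bullet> b) *\<^sub>R fderiv \<theta> y b) = X (\<theta> y)" for y
      by (simp only: expand[OF lin_\<theta>, symmetric] euler)
    have "((\<lambda>y. \<Sum>b\<in>Basis. (y \<bullet> b) *\<^sub>R fderiv \<theta> y b) has_derivative
      (\<lambda>u. \<Sum>b\<in>Basis. (z \<bullet> b) *\<^sub>R fderiv (\<lambda>y. fderiv \<theta> y b) z u + (u \<bullet> b) *\<^sub>R fderiv \<theta> z b)) (at z)"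
      by (intro has_derivative_sum has_derivative_scaleR has_derivative_inner_left has_derivative_ident dd\<theta>)
    then have "((\<lambda>y. X (\<theta> y)) has_derivative
      (\<lambda>u. \<Sum>b\<in>Basis. (z \<bullet> b) *\<^sub>R fderiv (\<lambda>y. fderiv \<theta> y b) z u + (u \<bullet> b) *\<^sub>R fderiv \<theta> z b)) (at z)"
      by (simp only: eq)
    from fun_cong[OF has_derivative_unique[OF
        has_derivative_compose[OF d\<theta> smooth_on_has_derivative[OF smooth_X in_S]] this], of u]
    have "fderiv X (\<theta> z) (fderiv \<theta> z u)
        = (\<Sum>b\<in>Basis. (z \<bullet> b) *\<^sub>R fderiv (\<lambda>y. fderiv \<theta> y b) z u + (u \<bullet> b) *\<^sub>R fderiv \<theta> z b)" .
    also have "\<dots> = (\<Sum>b\<in>Basis. (z \<bullet> b) *\<^sub>R fderiv (\<lambda>y. fderiv \<theta> y u) z b) + fderiv \<theta> z u"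
      using fderiv_symmetric_vector[OF smooth_\<theta> open_UNIV UNIV_I, of _ z u]
      by (simp only: sum.distrib expand[OF lin_\<theta>, of z u, symmetric])
    also have "(\<Sum>b\<in>Basis. (z \<bullet> b) *\<^sub>R fderiv (\<lambda>y. fderiv \<theta> y u) z b) = fderiv (\<lambda>y. fderiv \<theta> y u) z z"
      using dd\<theta> has_derivative_linear by (intro expand[symmetric]) blast
    finally show ?thesis by simp
  qed
  \<comment> \<open>Each coefficient of the pulled back form along the ray through \<open>v\<close> satisfies \<open>s g' = (f - k) g\<close>:
    by the relation just proved, the \<open>k\<close> arguments contribute \<open>-k\<close> to the Lie derivative.\<close>
  have coefficient: "\<exists>g'. \<forall>s. ((\<lambda>s. w (\<theta> (s *\<^sub>R v)) (map (fderiv \<theta> (s *\<^sub>R v)) us)) has_real_derivative g' s) (at s)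
      \<and> s * g' s = (f (\<theta> (s *\<^sub>R v)) - k) * w (\<theta> (s *\<^sub>R v)) (map (fderiv \<theta> (s *\<^sub>R v)) us)"
    if us: "length us = k" for us v
  proof -
    define D where "D s h = fderiv (\<lambda>z. w z (map (fderiv \<theta> (s *\<^sub>R v)) us)) (\<theta> (s *\<^sub>R v)) (fderiv \<theta> (s *\<^sub>R v) (h *\<^sub>R v))
      + (\<Sum>i<k. w (\<theta> (s *\<^sub>R v)) ((map (fderiv \<theta> (s *\<^sub>R v)) us)
          [i := fderiv (\<lambda>y. fderiv \<theta> y (us ! i)) (s *\<^sub>R v) (h *\<^sub>R v)]))" for s h :: real
    have d: "((\<lambda>s. w (\<theta> (s *\<^sub>R v)) (map (fderiv \<theta> (s *\<^sub>R v)) us)) has_derivative D s) (at s)" for s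
    proof -
      let ?Us = "map (\<lambda>u s. fderiv \<theta> (s *\<^sub>R v) u) us"
      let ?Us' = "map (\<lambda>u h. fderiv (\<lambda>y. fderiv \<theta> y u) (s *\<^sub>R v) (h *\<^sub>R v)) us"
      have line: "((\<lambda>s. s *\<^sub>R v) has_derivative (\<lambda>h. h *\<^sub>R v)) (at s)"
        by (auto intro!: derivative_eq_intros)
      have "((\<lambda>q. w (\<theta> (q *\<^sub>R v)) (map (\<lambda>U. U q) ?Us)) has_derivative
        (\<lambda>h. fderiv (\<lambda>z. w z (map (\<lambda>U. U s) ?Us)) (\<theta> (s *\<^sub>R v)) (fderiv \<theta> (s *\<^sub>R v) (h *\<^sub>R v)) +
          (\<Sum>i<k. w (\<theta> (s *\<^sub>R v)) ((map (\<lambda>U. U s) ?Us)[i := (?Us' ! i) h])))) (at s)"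
      proof (rule has_derivative_multilinear_form[OF open_S open_UNIV UNIV_I])
        show "((\<lambda>q. \<theta> (q *\<^sub>R v)) has_derivative (\<lambda>h. fderiv \<theta> (s *\<^sub>R v) (h *\<^sub>R v))) (at s)"
          by (rule has_derivative_compose[OF line d\<theta>])
      next
        fix i assume "i < k"
        then show "(?Us ! i has_derivative ?Us' ! i) (at s)"
          using has_derivative_compose[OF line dd\<theta>[of "us ! i"]] us by simp
      qed (use in_S us multilinear_w smooth_on_differentiable[OF smooth_w] in auto)
      then show ?thesis using us by (simp add: D_def[abs_def] o_def)
    qed
    have euler_eq: "D s s = (f (\<theta> (s *\<^sub>R v)) - k) * w (\<theta> (s *\<^sub>R v)) (map (fderiv \<theta> (s *\<^sub>R v)) us)" for s
    proof -
      let ?z = "s *\<^sub>R v" and ?ws = "map (fderiv \<theta> (s *\<^sub>R v)) us"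
      have "w (\<theta> ?z) (?ws[i := fderiv (\<lambda>y. fderiv \<theta> y (us ! i)) ?z ?z])
          = w (\<theta> ?z) (?ws[i := fderiv X (\<theta> ?z) (?ws ! i)]) - w (\<theta> ?z) ?ws" if "i < k" for i
      proof -
        have "?ws ! i = fderiv \<theta> ?z (us ! i)" using that us by simp
        then have "w (\<theta> ?z) (?ws[i := fderiv (\<lambda>y. fderiv \<theta> y (us ! i)) ?z ?z])
            = w (\<theta> ?z) (?ws[i := fderiv X (\<theta> ?z) (?ws ! i) - ?ws ! i])" by (simp only: second)
        also have "\<dots> = w (\<theta> ?z) (?ws[i := fderiv X (\<theta> ?z) (?ws ! i)]) - w (\<theta> ?z) (?ws[i := ?ws ! i])"
          using us that by (intro linear_diff[OF multilinear_form_linear[OF multilinear_w[OF in_S]]]) auto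
        finally show ?thesis by (simp only: list_update_id)
      qed
      then have "D s s = (fderiv (\<lambda>z. w z ?ws) (\<theta> ?z) (X (\<theta> ?z))
          + (\<Sum>i<k. w (\<theta> ?z) (?ws[i := fderiv X (\<theta> ?z) (?ws ! i)]))) - k * w (\<theta> ?z) ?ws"
        unfolding D_def euler by (simp add: sum_subtractf)
      also have "\<dots> = f (\<theta> ?z) * w (\<theta> ?z) ?ws - k * w (\<theta> ?z) ?ws"
        using lie_derivative_formula[OF in_S, of ?ws ?z] us by simp
      finally show ?thesis by (simp add: left_diff_distrib)
    qed
    have lin_D: "D s h = D s 1 * h" for s h
      using linear_cmul[OF has_derivative_linear[OF d], of s h 1] by simp
    have "((\<lambda>s. w (\<theta> (s *\<^sub>R v)) (map (fderiv \<theta> (s *\<^sub>R v)) us)) has_real_derivative D s 1) (at s)" for s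
      using d[of s] lin_D[of s] unfolding has_field_derivative_def by (metis (no_types, lifting) ext)
    moreover have "s * D s 1 = (f (\<theta> (s *\<^sub>R v)) - k) * w (\<theta> (s *\<^sub>R v)) (map (fderiv \<theta> (s *\<^sub>R v)) us)" for s
      using euler_eq[of s] lin_D[of s s] by (simp add: mult.commute)
    ultimately show ?thesis by (intro exI[of _ "\<lambda>s. D s 1"]) simp
  qed
  define w0 where "w0 us = w (\<theta> 0) (map (fderiv \<theta> 0) us)" for us
  obtain us where us: "length us = k" "w0 us \<noteq> 0"
  proof -
    have "map (fderiv \<theta> 0) (map (inv (fderiv \<theta> 0)) us0) = us0"
      by (simp add: comp_def surj_f_inv_f[OF surj])
    then show thesis using nonzero that[of "map (inv (fderiv \<theta> 0)) us0"] by (simp add: w0_def del: map_map)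
  qed
  have lin_w0: "linear (\<lambda>u. w0 (us[i := u]))" if "i < k" for i
  proof -
    have "linear ((\<lambda>u. w (\<theta> 0) ((map (fderiv \<theta> 0) us)[i := u])) \<circ> fderiv \<theta> 0)"
      using us that by (intro linear_compose lin_\<theta> multilinear_form_linear[OF multilinear_w[OF in_S]]) auto
    then show ?thesis by (simp add: w0_def comp_def map_update)
  qed
  have "span (set us) \<noteq> UNIV"
  proof
    assume "span (set us) = UNIV"
    then have "DIM('a) \<le> card (set us)" by (metis dim_UNIV dim_le_card' dim_span finite_set)
    then show False using card_length[of us] us degree by simp
  qed
  then obtain x where x: "x \<notin> span (set us)" by auto
  \<comment> \<open>Subtract from \<open>x\<close> the combination of the \<open>us\<close> that makes \<open>w0\<close> vanish whenever \<open>v\<close> replaces one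
    of them; as \<open>x\<close> is outside their span, something is left.\<close>
  define v where "v = x - (\<Sum>i<k. (w0 (us[i := x]) / w0 us) *\<^sub>R us ! i)"
  have "v \<noteq> 0"
  proof
    assume "v = 0"
    then have "x = (\<Sum>i<k. (w0 (us[i := x]) / w0 us) *\<^sub>R us ! i)" by (simp add: v_def)
    also have "\<dots> \<in> span (set us)" using us by (intro span_sum span_scale span_base) auto
    finally show False using x by simp
  qed
  moreover have w0_v: "w0 (us[j := v]) = 0" if j: "j < k" for j
  proof -
    have other: "w0 (us[j := us ! i]) = (if i = j then w0 us else 0)" if "i < k" for i
    proof (cases "i = j")
      case False
      let ?xs = "map (fderiv \<theta> 0) (us[j := us ! i])"
      have "?xs ! i = ?xs ! j" using False that j us by simp
      then have "\<not> distinct ?xs" using nth_eq_iff_index_eq[of ?xs i j] False that j us by auto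
      then show ?thesis
        using alternating_w[OF in_S, of 0] us False by (simp add: alternating_def w0_def)
    qed simp
    have "w0 (us[j := v]) = w0 (us[j := x]) - (\<Sum>i<k. (w0 (us[i := x]) / w0 us) * w0 (us[j := us ! i]))"
      unfolding v_def linear_diff[OF lin_w0[OF j]] linear_sum[OF lin_w0[OF j]] linear_cmul[OF lin_w0[OF j]] by simp
    also have "(\<Sum>i<k. (w0 (us[i := x]) / w0 us) * w0 (us[j := us ! i])) = (\<Sum>i<k. if i = j then w0 (us[j := x]) else 0)"
      using us by (intro sum.cong) (auto simp: other)
    also have "\<dots> = w0 (us[j := x])" using j by simp
    finally show ?thesis by simp
  qed
  define \<phi> where "\<phi> s = f (\<theta> (s *\<^sub>R v))" for s
  define \<phi>' where "\<phi>' s = fderiv f (\<theta> (s *\<^sub>R v)) (fderiv \<theta> (s *\<^sub>R v) v)" for s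
  define g where "g us s = w (\<theta> (s *\<^sub>R v)) (map (fderiv \<theta> (s *\<^sub>R v)) us)" for us s
  have g_0: "g us 0 = w0 us" for us by (simp add: g_def w0_def)
  have d\<phi>: "(\<phi> has_real_derivative \<phi>' s) (at s)" for s
  proof -
    have line: "((\<lambda>s. s *\<^sub>R v) has_derivative (\<lambda>h. h *\<^sub>R v)) (at s)"
      by (auto intro!: derivative_eq_intros)
    have df: "(f has_derivative fderiv f (\<theta> (s *\<^sub>R v))) (at (\<theta> (s *\<^sub>R v)))"
      by (rule smooth_on_has_derivative[OF smooth_f in_S])
    have "(\<phi> has_derivative (\<lambda>h. fderiv f (\<theta> (s *\<^sub>R v)) (fderiv \<theta> (s *\<^sub>R v) (h *\<^sub>R v)))) (at s)"
      unfolding \<phi>_def by (rule has_derivative_compose[OF has_derivative_compose[OF line d\<theta>] df])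
    then show ?thesis
      using has_derivative_linear[OF df]
      by (simp add: has_field_derivative_def linear_cmul[OF lin_\<theta>] linear_cmul \<phi>'_def mult_commute_abs)
  qed
  \<comment> \<open>At the centre the left side of the equation vanishes and the coefficient does not.\<close>
  have \<phi>_0: "\<phi> 0 = k"
  proof -
    obtain g' where "\<And>s. s * g' s = (\<phi> s - k) * g us s"
      using coefficient[OF us(1), of v] unfolding \<phi>_def g_def by blast
    from this[of 0] show ?thesis using us(2) g_0 by simp
  qed
  have zero_iff: "g xs s = 0 \<longleftrightarrow> w0 xs = 0" if xs: "length xs = k" and s: "0 \<le> s" for xs s
  proof -
    have "\<exists>g'. \<forall>s. (g xs has_real_derivative g' s) (at s) \<and> s * g' s = (\<phi> s - \<phi> 0) * g xs s"
      using coefficient[OF xs, of v] unfolding \<phi>_0 unfolding \<phi>_def g_def[abs_def] .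
    then obtain g' where g': "\<And>s. (g xs has_real_derivative g' s) (at s)" "\<And>s. s * g' s = (\<phi> s - \<phi> 0) * g xs s"
      by auto
    show ?thesis using singular_ode_zero_iff[OF g'(1) d\<phi> g'(2) s] g_0 by simp
  qed
  have "\<phi>' s = 0" if s: "0 \<le> s" for s
  proof -
    let ?L = "fderiv \<theta> (s *\<^sub>R v)"
    have "\<phi>' s * g us s = (\<Sum>i<k. fderiv f (\<theta> (s *\<^sub>R v)) (map ?L us ! i) * w (\<theta> (s *\<^sub>R v)) ((map ?L us)[i := ?L v]))"
      unfolding \<phi>'_def g_def using us by (intro differential_wedge_zero in_S) simp
    also have "\<dots> = 0"
    proof (intro sum.neutral ballI)
      fix i assume "i \<in> {..<k}"
      then have "g (us[i := v]) s = 0" using zero_iff us s w0_v by simp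
      then show "fderiv f (\<theta> (s *\<^sub>R v)) (map ?L us ! i) * w (\<theta> (s *\<^sub>R v)) ((map ?L us)[i := ?L v]) = 0"
        by (simp add: g_def map_update)
    qed
    finally show ?thesis using zero_iff[OF us(1) s] us(2) by simp
  qed
  then have "\<phi> s = \<phi> 0" if "0 \<le> s" for s
  proof (cases "s = 0")
    case False
    then have "0 < s" using that by simp
    show ?thesis
    proof (rule DERIV_isconst2[OF \<open>0 < s\<close>])
      show "continuous_on {0..s} \<phi>"
        using DERIV_isCont[OF d\<phi>] by (simp add: continuous_at_imp_continuous_on)
      show "(\<phi> has_real_derivative 0) (at t)" if "0 < t" "t < s" for t
        using d\<phi>[of t] \<open>\<And>s. 0 \<le> s \<Longrightarrow> \<phi>' s = 0\<close>[of t] that by simp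
    qed (use \<open>0 < s\<close> in auto)
  qed simp
  then have "f (\<theta> (s *\<^sub>R v)) = k" if "0 \<le> s" for s using that \<phi>_0 by (simp add: \<phi>_def)
  ultimately show thesis using that by blast
qed


section \<open>Straightening a density\<close>

text \<open>Multiplies the \<open>m\<close>-th coordinate of \<open>z - c\<close> by \<open>s\<close>.\<close>

definition squeeze :: "real ^ 'n::finite \<Rightarrow> 'n \<Rightarrow> real \<Rightarrow> real ^ 'n \<Rightarrow> real ^ 'n" where
  "squeeze c m s z = z + ((s - 1) * (z - c) $ m) *\<^sub>R axis m 1"

lemma squeeze_1 [simp]: "squeeze c m 1 z = z"
  by (simp add: squeeze_def)

lemma squeeze_in_ball:
  assumes "z \<in> ball c r" "0 \<le> s" "s \<le> 1"
  shows "squeeze c m s z \<in> ball c r"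
proof -
  have "norm (squeeze c m s z - c) \<le> norm (z - c)"
  proof (rule norm_le_componentwise_cart)
    fix i
    have "(z - c) $ m + (s - 1) * (z - c) $ m = s * (z - c) $ m" by (simp add: algebra_simps)
    then have "\<bar>(z - c) $ m + (s - 1) * (z - c) $ m\<bar> = s * \<bar>(z - c) $ m\<bar>"
      using assms by (simp only: abs_mult abs_of_nonneg)
    also have "\<dots> \<le> 1 * \<bar>(z - c) $ m\<bar>" using assms by (intro mult_right_mono) auto
    finally show "norm ((squeeze c m s z - c) $ i) \<le> norm ((z - c) $ i)"
      by (auto simp: squeeze_def axis_def algebra_simps)
  qed
  then show ?thesis using assms by (simp add: dist_norm norm_minus_commute)
qed

lemma squeeze_has_derivative:
  "(squeeze c m s has_derivative (\<lambda>h. (h - h $ m *\<^sub>R axis m 1) + (s * h $ m) *\<^sub>R axis m 1)) (at z)"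
proof -
  have "(squeeze c m s has_derivative (\<lambda>h. h + ((s - 1) * h $ m) *\<^sub>R axis m 1)) (at z)"
    unfolding squeeze_def[abs_def] by (auto intro!: derivative_eq_intros)
  then show ?thesis by (simp add: algebra_simps)
qed

text \<open>Differentiating under the integral in the direction \<open>m\<close> produces an extra factor \<open>s\<close>; with all
  powers of \<open>s\<close> included, the family is closed under differentiation.\<close>

definition moment :: "real ^ 'n::finite \<Rightarrow> 'n \<Rightarrow> nat \<Rightarrow> (real ^ 'n \<Rightarrow> real) \<Rightarrow> real ^ 'n \<Rightarrow> real" where
  "moment c m j f z = integral {0..1} (\<lambda>s. s ^ j * f (squeeze c m s z))"

lemma continuous_squeeze: "continuous_on A (\<lambda>(z, s). squeeze c m s z)"
  unfolding squeeze_def case_prod_beta by (intro continuous_intros)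

lemma continuous_moment_integrand:
  assumes "continuous_on (ball c r) f"
  shows "continuous_on (ball c r \<times> cbox 0 1) (\<lambda>(z, s). s ^ j * f (squeeze c m s z))"
proof -
  have "continuous_on (ball c r \<times> cbox 0 1) (\<lambda>p. f (case p of (z, s) \<Rightarrow> squeeze c m s z))"
    by (rule continuous_on_compose2[OF assms continuous_squeeze])
      (auto simp del: mem_ball intro: squeeze_in_ball)
  then have "continuous_on (ball c r \<times> cbox 0 1) (\<lambda>p. snd p ^ j * f (case p of (z, s) \<Rightarrow> squeeze c m s z))"
    by (intro continuous_intros)
  then show ?thesis by (simp add: case_prod_beta)
qed

lemma moment_integrable:
  assumes "continuous_on (ball c r) f" "z \<in> ball c r"
  shows "(\<lambda>s. s ^ j * f (squeeze c m s z)) integrable_on cbox 0 1"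
proof (rule integrable_continuous)
  have "continuous_on (cbox 0 1) (\<lambda>s. case (z, s) of (z, s) \<Rightarrow> s ^ j * f (squeeze c m s z))"
    by (rule continuous_on_compose2[OF continuous_moment_integrand[OF assms(1)]])
      (use assms(2) in \<open>auto intro!: continuous_intros\<close>)
  then show "continuous_on (cbox 0 1) (\<lambda>s. s ^ j * f (squeeze c m s z))" by simp
qed

text \<open>The theorem on differentiation under the integral sign wants the derivative as a bounded linear
  map that depends continuously on all variables; continuity is checked on basis vectors.\<close>

lemma moment_has_derivative:
  assumes f: "smooth_on (ball c r) f" and z: "z \<in> ball c r"
  shows "(moment c m j f has_derivative
    (\<lambda>h. moment c m j (\<lambda>y. fderiv f y (h - h $ m *\<^sub>R axis m 1)) z
       + h $ m * moment c m (Suc j) (\<lambda>y. fderiv f y (axis m 1)) z)) (at z)"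
proof -
  let ?D = "\<lambda>z s h. s ^ j * fderiv f (squeeze c m s z) (h - h $ m *\<^sub>R axis m 1)
      + h $ m * (s ^ Suc j * fderiv f (squeeze c m s z) (axis m 1))"
  have d: "((\<lambda>z. s ^ j * f (squeeze c m s z)) has_derivative ?D z s) (at z)"
    if "z \<in> ball c r" "s \<in> cbox 0 1" for z s
  proof -
    have "squeeze c m s z \<in> ball c r" using that by (intro squeeze_in_ball) auto
    note df = smooth_on_has_derivative[OF f this]
    have "((\<lambda>z. s ^ j * f (squeeze c m s z)) has_derivative
      (\<lambda>h. s ^ j * fderiv f (squeeze c m s z) ((h - h $ m *\<^sub>R axis m 1) + (s * h $ m) *\<^sub>R axis m 1))) (at z)"
      by (intro has_derivative_mult_right has_derivative_compose[OF squeeze_has_derivative df])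
    moreover have "s ^ j * fderiv f (squeeze c m s z) ((h - h $ m *\<^sub>R axis m 1) + (s * h $ m) *\<^sub>R axis m 1) = ?D z s h" for h
      unfolding linear_add[OF has_derivative_linear[OF df]] linear_cmul[OF has_derivative_linear[OF df]]
      by (simp add: algebra_simps)
    ultimately show ?thesis by simp
  qed
  have apply_D: "blinfun_apply (Blinfun (?D z s)) = ?D z s" if "z \<in> ball c r" "s \<in> cbox 0 1" for z s
    using has_derivative_bounded_linear[OF d[OF that]] by (rule bounded_linear_Blinfun_apply)
  have cont: "continuous_on (ball c r) (\<lambda>y. fderiv f y v)" for v
    using smooth_on_continuous[OF smooth_on_fderiv[OF f]] .
  have contD: "continuous_on (ball c r \<times> cbox 0 1) (\<lambda>(z, s). Blinfun (?D z s))"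
  proof (rule continuous_on_blinfun_componentwise)
    fix b :: "real ^ 'a"
    have "continuous_on (ball c r \<times> cbox 0 1) (\<lambda>p. (case p of (z, s) \<Rightarrow> s ^ j * fderiv f (squeeze c m s z) (b - b $ m *\<^sub>R axis m 1))
        + b $ m * (case p of (z, s) \<Rightarrow> s ^ Suc j * fderiv f (squeeze c m s z) (axis m 1)))"
      by (intro continuous_intros continuous_moment_integrand cont)
    then show "continuous_on (ball c r \<times> cbox 0 1) (\<lambda>p. blinfun_apply (case p of (z, s) \<Rightarrow> Blinfun (?D z s)) b)"
      by (rule continuous_on_eq) (auto simp only: case_prod_conv apply_D mem_Times_iff fst_conv snd_conv)
  qed
  have "((\<lambda>z. integral (cbox 0 1) (\<lambda>s. s ^ j * f (squeeze c m s z))) has_derivative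
      blinfun_apply (integral (cbox 0 1) (\<lambda>s. Blinfun (?D z s)))) (at z within ball c r)"
  proof (rule leibniz_rule[OF _ _ contD z convex_ball])
    show "((\<lambda>z. s ^ j * f (squeeze c m s z)) has_derivative blinfun_apply (Blinfun (?D z s))) (at z within ball c r)"
      if "z \<in> ball c r" "s \<in> cbox 0 1" for z s
      unfolding apply_D[OF that] using d[OF that] by (rule has_derivative_at_withinI)
    show "(\<lambda>s. s ^ j * f (squeeze c m s z)) integrable_on cbox 0 1" if "z \<in> ball c r" for z
      by (rule moment_integrable[OF smooth_on_continuous[OF f] that])
  qed
  then have 1: "(moment c m j f has_derivative blinfun_apply (integral (cbox 0 1) (\<lambda>s. Blinfun (?D z s)))) (at z)"
    using at_within_open[OF z open_ball] by (simp add: moment_def[abs_def])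
  have 2: "blinfun_apply (integral (cbox 0 1) (\<lambda>s. Blinfun (?D z s))) h =
      moment c m j (\<lambda>y. fderiv f y (h - h $ m *\<^sub>R axis m 1)) z
       + h $ m * moment c m (Suc j) (\<lambda>y. fderiv f y (axis m 1)) z" for h
  proof -
    have "(\<lambda>s. Blinfun (?D z s)) integrable_on cbox 0 1"
    proof (rule integrable_continuous)
      have "continuous_on (cbox 0 1) (\<lambda>s. case (z, s) of (z, s) \<Rightarrow> Blinfun (?D z s))"
        by (rule continuous_on_compose2[OF contD]) (use z in \<open>auto intro!: continuous_intros\<close>)
      then show "continuous_on (cbox 0 1) (\<lambda>s. Blinfun (?D z s))" by simp
    qed
    then have "blinfun_apply (integral (cbox 0 1) (\<lambda>s. Blinfun (?D z s))) h
        = integral (cbox 0 1) (\<lambda>s. blinfun_apply (Blinfun (?D z s)) h)" by (rule blinfun_apply_integral)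
    also have "\<dots> = integral (cbox 0 1) (\<lambda>s. ?D z s h)"
      by (rule Henstock_Kurzweil_Integration.integral_cong) (simp only: apply_D[OF z])
    also have "\<dots> = integral (cbox 0 1) (\<lambda>s. s ^ j * fderiv f (squeeze c m s z) (h - h $ m *\<^sub>R axis m 1))
        + h $ m * integral (cbox 0 1) (\<lambda>s. s ^ Suc j * fderiv f (squeeze c m s z) (axis m 1))"
      by (subst Henstock_Kurzweil_Integration.integral_add)
        (auto simp only: integral_mult_right intro!: moment_integrable[OF cont z] integrable_on_mult_right)
    finally show ?thesis by (simp only: moment_def cbox_interval)
  qed
  show ?thesis by (rule has_derivative_eq_rhs[OF 1 ext[OF 2]])
qed

lemma smooth_on_moment:
  assumes "smooth_on (ball c r) f"
  shows "smooth_on (ball c r) (moment c m j f)"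
proof -
  have "smooth_on (ball c r) f \<Longrightarrow> Ck_on k (ball c r) (moment c m j f)" for k f j
  proof (induction k arbitrary: f j)
    case 0
    show ?case
      using integral_continuous_on_param[OF continuous_moment_integrand[OF smooth_on_continuous[OF 0]]]
      by (simp add: moment_def[abs_def])
  next
    case (Suc k)
    show ?case
    proof (rule Ck_on_SucI[OF open_ball moment_has_derivative[OF Suc.prems]])
      fix v :: "real ^ 'a"
      show "Ck_on k (ball c r) (\<lambda>z. moment c m j (\<lambda>y. fderiv f y (v - v $ m *\<^sub>R axis m 1)) z
          + v $ m * moment c m (Suc j) (\<lambda>y. fderiv f y (axis m 1)) z)"
        by (intro Ck_on_add Ck_on_bounded_bilinear[OF _ bounded_bilinear_mult] Ck_on_const open_ball
            Suc.IH smooth_on_fderiv Suc.prems)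
    qed
  qed
  then show ?thesis using assms by (simp add: smooth_on_def)
qed

text \<open>\<open>primitive c m \<rho>\<close> integrates \<open>\<rho>\<close> in the \<open>m\<close>-th coordinate from the hyperplane through \<open>c\<close>;
  after substitution the interval is fixed, so that derivatives can be taken under the integral.\<close>

definition primitive :: "real ^ 'n::finite \<Rightarrow> 'n \<Rightarrow> (real ^ 'n \<Rightarrow> real) \<Rightarrow> real ^ 'n \<Rightarrow> real" where
  "primitive c m \<rho> z = (z - c) $ m * moment c m 0 \<rho> z"

lemma smooth_on_primitive:
  assumes "smooth_on (ball c r) \<rho>"
  shows "smooth_on (ball c r) (primitive c m \<rho>)"
proof -
  have "smooth_on (ball c r) (\<lambda>z. (z - c) $ m)"
    by (intro smooth_on_linear_compose[OF open_ball bounded_linear_vec_nth]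
        smooth_on_minus open_ball smooth_on_id smooth_on_const)
  then show ?thesis unfolding primitive_def[abs_def]
    by (intro smooth_on_mult open_ball smooth_on_moment assms)
qed

text \<open>By the product rule the left side is \<open>\<integral> d/ds (s \<rho>(squeeze c m s z)) ds\<close> over \<open>[0,1]\<close>.\<close>

lemma primitive_derivative:
  assumes \<rho>: "smooth_on (ball c r) \<rho>" and z: "z \<in> ball c r"
  shows "fderiv (primitive c m \<rho>) z (axis m 1) = \<rho> z"
proof -
  let ?y = "(z - c) $ m"
  have "(primitive c m \<rho> has_derivative
    (\<lambda>h. ?y * (moment c m 0 (\<lambda>y. fderiv \<rho> y (h - h $ m *\<^sub>R axis m 1)) z
       + h $ m * moment c m (Suc 0) (\<lambda>y. fderiv \<rho> y (axis m 1)) z) + h $ m * moment c m 0 \<rho> z)) (at z)"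
    unfolding primitive_def[abs_def]
    by (rule has_derivative_mult[OF _ moment_has_derivative[OF assms]]) (auto intro!: derivative_eq_intros)
  from fderiv_eq[OF this]
  have 1: "fderiv (primitive c m \<rho>) z (axis m 1)
      = ?y * (moment c m 0 (\<lambda>y. fderiv \<rho> y 0) z + moment c m (Suc 0) (\<lambda>y. fderiv \<rho> y (axis m 1)) z)
        + moment c m 0 \<rho> z" by simp
  have lin: "linear (fderiv \<rho> (squeeze c m s z))" if "s \<in> {0..1}" for s
    using that z squeeze_in_ball[OF z] fderiv_bounded_linear[OF \<rho>] bounded_linear.linear by auto
  have "moment c m 0 (\<lambda>y. fderiv \<rho> y 0) z = integral {0..1 :: real} (\<lambda>s. 0 :: real)"
    unfolding moment_def by (rule Henstock_Kurzweil_Integration.integral_cong) (simp add: linear_0[OF lin])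
  then have 2: "moment c m 0 (\<lambda>y. fderiv \<rho> y 0) z = 0" by simp
  have "((\<lambda>s. ?y * (s ^ 1 * fderiv \<rho> (squeeze c m s z) (axis m 1)) + s ^ 0 * \<rho> (squeeze c m s z)) has_integral
      (1 * \<rho> (squeeze c m 1 z) - 0 * \<rho> (squeeze c m 0 z))) {0..1}"
  proof (rule fundamental_theorem_of_calculus)
    fix s :: real assume s: "s \<in> {0..1}"
    have line: "((\<lambda>s. squeeze c m s z) has_derivative (\<lambda>h. (h * ?y) *\<^sub>R axis m 1)) (at s)"
      unfolding squeeze_def by (auto intro!: derivative_eq_intros)
    have d\<rho>: "(\<rho> has_derivative fderiv \<rho> (squeeze c m s z)) (at (squeeze c m s z))"
      using s by (intro smooth_on_has_derivative[OF \<rho>] squeeze_in_ball z) auto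
    have "((\<lambda>s. s * \<rho> (squeeze c m s z)) has_derivative
        (\<lambda>h. s * fderiv \<rho> (squeeze c m s z) ((h * ?y) *\<^sub>R axis m 1) + h * \<rho> (squeeze c m s z))) (at s)"
      by (rule has_derivative_mult[OF has_derivative_ident has_derivative_compose[OF line d\<rho>]])
    then have "((\<lambda>s. s * \<rho> (squeeze c m s z)) has_vector_derivative
        (?y * (s ^ 1 * fderiv \<rho> (squeeze c m s z) (axis m 1)) + s ^ 0 * \<rho> (squeeze c m s z))) (at s)"
      unfolding has_vector_derivative_def linear_cmul[OF lin[OF s]] by (simp add: algebra_simps)
    then show "((\<lambda>s. s * \<rho> (squeeze c m s z)) has_vector_derivative
        (?y * (s ^ 1 * fderiv \<rho> (squeeze c m s z) (axis m 1)) + s ^ 0 * \<rho> (squeeze c m s z))) (at s within {0..1})"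
      by (rule has_vector_derivative_at_within)
  qed simp
  then have "\<rho> z = integral (cbox 0 1) (\<lambda>s. ?y * (s ^ 1 * fderiv \<rho> (squeeze c m s z) (axis m 1)) + s ^ 0 * \<rho> (squeeze c m s z))"
    by (simp add: integral_unique)
  also have "\<dots> = ?y * moment c m 1 (\<lambda>y. fderiv \<rho> y (axis m 1)) z + moment c m 0 \<rho> z"
    unfolding moment_def cbox_interval[symmetric]
    by (subst Henstock_Kurzweil_Integration.integral_add)
      (auto simp only: integral_mult_right intro!: integrable_on_mult_right
        moment_integrable[OF smooth_on_continuous[OF smooth_on_fderiv[OF \<rho>]] z]
        moment_integrable[OF smooth_on_continuous[OF \<rho>] z])
  finally show ?thesis unfolding 1 2 by simp
qed

text \<open>Cramer's rule for the identity matrix.\<close>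

lemma det_replace_row:
  fixes a :: "real ^ 'n::finite"
  shows "det (\<chi> i. if i = m then a else axis i 1) = a $ m"
proof -
  have 1: "row i (mat 1 :: real ^ 'n ^ 'n) = axis i 1" for i
    by (auto simp: row_def mat_def axis_def vec_eq_iff)
  have "det (\<chi> i. if i = m then \<Sum>i\<in>UNIV. a $ i *s row i (mat 1) else row i (mat 1)) = a $ m * det (mat 1 :: real ^ 'n ^ 'n)"
    by (rule cramer_lemma_transpose)
  then show ?thesis unfolding 1 basis_expansion by simp
qed

text \<open>Replace the \<open>m\<close>-th coordinate by the primitive of \<open>\<rho>\<close> in that coordinate. The new map has Jacobian
  \<open>\<rho>\<close>, so it carries the density \<open>\<rho>\<close> to the constant one. It is injective because the primitive is
  strictly monotone on segments in the direction \<open>m\<close>; its image is open by invariance of domain,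
  and its inverse is smooth because the derivative of the inverse is a rational expression in smooth
  functions composed with the inverse itself.\<close>

lemma straighten_density:
  fixes \<rho> :: "real ^ 'n::finite \<Rightarrow> real"
  assumes \<rho>: "smooth_on (ball c r) \<rho>" and nz: "\<And>z. z \<in> ball c r \<Longrightarrow> \<rho> z \<noteq> 0"
  obtains \<Sigma> \<Psi> where "smooth_on (ball c r) \<Sigma>" "open (\<Sigma> ` ball c r)" "smooth_on (\<Sigma> ` ball c r) \<Psi>"
    "\<And>z. z \<in> ball c r \<Longrightarrow> \<Psi> (\<Sigma> z) = z"
    "\<And>z. z \<in> ball c r \<Longrightarrow> det (matrix (fderiv \<Sigma> z)) = \<rho> z"
proof -
  let ?B = "ball c r"
  fix m :: 'n
  let ?e = "axis m 1 :: real ^ 'n"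
  define F where "F = primitive c m \<rho>"
  define \<Sigma> where "\<Sigma> z = z + (F z - z $ m) *\<^sub>R ?e" for z
  have F: "smooth_on ?B F" unfolding F_def by (rule smooth_on_primitive[OF \<rho>])
  have dF: "(F has_derivative fderiv F z) (at z)" if "z \<in> ?B" for z
    by (rule smooth_on_has_derivative[OF F that])
  have F_m: "fderiv F z ?e = \<rho> z" if "z \<in> ?B" for z
    unfolding F_def by (rule primitive_derivative[OF \<rho> that])
  have nth: "smooth_on A (\<lambda>z. z $ m)" for A :: "(real ^ 'n) set"
    by (rule smooth_on_bounded_linear[OF bounded_linear_vec_nth])
  have smooth_\<Sigma>: "smooth_on ?B \<Sigma>" unfolding \<Sigma>_def[abs_def]
    by (intro smooth_on_add smooth_on_scaleR smooth_on_minus open_ball smooth_on_id smooth_on_const F nth)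
  have d\<Sigma>: "(\<Sigma> has_derivative (\<lambda>h. h + (fderiv F z h - h $ m) *\<^sub>R ?e)) (at z)" if "z \<in> ?B" for z
    unfolding \<Sigma>_def[abs_def] by (auto intro!: derivative_eq_intros dF[OF that])
  have component: "\<Sigma> z $ i = (if i = m then F z else z $ i)" for z i
    by (simp add: \<Sigma>_def axis_def)
  have inj: "inj_on \<Sigma> ?B"
  proof (rule inj_onI, rule ccontr)
    fix z z' assume *: "z \<in> ?B" "z' \<in> ?B" "\<Sigma> z = \<Sigma> z'" "z \<noteq> z'"
    have eq: "F z = F z'" "\<And>i. i \<noteq> m \<Longrightarrow> z $ i = z' $ i"
      using *(3) component by metis+
    define d where "d = z' $ m - z $ m"
    have z': "z' = z + d *\<^sub>R ?e" using eq(2) by (auto simp: vec_eq_iff axis_def d_def)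
    have in_B: "z + (t * d) *\<^sub>R ?e \<in> ?B" if "0 \<le> t" "t \<le> 1" for t
    proof -
      have "z + (t * d) *\<^sub>R ?e = (1 - t) *\<^sub>R z + t *\<^sub>R z'" unfolding z' by (simp add: algebra_simps)
      then show ?thesis using convexD[OF convex_ball *(1,2), of "1 - t" t] that by simp
    qed
    have deriv: "((\<lambda>t. F (z + (t * d) *\<^sub>R ?e)) has_real_derivative d * \<rho> (z + (t * d) *\<^sub>R ?e)) (at t)"
      if "0 \<le> t" "t \<le> 1" for t
    proof -
      note dp = dF[OF in_B[OF that]]
      have eq: "fderiv F (z + (t * d) *\<^sub>R ?e) ((h * d) *\<^sub>R ?e) = d * \<rho> (z + (t * d) *\<^sub>R ?e) * h" for h
        unfolding linear_cmul[OF has_derivative_linear[OF dp]] F_m[OF in_B[OF that]] by simp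
      have "((\<lambda>t. z + (t * d) *\<^sub>R ?e) has_derivative (\<lambda>h. (h * d) *\<^sub>R ?e)) (at t)"
        by (auto intro!: derivative_eq_intros)
      from has_derivative_eq_rhs[OF has_derivative_compose[OF this dp] ext[OF eq]] show ?thesis
        by (simp only: has_field_derivative_def)
    qed
    obtain t where "0 < t" "t < 1" and
      "F (z + (1 * d) *\<^sub>R ?e) - F (z + (0 * d) *\<^sub>R ?e) = (1 - 0) * (d * \<rho> (z + (t * d) *\<^sub>R ?e))"
      using MVT2[OF zero_less_one deriv] by blast
    moreover have "\<rho> (z + (t * d) *\<^sub>R ?e) \<noteq> 0" using in_B nz \<open>0 < t\<close> \<open>t < 1\<close> by simp
    ultimately have "d = 0" using eq(1) z' by simp
    then show False using z' *(4) by simp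
  qed
  let ?T = "\<Sigma> ` ?B"
  define \<Psi> where "\<Psi> = inv_into ?B \<Sigma>"
  have \<Psi>\<Sigma>: "\<Psi> (\<Sigma> z) = z" if "z \<in> ?B" for z using inj that by (simp add: \<Psi>_def)
  have \<Sigma>\<Psi>: "\<Sigma> (\<Psi> y) = y" "\<Psi> y \<in> ?B" if "y \<in> ?T" for y
    using that f_inv_into_f inv_into_into by (metis \<Psi>_def)+
  have open_T: "open ?T" by (rule invariance_of_domain[OF smooth_on_continuous[OF smooth_\<Sigma>] open_ball inj])
  have cont_\<Psi>: "continuous_on ?T \<Psi>"
    by (rule continuous_on_inverse_open[OF open_ball smooth_on_continuous[OF smooth_\<Sigma>]]) (auto simp: \<Psi>\<Sigma>)
  \<comment> \<open>The inverse of the derivative of \<open>\<Sigma>\<close> at \<open>\<Psi> y\<close>, solved for the \<open>m\<close>-th coordinate.\<close>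
  define G where "G y h = h + (inverse (\<rho> (\<Psi> y)) * (h $ m - fderiv F (\<Psi> y) (h - h $ m *\<^sub>R ?e)) - h $ m) *\<^sub>R ?e" for y h
  have d\<Psi>: "(\<Psi> has_derivative G y) (at y)" if y: "y \<in> ?T" for y
  proof (rule has_derivative_inverse_basic[where f = \<Sigma> and g = \<Psi> and y = y, OF d\<Sigma>[OF \<Sigma>\<Psi>(2)[OF y]] _ _ _ open_T y])
    note dFy = dF[OF \<Sigma>\<Psi>(2)[OF y]]
    note lin = has_derivative_linear[OF dFy]
    show "bounded_linear (G y)"
      unfolding G_def by (intro bounded_linear_intros bounded_linear_vec_nth bounded_linear_compose[OF has_derivative_bounded_linear[OF dFy]])
    show "G y \<circ> (\<lambda>h. h + (fderiv F (\<Psi> y) h - h $ m) *\<^sub>R ?e) = id"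
    proof
      fix h
      let ?k = "h + (fderiv F (\<Psi> y) h - h $ m) *\<^sub>R ?e"
      have k: "?k $ m = fderiv F (\<Psi> y) h" by simp
      have "?k - ?k $ m *\<^sub>R ?e = h - h $ m *\<^sub>R ?e" unfolding k by (simp add: algebra_simps)
      then have "fderiv F (\<Psi> y) (?k - ?k $ m *\<^sub>R ?e) = fderiv F (\<Psi> y) h - h $ m * \<rho> (\<Psi> y)"
        by (simp only: linear_diff[OF lin] linear_cmul[OF lin] F_m[OF \<Sigma>\<Psi>(2)[OF y]] real_scaleR_def)
      then have "inverse (\<rho> (\<Psi> y)) * (?k $ m - fderiv F (\<Psi> y) (?k - ?k $ m *\<^sub>R ?e)) = h $ m"
        unfolding k using nz[OF \<Sigma>\<Psi>(2)[OF y]] by simp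
      then have "G y ?k = ?k + (h $ m - ?k $ m) *\<^sub>R ?e" by (simp only: G_def)
      also have "\<dots> = h" unfolding k by (simp add: algebra_simps)
      finally show "(G y \<circ> (\<lambda>h. h + (fderiv F (\<Psi> y) h - h $ m) *\<^sub>R ?e)) h = id h" by simp
    qed
    show "continuous (at y) \<Psi>" using cont_\<Psi> open_T y continuous_on_eq_continuous_at by blast
  qed (use \<Sigma>\<Psi> in auto)
  have "Ck_on q ?T \<Psi>" for q
  proof (induction q)
    case (Suc q)
    have along: "Ck_on q ?T (\<lambda>y. g (\<Psi> y))" if "smooth_on ?B g" for g :: "real ^ 'n \<Rightarrow> real"
      using that \<Sigma>\<Psi>(2) by (intro Ck_on_compose[OF open_T open_ball _ Suc]) (auto simp: smooth_on_def)
    show ?case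
    proof (rule Ck_on_SucI[OF open_T d\<Psi>])
      fix v
      let ?u = "v - v $ m *\<^sub>R ?e"
      have 1: "Ck_on q ?T (\<lambda>y. inverse (\<rho> (\<Psi> y)))"
        by (rule along[OF smooth_on_inverse[OF open_ball \<rho> nz]])
      have 2: "Ck_on q ?T (\<lambda>y. v $ m - fderiv F (\<Psi> y) ?u)"
        by (rule along[OF smooth_on_minus[OF open_ball smooth_on_const smooth_on_fderiv[OF F]]])
      have "Ck_on q ?T (\<lambda>y. v + (inverse (\<rho> (\<Psi> y)) * (v $ m - fderiv F (\<Psi> y) ?u) + (- v $ m)) *\<^sub>R ?e)"
        by (intro Ck_on_add[OF open_T] Ck_on_bounded_bilinear[OF open_T bounded_bilinear_scaleR]
            Ck_on_bounded_bilinear[OF open_T bounded_bilinear_mult] Ck_on_const 1 2)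
      then show "Ck_on q ?T (\<lambda>y. G y v)" by (simp add: G_def)
    qed
  qed (use cont_\<Psi> in simp)
  then have "smooth_on ?T \<Psi>" by (simp add: smooth_on_def)
  moreover have "det (matrix (fderiv \<Sigma> z)) = \<rho> z" if z: "z \<in> ?B" for z
  proof -
    have "matrix (fderiv \<Sigma> z) = (\<chi> i. if i = m then \<chi> j. fderiv F z (axis j 1) else axis i 1)"
      unfolding fderiv_eq[OF d\<Sigma>[OF z]] by (auto simp: matrix_def vec_eq_iff axis_def)
    then show ?thesis by (simp add: det_replace_row F_m[OF z])
  qed
  ultimately show thesis using that[of \<Sigma> \<Psi>] smooth_\<Sigma> open_T \<Psi>\<Sigma> by blast
qed


section \<open>Volume preserving flows with compact support\<close>

text \<open>Smooth functions that are flat at \<open>0\<close>; the powers of \<open>1/s\<close> make the family closed under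
  differentiation.\<close>

definition flat :: "nat \<Rightarrow> real \<Rightarrow> real" where
  "flat j s = (if s \<le> 0 then 0 else inverse s ^ j * exp (- inverse s))"

lemma flat_tendsto_0: "(flat j \<longlongrightarrow> 0) (at 0)"
proof (rule filterlim_split_at)
  show "(flat j \<longlongrightarrow> 0) (at_left 0)"
    by (rule Lim_transform_eventually[OF tendsto_const]) (auto simp: flat_def eventually_at_filter)
  have "((\<lambda>x::real. x ^ j / exp x) \<longlongrightarrow> 0) at_top" by (rule tendsto_power_div_exp_0)
  from filterlim_compose[OF this filterlim_inverse_at_top_right]
  show "(flat j \<longlongrightarrow> 0) (at_right 0)"
    by (rule Lim_transform_eventually) (auto simp: flat_def eventually_at_filter exp_minus divide_inverse)
qed

lemma flat_has_derivative:
  "(flat j has_real_derivative (flat (j + 2) s - j * flat (j + 1) s)) (at s)"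
proof -
  consider "s < 0" | "s = 0" | "0 < s" by linarith
  then show ?thesis
  proof cases
    case 1
    have "(flat j has_real_derivative 0) (at s)"
      by (rule has_field_derivative_transform_within_open[of "\<lambda>_. 0" _ _ "{..<0}"])
        (use 1 in \<open>auto simp: flat_def\<close>)
    then show ?thesis using 1 by (simp add: flat_def)
  next
    case 2
    have "((\<lambda>h. (flat j (0 + h) - flat j 0) / h) \<longlongrightarrow> 0) (at 0)"
      by (rule Lim_transform_eventually[OF flat_tendsto_0[of "Suc j"]])
        (auto simp: flat_def eventually_at_filter field_simps)
    then show ?thesis using 2 by (simp add: DERIV_def flat_def)
  next
    case 3
    have "((\<lambda>s. inverse s ^ j * exp (- inverse s)) has_real_derivative
      (inverse s ^ (j + 2) * exp (- inverse s) - j * (inverse s ^ (j + 1) * exp (- inverse s)))) (at s)"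
    proof -
      have inv: "(inverse has_real_derivative - (inverse s ^ Suc (Suc 0))) (at s)"
        using 3 by (intro DERIV_inverse) simp
      have 1: "((\<lambda>s. inverse s ^ j) has_real_derivative (- (j * inverse s ^ (j + 1)))) (at s)"
        using DERIV_power_Suc[OF inv, of "j - 1"] by (cases j) (auto simp: algebra_simps)
      have 2: "((\<lambda>s. exp (- inverse s)) has_real_derivative exp (- inverse s) * inverse s ^ 2) (at s)"
        using 3 by (auto intro!: derivative_eq_intros simp: power2_eq_square)
      show ?thesis
        by (rule DERIV_cong[OF DERIV_mult[OF 1 2]]) (simp add: algebra_simps power2_eq_square)
    qed
    then have "(flat j has_real_derivative
      (inverse s ^ (j + 2) * exp (- inverse s) - j * (inverse s ^ (j + 1) * exp (- inverse s)))) (at s)"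
      by (rule has_field_derivative_transform_within_open[of _ _ _ "{0<..}"]) (use 3 in \<open>auto simp: flat_def\<close>)
    then show ?thesis using 3 by (simp add: flat_def)
  qed
qed

lemma smooth_on_flat: "smooth_on UNIV (flat j)"
proof -
  have "Ck_on r UNIV (flat j)" for r j
  proof (induction r arbitrary: j)
    case 0
    show ?case using DERIV_isCont[OF flat_has_derivative] by (simp add: continuous_at_imp_continuous_on)
  next
    case (Suc r)
    show ?case
    proof (rule Ck_on_SucI)
      show "(flat j has_derivative (\<lambda>h. h * (flat (j + 2) s + (- real j) * flat (j + 1) s))) (at s)" for s
        using flat_has_derivative[of j s] by (simp add: has_field_derivative_def mult_commute_abs)
      show "Ck_on r UNIV (\<lambda>s. v * (flat (j + 2) s + (- real j) * flat (j + 1) s))" for v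
        by (intro Ck_on_add Ck_on_bounded_bilinear[OF _ bounded_bilinear_mult] Ck_on_const Suc open_UNIV)
    qed simp
  qed
  then show ?thesis by (simp add: smooth_on_def)
qed

text \<open>Rotations in the plane spanned by \<open>e\<close> and \<open>e'\<close>: \<open>proj\<close> is the orthogonal projection to the plane,
  \<open>quarter\<close> its composition with the quarter turn.\<close>

locale oriented_plane =
  fixes e e' :: "real ^ 'n::finite"
  assumes orthonormal: "e \<bullet> e = 1" "e' \<bullet> e' = 1" "e \<bullet> e' = 0"
begin

lemma orthonormal': "e' \<bullet> e = 0"
  using orthonormal(3) by (simp add: inner_commute)

definition proj :: "real ^ 'n \<Rightarrow> real ^ 'n" where
  "proj v = (v \<bullet> e) *\<^sub>R e + (v \<bullet> e') *\<^sub>R e'"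

definition quarter :: "real ^ 'n \<Rightarrow> real ^ 'n" where
  "quarter v = (v \<bullet> e) *\<^sub>R e' - (v \<bullet> e') *\<^sub>R e"

definition rot :: "real \<Rightarrow> real ^ 'n \<Rightarrow> real ^ 'n" where
  "rot a v = v + (cos a - 1) *\<^sub>R proj v + sin a *\<^sub>R quarter v"

lemma linear_proj: "linear proj" and linear_quarter: "linear quarter"
  unfolding proj_def[abs_def] quarter_def[abs_def]
  by (auto intro!: linearI simp: inner_add_left algebra_simps)

lemma linear_rot: "linear (rot a)"
  unfolding rot_def
  by (intro linear_compose_add linear_compose_scale_right linear_proj linear_quarter linear_id[unfolded id_def])

lemma proj_proj: "proj (proj v) = proj v"
  and proj_quarter: "proj (quarter v) = quarter v"
  and quarter_proj: "quarter (proj v) = quarter v"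
  and quarter_quarter: "quarter (quarter v) = - proj v"
  by (simp_all add: proj_def quarter_def inner_add_left inner_diff_left orthonormal orthonormal')

lemma rot_0 [simp]: "rot 0 v = v"
  by (simp add: rot_def)

lemma rot_rot: "rot a (rot b v) = rot (a + b) v"
proof -
  have p: "proj (rot b v) = cos b *\<^sub>R proj v + sin b *\<^sub>R quarter v"
    unfolding rot_def linear_add[OF linear_proj] linear_cmul[OF linear_proj] proj_proj proj_quarter
    by (simp add: algebra_simps)
  have q: "quarter (rot b v) = cos b *\<^sub>R quarter v - sin b *\<^sub>R proj v"
    unfolding rot_def linear_add[OF linear_quarter] linear_cmul[OF linear_quarter] quarter_proj quarter_quarter
    by (simp add: algebra_simps)
  show ?thesis
    unfolding rot_def[of a "rot b v"] p q unfolding rot_def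
    by (simp add: cos_add sin_add algebra_simps)
qed

lemma inner_quarter: "v \<bullet> quarter v = 0"
  by (simp add: quarter_def inner_diff_right)

lemma norm_rot [simp]: "norm (rot a v) = norm v"
proof -
  have "(v + (x - 1) *\<^sub>R proj v + y *\<^sub>R quarter v) \<bullet> (v + (x - 1) *\<^sub>R proj v + y *\<^sub>R quarter v)
      = v \<bullet> v + (y\<^sup>2 + x\<^sup>2 - 1) * ((v \<bullet> e)\<^sup>2 + (v \<bullet> e')\<^sup>2)" for x y
    unfolding proj_def quarter_def
    by (simp add: inner_add_left inner_add_right inner_diff_left inner_diff_right orthonormal orthonormal'
        inner_commute[of e v] inner_commute[of e' v] power2_eq_square algebra_simps)
  from this[of "cos a" "sin a"] show ?thesis by (simp add: norm_eq_sqrt_inner rot_def)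
qed

text \<open>Being a square of an orthogonal map, a rotation has determinant \<open>1\<close>.\<close>

lemma det_rot: "det (matrix (rot a)) = 1"
proof -
  have "orthogonal_transformation (rot (a / 2))"
    using linear_rot by (simp add: orthogonal_transformation)
  then have "\<bar>det (matrix (rot (a / 2)))\<bar> = 1" by (rule orthogonal_transformation_det)
  moreover have "rot a = rot (a / 2) \<circ> rot (a / 2)" by (auto simp: rot_rot)
  then have "det (matrix (rot a)) = det (matrix (rot (a / 2))) * det (matrix (rot (a / 2)))"
    using matrix_compose[OF linear_rot linear_rot] by (simp add: det_mul)
  ultimately show ?thesis by (metis abs_mult_self_eq mult_1)
qed

end

text \<open>A transvection is the square of the transvection with half the factor, and conjugate by a
  reflection to its inverse.\<close>

lemma det_transvection:
  fixes v u :: "real ^ 'n::finite"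
  assumes vu: "v \<bullet> u = 0"
  shows "det (matrix (\<lambda>h. h + (c * (v \<bullet> h)) *\<^sub>R u)) = 1"
proof -
  define T where "T c h = h + (c * (v \<bullet> h)) *\<^sub>R u" for c h
  have lin: "linear (T c)" for c
    unfolding T_def[abs_def] by (auto intro!: linearI simp: inner_add_right algebra_simps)
  have T_T: "T c \<circ> T d = T (c + d)" for c d
    using vu by (auto simp: T_def fun_eq_iff inner_add_right algebra_simps)
  have det_T: "det (matrix (T (c + d))) = det (matrix (T c)) * det (matrix (T d))" for c d
    using matrix_compose[OF lin[of d] lin[of c]] by (simp add: T_T det_mul)
  have "T 0 = id" by (auto simp: T_def)
  then have T_0: "det (matrix (T 0)) = 1" by (simp add: matrix_id_mat_1 det_I flip: id_def)
  have "det (matrix (T c)) = 1"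
  proof (cases "v = 0")
    case True
    then have "T c = T 0" by (auto simp: T_def)
    then show ?thesis using T_0 by simp
  next
    case False
    define R where "R h = h - (2 * (v \<bullet> h) / (v \<bullet> v)) *\<^sub>R v" for h
    have lin_R: "linear R"
      unfolding R_def[abs_def] by (auto intro!: linearI simp: inner_add_right algebra_simps add_divide_distrib)
    have vR: "v \<bullet> R h = - (v \<bullet> h)" for h using False by (simp add: R_def inner_diff_right)
    have RR: "R (R h) = h" for h
      unfolding R_def[of "R h"] vR by (simp add: R_def)
    have Ru: "R u = u" using vu by (simp add: R_def)
    have "R \<circ> (T c \<circ> R) = T (- c)"
      by (auto simp: fun_eq_iff T_def linear_add[OF lin_R] linear_diff[OF lin_R] linear_cmul[OF lin_R] vR RR Ru)
    then have "det (matrix (T (- c))) = det (matrix R) * (det (matrix (T c)) * det (matrix R))"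
      using matrix_compose[OF linear_compose[OF lin_R lin] lin_R] matrix_compose[OF lin_R lin]
      by (metis det_mul)
    also have "\<dots> = det (matrix (T c)) * det (matrix (R \<circ> R))"
      by (simp add: matrix_compose[OF lin_R lin_R] det_mul)
    also have "R \<circ> R = id" using RR by auto
    finally have "det (matrix (T (- c))) = det (matrix (T c))" by (simp add: matrix_id_mat_1 det_I flip: id_def)
    then have "det (matrix (T c)) * det (matrix (T c)) = 1"
      using det_T[of c "- c"] T_0 by simp
    moreover have "det (matrix (T c)) \<ge> 0" using det_T[of "c / 2" "c / 2"] by simp
    ultimately show ?thesis by (metis abs_of_nonneg abs_mult_self_eq real_sqrt_abs2 real_sqrt_one)
  qed
  then show ?thesis by (simp add: T_def[abs_def])
qed

text \<open>The flow moves each sphere about the midpoint of \<open>p\<close> and \<open>q\<close> by a rotation in a fixed plane; the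
  angle depends on the radius, vanishes for large radii, and makes time one exchange \<open>p\<close> and \<open>q\<close>.
  The dependence of the angle on the radius contributes a transvection to the derivative.\<close>

lemma volume_preserving_flow:
  fixes p q :: "real ^ 'n::finite"
  assumes n: "2 \<le> CARD('n)" and pq: "dist p q < \<epsilon>"
  obtains \<Phi> :: "real \<Rightarrow> real ^ 'n \<Rightarrow> real ^ 'n" where
    "smooth_on UNIV (\<lambda>(t, z). \<Phi> t z)" "\<And>z. \<Phi> 0 z = z" "\<And>s t z. \<Phi> s (\<Phi> t z) = \<Phi> (s + t) z"
    "\<Phi> 1 p = q" "\<And>t z. z \<notin> cball p (2 * \<epsilon>) \<Longrightarrow> \<Phi> t z = z"
    "\<And>t z. det (matrix (fderiv (\<Phi> t) z)) = 1"
proof (cases "p = q")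
  case True
  have "fderiv (\<lambda>z. z) z = id" for z :: "real ^ 'n"
    using fderiv_eq[OF has_derivative_ident] by (auto simp: id_def)
  moreover have "smooth_on UNIV (\<lambda>(t::real, z). z :: real ^ 'n)"
    unfolding case_prod_beta by (rule smooth_on_bounded_linear[OF bounded_linear_snd])
  ultimately show thesis using True by (intro that[of "\<lambda>t z. z"]) (auto simp: matrix_id_mat_1 det_I simp flip: id_def)
next
  case False
  define d where "d = dist p q"
  have d: "0 < d" "d < \<epsilon>" using False pq by (auto simp: d_def)
  define m where "m = midpoint p q"
  define e where "e = (1 / d) *\<^sub>R (q - p)"
  have e: "e \<bullet> e = 1"
    using d by (simp add: e_def dot_square_norm d_def dist_norm norm_minus_commute power2_eq_square)
  have p_m: "p - m = (- d / 2) *\<^sub>R e" and q_m: "q - m = (d / 2) *\<^sub>R e"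
    using d by (auto simp: m_def e_def midpoint_def algebra_simps simp flip: scaleR_2) 
  obtain x where x: "x \<noteq> 0" "orthogonal e x"
    using orthogonal_to_vector_exists[of e] n by auto
  define e' where "e' = (1 / norm x) *\<^sub>R x"
  interpret oriented_plane e e'
    using e x by unfold_locales (auto simp: e'_def orthogonal_def dot_square_norm power2_eq_square)
  \<comment> \<open>\<open>\<beta>\<close> takes the squared distance from \<open>m\<close>. Its factor makes it \<open>pi\<close> at the distance \<open>d / 2\<close> of \<open>p\<close>
    and \<open>q\<close> from \<open>m\<close>, so that time one is a half turn there.\<close>
  define \<beta> where "\<beta> s = flat 0 (\<epsilon>\<^sup>2 - s) * (pi / flat 0 (\<epsilon>\<^sup>2 - (d / 2)\<^sup>2))" for s
  have smooth_\<beta>: "smooth_on UNIV \<beta>" unfolding \<beta>_def[abs_def]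
    by (intro smooth_on_mult smooth_on_const smooth_on_compose[OF _ _ smooth_on_flat] smooth_on_minus smooth_on_id) auto
  have \<beta>_pi: "\<beta> ((d / 2)\<^sup>2) = pi"
  proof -
    have "(d / 2)\<^sup>2 < \<epsilon>\<^sup>2" using d by (intro power_strict_mono) auto
    then show ?thesis by (simp add: \<beta>_def flat_def)
  qed
  have \<beta>_0: "\<beta> s = 0" if "\<epsilon>\<^sup>2 \<le> s" for s using that by (simp add: \<beta>_def flat_def)
  define angle where "angle t z = t * \<beta> ((z - m) \<bullet> (z - m))" for t z
  define \<Phi> where "\<Phi> t z = m + rot (angle t z) (z - m)" for t z
  show thesis
  proof (rule that[of \<Phi>])
    show "smooth_on UNIV (\<lambda>(t, z). \<Phi> t z)"
    proof -
      have t: "smooth_on UNIV (\<lambda>p :: real \<times> (real ^ 'n). fst p)"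
        by (rule smooth_on_bounded_linear[OF bounded_linear_fst])
      have v: "smooth_on UNIV (\<lambda>p :: real \<times> (real ^ 'n). snd p - m)"
        by (intro smooth_on_minus smooth_on_bounded_linear[OF bounded_linear_snd] smooth_on_const open_UNIV)
      have \<beta>': "smooth_on UNIV (\<lambda>p :: real \<times> (real ^ 'n). \<beta> ((snd p - m) \<bullet> (snd p - m)))"
        by (rule smooth_on_compose[OF open_UNIV open_UNIV smooth_\<beta> smooth_on_inner[OF open_UNIV v v]]) simp
      have a: "smooth_on UNIV (\<lambda>p :: real \<times> (real ^ 'n). angle (fst p) (snd p))"
        unfolding angle_def by (intro smooth_on_mult open_UNIV t \<beta>')
      have sc: "smooth_on UNIV (\<lambda>p :: real \<times> (real ^ 'n). sin (angle (fst p) (snd p)))"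
        "smooth_on UNIV (\<lambda>p :: real \<times> (real ^ 'n). cos (angle (fst p) (snd p)))"
        using a by (auto intro!: smooth_on_compose[OF open_UNIV open_UNIV smooth_on_sin_cos(1)]
            smooth_on_compose[OF open_UNIV open_UNIV smooth_on_sin_cos(2)])
      show ?thesis
        unfolding case_prod_beta \<Phi>_def rot_def proj_def quarter_def
        by (intro smooth_on_add smooth_on_scaleR smooth_on_minus smooth_on_inner smooth_on_const v sc open_UNIV)
    qed
    show "\<Phi> 0 z = z" for z by (simp add: \<Phi>_def angle_def)
    have angle_\<Phi>: "angle s (\<Phi> t z) = angle s z" for s t z
      by (simp add: angle_def \<Phi>_def dot_square_norm)
    show "\<Phi> s (\<Phi> t z) = \<Phi> (s + t) z" for s t z
    proof -
      have "\<Phi> s (\<Phi> t z) = m + rot (angle s z) (rot (angle t z) (z - m))"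
        unfolding \<Phi>_def[of s "\<Phi> t z"] angle_\<Phi> by (simp add: \<Phi>_def)
      then show ?thesis by (simp add: rot_rot \<Phi>_def angle_def distrib_right)
    qed
    show "\<Phi> 1 p = q"
    proof -
      have "(p - m) \<bullet> (p - m) = (d / 2)\<^sup>2" unfolding p_m using e by (simp add: power2_eq_square)
      then have "\<Phi> 1 p = m + rot pi (p - m)" by (simp add: \<Phi>_def angle_def \<beta>_pi)
      also have "rot pi (p - m) = q - m"
      proof -
        have "proj (p - m) = p - m" unfolding p_m by (simp add: proj_def orthonormal)
        then have "rot pi (p - m) = (p - m) - ((p - m) + (p - m))"
          by (simp add: rot_def flip: scaleR_2)
        also have "\<dots> = - (p - m)" by simp
        finally show ?thesis unfolding p_m q_m by simp
      qed
      finally show ?thesis by simp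
    qed
    show "\<Phi> t z = z" if z: "z \<notin> cball p (2 * \<epsilon>)" for t z
    proof -
      have "dist p m \<le> d" using d by (simp add: m_def dist_midpoint d_def)
      then have "\<epsilon> \<le> norm (z - m)"
        using z d dist_triangle[of p z m] by (simp add: dist_norm norm_minus_commute)
      then have "\<epsilon>\<^sup>2 \<le> (z - m) \<bullet> (z - m)"
        using d unfolding dot_square_norm by (intro power_mono) auto
      then show ?thesis by (simp add: \<Phi>_def angle_def \<beta>_0)
    qed
    show "det (matrix (fderiv (\<Phi> t) z)) = 1" for t z
    proof -
      let ?v = "z - m" and ?b = "angle t z"
      define c where "c = 2 * t * fderiv \<beta> (?v \<bullet> ?v) 1"
      have d\<beta>: "(\<beta> has_derivative fderiv \<beta> (?v \<bullet> ?v)) (at (?v \<bullet> ?v))"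
        by (rule smooth_on_has_derivative[OF smooth_\<beta> UNIV_I])
      have d\<beta>': "fderiv \<beta> (?v \<bullet> ?v) h = h * fderiv \<beta> (?v \<bullet> ?v) 1" for h
        using linear_cmul[OF has_derivative_linear[OF d\<beta>], of h 1] by simp
      have dv: "((\<lambda>z. (z - m) \<bullet> (z - m)) has_derivative (\<lambda>h. 2 * (?v \<bullet> h))) (at z)"
        by (auto intro!: derivative_eq_intros simp: inner_commute)
      have "(angle t has_derivative (\<lambda>h. t * fderiv \<beta> (?v \<bullet> ?v) (2 * (?v \<bullet> h)))) (at z)"
        unfolding angle_def[abs_def]
        by (intro has_derivative_mult_right has_derivative_compose[OF dv d\<beta>])
      moreover have "t * fderiv \<beta> (?v \<bullet> ?v) (2 * (?v \<bullet> h)) = c * (?v \<bullet> h)" for h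
        unfolding d\<beta>'[of "2 * (?v \<bullet> h)"] by (simp add: c_def)
      ultimately have da: "(angle t has_derivative (\<lambda>h. c * (?v \<bullet> h))) (at z)" by simp
      have dl: "((\<lambda>z. L (z - m)) has_derivative L) (at z)" if "linear L" for L :: "real ^ 'n \<Rightarrow> real ^ 'n"
      proof -
        have "((\<lambda>z. z - m) has_derivative (\<lambda>h. h)) (at z)" by (auto intro!: derivative_eq_intros)
        from has_derivative_compose[OF this linear_imp_has_derivative[OF that]] show ?thesis .
      qed
      have 1: "(\<Phi> t has_derivative (\<lambda>h. rot ?b h
          + ((- sin ?b * (c * (?v \<bullet> h))) *\<^sub>R proj ?v + (cos ?b * (c * (?v \<bullet> h))) *\<^sub>R quarter ?v))) (at z)"
        unfolding \<Phi>_def[abs_def] rot_def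
        by (rule derivative_eq_intros da dl[OF linear_proj] dl[OF linear_quarter] refl)+
          (auto simp: algebra_simps)
      have 2: "rot ?b h + ((- sin ?b * (c * (?v \<bullet> h))) *\<^sub>R proj ?v + (cos ?b * (c * (?v \<bullet> h))) *\<^sub>R quarter ?v)
          = rot ?b (h + (c * (?v \<bullet> h)) *\<^sub>R quarter ?v)" for h
      proof -
        have q: "rot ?b (quarter ?v) = cos ?b *\<^sub>R quarter ?v - sin ?b *\<^sub>R proj ?v"
          by (simp add: rot_def proj_quarter quarter_quarter algebra_simps)
        show ?thesis
          unfolding linear_add[OF linear_rot] linear_cmul[OF linear_rot] q
          by (simp add: scaleR_right_diff_distrib mult_ac)
      qed
      have "fderiv (\<Phi> t) z = rot ?b \<circ> (\<lambda>h. h + (c * (?v \<bullet> h)) *\<^sub>R quarter ?v)"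
        unfolding comp_def by (rule fderiv_eq[OF has_derivative_eq_rhs[OF 1 ext[OF 2]]])
      moreover have "linear (\<lambda>h. h + (c * (?v \<bullet> h)) *\<^sub>R quarter ?v)"
        by (auto intro!: linearI simp: inner_add_right algebra_simps)
      ultimately show ?thesis
        by (simp add: matrix_compose[OF _ linear_rot] det_mul det_rot det_transvection[OF inner_quarter])
    qed
  qed
qed


section \<open>Local homogeneity and the degree of the form\<close>

lemma chart_image_eq: "is_chart c \<Longrightarrow> z \<in> snd c ` fst c \<Longrightarrow> chart_inv c z \<in> fst c \<and> snd c (chart_inv c z) = z"
  using chart_inv_chart by fastforce

lemma chart_continuous:
  assumes "is_chart c"
  shows "continuous_on (fst c) (snd c)" "continuous_on (snd c ` fst c) (chart_inv c)"
  using assms by (auto simp: is_chart_def homeomorphism_def)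

context
  fixes A :: "('m::topological_space, 'n::finite) atlas" and c :: "('m, 'n) chart"
  assumes A: "smooth_atlas A" and c: "c \<in> A"
begin

lemma chart_c: "is_chart c"
  using A c by (simp add: smooth_atlas_def)

lemma tvec_linear:
  assumes "p \<in> fst c"
  shows "tvec A c p (a *\<^sub>R u + b *\<^sub>R v) = (\<lambda>c'. a *\<^sub>R tvec A c p u c' + b *\<^sub>R tvec A c p v c')"
proof
  fix c'
  show "tvec A c p (a *\<^sub>R u + b *\<^sub>R v) c' = a *\<^sub>R tvec A c p u c' + b *\<^sub>R tvec A c p v c'"
  proof (cases "c' \<in> A \<and> p \<in> fst c'")
    case True
    then have "linear (frechet_derivative (snd c' \<circ> chart_inv c) (at (snd c p)))"
      using transition_differentiable[OF A c _ assms] linear_frechet_derivative by blast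
    then show ?thesis using True by (simp add: tvec_def linear_add linear_cmul)
  next
    case False
    then show ?thesis unfolding tvec_def if_not_P[OF False] by simp
  qed
qed

lemma map_tvec_tuples: "p \<in> fst c \<Longrightarrow> length us = j \<Longrightarrow> map (tvec A c p) us \<in> tuples A p j"
  using tvec_in_tangent_space[OF A c] by (auto simp: tuples_def)

lemma map_tvec_component: "p \<in> fst c \<Longrightarrow> map (\<lambda>v. v c) (map (tvec A c p) us) = us"
  using tvec_self[OF A c] by (simp add: comp_def)

lemma tuples_tvec:
  assumes "p \<in> fst c" "vs \<in> tuples A p j"
  shows "map (tvec A c p) (map (\<lambda>v. v c) vs) = vs"
  using assms tvec_component[OF c assms(1)] by (auto simp: tuples_def intro!: map_idI)

lemma form_local_rep:
  assumes "p \<in> fst c" "vs \<in> tuples A p j"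
  shows "\<Omega> p vs = local_rep A c \<Omega> (snd c p) (map (\<lambda>v. v c) vs)"
  unfolding local_rep_def chart_inv_chart[OF chart_c assms(1)] tuples_tvec[OF assms] ..

lemma alternating_local_rep:
  assumes p: "p \<in> fst c" and "alternating_form A k p (\<Omega> p)"
  shows "alternating k (local_rep A c \<Omega> (snd c p))"
  unfolding alternating_def multilinear_form_def local_rep_def chart_inv_chart[OF chart_c p]
proof (intro conjI allI impI)
  fix us :: "(real ^ 'n) list" and i u v and a b :: real
  assume us: "length us = k" "i < k"
  have "\<Omega> p ((map (tvec A c p) us)[i := (\<lambda>c'. a *\<^sub>R tvec A c p u c' + b *\<^sub>R tvec A c p v c')])
      = a * \<Omega> p ((map (tvec A c p) us)[i := tvec A c p u]) + b * \<Omega> p ((map (tvec A c p) us)[i := tvec A c p v])"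
    using assms(2) us map_tvec_tuples[OF p us(1)] tvec_in_tangent_space[OF A c p]
    unfolding alternating_form_def by blast
  then show "\<Omega> p (map (tvec A c p) (us[i := a *\<^sub>R u + b *\<^sub>R v]))
      = a * \<Omega> p (map (tvec A c p) (us[i := u])) + b * \<Omega> p (map (tvec A c p) (us[i := v]))"
    by (simp add: map_update tvec_linear[OF p])
next
  fix us :: "(real ^ 'n) list" assume us: "length us = k" "\<not> distinct us"
  then have "\<not> distinct (map (tvec A c p) us)" by (auto simp: distinct_map)
  then show "\<Omega> p (map (tvec A c p) us) = 0"
    using assms(2) map_tvec_tuples[OF p us(1)] unfolding alternating_form_def by blast
qed

lemma local_rep_interior_product:
  assumes "z \<in> snd c ` fst c" "X (chart_inv c z) \<in> tangent_space A (chart_inv c z)"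
  shows "local_rep A c (interior_product X \<Omega>) z us = local_rep A c \<Omega> z (X (chart_inv c z) c # us)"
  using assms chart_image_eq[OF chart_c] tvec_component[OF c]
  by (simp add: local_rep_def interior_product_def)

lemma ext_deriv_local_rep:
  assumes p: "p \<in> fst c"
  shows "ext_deriv A c \<omega> p (map (tvec A c p) us) = coord_ext_deriv (local_rep A c \<omega>) (snd c p) us"
  unfolding ext_deriv_def map_tvec_component[OF p] coord_ext_deriv_def Let_def ..

text \<open>Already two tangent vectors on which the contractions differ give a nonzero value.\<close>

lemma nondegenerate_local_rep:
  assumes p: "p \<in> fst c" and nd: "one_nondegenerate A k \<Omega>" and k: "0 < k"
  obtains us where "length us = k" "local_rep A c \<Omega> (snd c p) us \<noteq> 0"
proof -
  let ?v = "tvec A c p (axis undefined 1)" and ?o = "tvec A c p 0"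
  have "axis undefined 1 \<noteq> (0 :: real ^ 'n)" by (simp add: axis_eq_0_iff)
  then have "?v \<noteq> ?o" using tvec_self[OF A c p] by metis
  moreover have "inj_on (\<lambda>v. \<lambda>vs\<in>tuples A p (k - 1). \<Omega> p (v # vs)) (tangent_space A p)"
    using nd by (simp add: one_nondegenerate_def)
  ultimately have "(\<lambda>vs\<in>tuples A p (k - 1). \<Omega> p (?v # vs)) \<noteq> (\<lambda>vs\<in>tuples A p (k - 1). \<Omega> p (?o # vs))"
    using tvec_in_tangent_space[OF A c p] by (auto dest: inj_onD)
  then obtain vs where vs: "vs \<in> tuples A p (k - 1)" "\<Omega> p (?v # vs) \<noteq> \<Omega> p (?o # vs)"
    using restrict_ext[of "tuples A p (k - 1)" "\<lambda>vs. \<Omega> p (?v # vs)" "\<lambda>vs. \<Omega> p (?o # vs)"] by blast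
  then obtain u where u: "\<Omega> p (tvec A c p u # vs) \<noteq> 0" by metis
  have in_tuples: "tvec A c p u # vs \<in> tuples A p k"
    using vs(1) k tvec_in_tangent_space[OF A c p] by (auto simp: tuples_def)
  show thesis
    by (rule that[of "map (\<lambda>v. v c) (tvec A c p u # vs)"])
      (use in_tuples u form_local_rep[OF p in_tuples, of \<Omega>] in \<open>simp_all add: tuples_def\<close>)
qed

end

lemma chart_inv_std [simp]: "chart_inv std_chart = id"
  by (simp add: chart_inv_def std_chart_def inv_id)

lemma smooth_atlas_std: "smooth_atlas std_atlas"
proof -
  show ?thesis
    unfolding smooth_atlas_def is_chart_def std_atlas_def
    by (simp add: homeomorphism_def) (simp add: std_chart_def smooth_on_id id_def)
qed

lemma in_std_atlas [simp]: "std_chart \<in> std_atlas" "fst std_chart = UNIV" "snd std_chart = id"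
  by (simp_all add: std_atlas_def std_chart_def)

text \<open>In a closed form the term \<open>i(X) d\<close> of the Lie derivative vanishes, so local homogeneity becomes
  the equation of the locale \<open>homogeneous_form\<close> in the chart \<open>c\<close>.\<close>

lemma homogeneous_form_local_rep:
  fixes A :: "('m::t2_space, 'n::finite) atlas"
  assumes M: "multisymplectic A k \<Omega>" and c: "c \<in> A" and X: "vector_field A X"
    and f: "smooth_fun A (fst c) f"
    and lie: "\<And>p vs. p \<in> fst c \<Longrightarrow> vs \<in> tuples A p k \<Longrightarrow> lie_deriv A c X \<Omega> p vs = f p * \<Omega> p vs"
  shows "homogeneous_form (snd c ` fst c) k (local_rep A c \<Omega>) (\<lambda>z. X (chart_inv c z) c) (f \<circ> chart_inv c)"
proof -
  have A: "smooth_atlas A" and \<Omega>: "differential_form A k \<Omega>" and cl: "closed_form A k \<Omega>" and k: "2 \<le> k"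
    using M by (auto simp: multisymplectic_def smooth_manifold_def)
  have ch: "is_chart c" using A c by (simp add: smooth_atlas_def)
  have op: "open (snd c ` fst c)" using ch by (simp add: is_chart_def)
  have closed: "ext_deriv A c \<Omega> p vs = 0" if "p \<in> fst c" "vs \<in> tuples A p (Suc k)" for p vs
    using cl c that by (auto simp: closed_form_def)
  have X_tangent: "X p \<in> tangent_space A p" for p using X by (simp add: vector_field_def)
  show ?thesis
  proof
    fix z us assume z: "z \<in> snd c ` fst c"
    then obtain p where p: "p \<in> fst c" "z = snd c p" by auto
    show "alternating k (local_rep A c \<Omega> z)"
      unfolding p(2) using \<Omega> by (intro alternating_local_rep[OF A c p(1)]) (simp add: differential_form_def)
    show "coord_ext_deriv (local_rep A c \<Omega>) z us = 0" if "length us = Suc k"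
      unfolding p(2) ext_deriv_local_rep[OF A c p(1), symmetric]
      by (rule closed[OF p(1) map_tvec_tuples[OF A c p(1) that]])
    show "coord_ext_deriv (\<lambda>z us. local_rep A c \<Omega> z (X (chart_inv c z) c # us)) z us
        = (f \<circ> chart_inv c) z * local_rep A c \<Omega> z us" if us: "length us = k"
    proof -
      let ?vs = "map (tvec A c p) us"
      have vs: "?vs \<in> tuples A p k" by (rule map_tvec_tuples[OF A c p(1) us])
      have "coord_ext_deriv (\<lambda>z us. local_rep A c \<Omega> z (X (chart_inv c z) c # us)) z us
          = coord_ext_deriv (local_rep A c (interior_product X \<Omega>)) z us"
        unfolding coord_ext_deriv_def
        by (intro sum.cong refl arg_cong2[of _ _ _ _ "(*)"] fun_cong[OF fderiv_cong_open[OF op z]]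
            local_rep_interior_product[where X = X, OF A c _ X_tangent, symmetric])
      also have "\<dots> = ext_deriv A c (interior_product X \<Omega>) p ?vs"
        unfolding p(2) ext_deriv_local_rep[OF A c p(1)] ..
      also have "\<dots> = lie_deriv A c X \<Omega> p ?vs"
      proof -
        have "X p # ?vs \<in> tuples A p (Suc k)" using vs X_tangent by (auto simp: tuples_def)
        from closed[OF p(1) this] show ?thesis by (simp add: lie_deriv_def interior_product_def)
      qed
      also have "\<dots> = f p * \<Omega> p ?vs" by (rule lie[OF p(1) vs])
      also have "\<dots> = (f \<circ> chart_inv c) z * local_rep A c \<Omega> z us"
        using chart_inv_chart[OF ch p(1)] by (simp add: p(2) local_rep_def)
      finally show ?thesis .
    qed
  next
    show "smooth_on (snd c ` fst c) (f \<circ> chart_inv c)"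
      using f c unfolding smooth_fun_def by (metis Int_absorb)
  qed (use \<Omega> c X op k in \<open>auto simp: differential_form_def vector_field_def\<close>)
qed

lemma (in homogeneous_form) factor_zero:
  assumes N: "open N" "z \<in> N" "N \<subseteq> S" and X_0: "\<And>y. y \<in> N \<Longrightarrow> X y = 0"
    and us: "length us = k" "w z us \<noteq> 0"
  shows "f z = 0"
proof -
  have z: "z \<in> S" using N by auto
  have "fderiv X z = fderiv (\<lambda>_. 0) z" using X_0 by (intro fderiv_cong_open[OF N(1,2)])
  then have dX: "fderiv X z u = 0" for u by (simp add: frechet_derivative_const)
  have "w z (us[i := 0]) = 0" if "i < k" for i
    using linear_0[OF multilinear_form_linear[OF multilinear_w[OF z] us(1) that]] .
  moreover have "fderiv (\<lambda>z. w z us) z 0 = 0"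
    using linear_0[OF has_derivative_linear[OF smooth_on_has_derivative[OF smooth_w[OF us(1)] z]]] .
  ultimately show ?thesis
    using lie_derivative_formula[OF z us(1)] us(2) X_0[OF N(2)] by (simp add: dX)
qed

text \<open>Take the support inside one chart. A degree above the dimension would make the form vanish. For a
  smaller degree there is a ray in the coordinates \<open>\<phi>\<close> along which the factor equals \<open>k\<close>. The ray leaves
  every compact part of the interior of the support, but stays in the compact set \<open>K\<close>, so it
  accumulates at a point \<open>q\<close> of the frontier of the support. There the factor is \<open>k\<close> by continuity along
  the ray, and \<open>0\<close> by continuity from outside the support.\<close>

lemma locally_homogeneous_top_degree:
  fixes A :: "('m::t2_space, 'n::finite) atlas"
  assumes M: "multisymplectic A k \<Omega>" and H: "locally_homogeneous A k \<Omega>"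
  shows "k = CARD('n)"
proof (rule ccontr)
  assume "k \<noteq> CARD('n)"
  have A: "smooth_atlas A" and nd: "one_nondegenerate A k \<Omega>" and k: "0 < k"
    using M by (auto simp: multisymplectic_def smooth_manifold_def)
  fix x :: 'm
  obtain c where c: "c \<in> A" "x \<in> fst c" using A unfolding smooth_atlas_def by blast
  have ch: "is_chart c" using A c by (simp add: smooth_atlas_def)
  have op: "open (fst c)" "open (snd c ` fst c)" using ch by (auto simp: is_chart_def)
  note inv = chart_inv_chart[OF ch]
  let ?S = "snd c ` fst c"
  let ?w = "local_rep A c \<Omega>"
  obtain K \<Delta> f where K: "K \<subseteq> fst c" and E: "local_euler_like A x K \<Delta>" and f: "smooth_fun A (fst c) f"
    and lie: "\<forall>c'\<in>A. \<forall>p\<in>fst c \<inter> fst c'. \<forall>vs\<in>tuples A p k. lie_deriv A c' \<Delta> \<Omega> p vs = f p * \<Omega> p vs"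
    using H op(1) c(2) unfolding locally_homogeneous_def locally_homogeneous_at_def by meson
  let ?D = "interior (support \<Delta>)"
  obtain \<phi> :: "'m \<Rightarrow> real ^ 'n" where \<phi>: "diffeo A ?D std_atlas UNIV \<phi>"
    and euler: "\<forall>y\<in>?D. tangent_map A std_atlas \<phi> y (\<Delta> y) = dilation_field (\<phi> y)"
    using E unfolding local_euler_like_def by blast
  have comp_K: "compact K" and \<Delta>: "vector_field A \<Delta>" and supp: "support \<Delta> \<subseteq> K"
    using E by (auto simp: local_euler_like_def)
  define X where "X z = \<Delta> (chart_inv c z) c" for z
  define f' where "f' = f \<circ> chart_inv c"
  interpret homogeneous_form ?S k ?w X f'
    unfolding X_def[abs_def] f'_def using lie c(1) by (intro homogeneous_form_local_rep M \<Delta> f) auto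
  have nonzero: "\<exists>us. length us = k \<and> ?w z us \<noteq> 0" if "z \<in> ?S" for z
    using that nondegenerate_local_rep[OF A c(1) _ nd k] by (metis imageE)
  have "\<not> CARD('n) < k"
  proof
    assume "CARD('n) < k"
    obtain us where us: "length us = k" "?w (snd c x) us \<noteq> 0" using nonzero c(2) by blast
    have "snd c x \<in> ?S" using c(2) by blast
    from alternating_eq_0_degree[OF alternating_w[OF this] _ us(1)] us(2) \<open>CARD('n) < k\<close> show False by simp
  qed
  then have degree: "k < DIM(real ^ 'n)" using \<open>k \<noteq> CARD('n)\<close> by simp
  define \<psi> where "\<psi> = inv_into ?D \<phi>"
  have bij: "bij_betw \<phi> ?D UNIV" using \<phi> by (simp add: diffeo_def)
  have \<psi>: "\<psi> z \<in> ?D" "\<phi> (\<psi> z) = z" for z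
    using bij bij_betw_imp_surj_on[OF bij] f_inv_into_f[of z \<phi> ?D] inv_into_into[of z \<phi> ?D] by (auto simp: \<psi>_def)
  have D_K: "?D \<subseteq> K" and D_c: "?D \<subseteq> fst c" using supp K interior_subset[of "support \<Delta>"] by auto
  \<comment> \<open>\<open>\<theta>\<close> and \<open>\<xi>\<close> are the change between the chart \<open>c\<close> and the coordinates \<open>\<phi>\<close>.\<close>
  define \<theta> where "\<theta> z = snd c (\<psi> z)" for z
  define \<xi> where "\<xi> = \<phi> \<circ> chart_inv c"
  have inv_\<theta>: "chart_inv c (\<theta> z) = \<psi> z" for z using \<psi>(1) D_c inv by (auto simp: \<theta>_def)
  have \<xi>\<theta>: "\<xi> (\<theta> z) = z" for z by (simp add: \<xi>_def inv_\<theta> \<psi>)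
  have \<psi>\<phi>: "\<psi> (\<phi> y) = y" if "y \<in> ?D" for y
    using that bij by (simp add: \<psi>_def bij_betw_def)
  have \<theta>\<xi>: "\<theta> (\<xi> z) = z" if "z \<in> snd c ` (?D \<inter> fst c)" for z
    using that inv \<psi>\<phi> by (auto simp: \<theta>_def \<xi>_def)
  have smooth_\<theta>: "smooth_on UNIV \<theta>"
  proof -
    have "smooth_map std_atlas UNIV A \<psi>" using \<phi> by (simp add: diffeo_def \<psi>_def)
    then have "smooth_on (snd std_chart ` (UNIV \<inter> fst std_chart \<inter> \<psi> -` fst c)) (snd c \<circ> \<psi> \<circ> chart_inv std_chart)"
      using c(1) in_std_atlas(1) unfolding smooth_map_def by blast
    moreover have "\<psi> -` fst c = UNIV" using \<psi>(1) D_c by auto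
    ultimately show ?thesis by (simp add: comp_def \<theta>_def[abs_def])
  qed
  have map_\<phi>: "smooth_map A ?D std_atlas \<phi>" using \<phi> by (simp add: diffeo_def)
  then have "smooth_on (snd c ` (?D \<inter> fst c \<inter> \<phi> -` fst std_chart)) (snd std_chart \<circ> \<phi> \<circ> chart_inv c)"
    using c(1) in_std_atlas(1) unfolding smooth_map_def by blast
  then have smooth_\<xi>: "smooth_on (snd c ` (?D \<inter> fst c)) \<xi>" by (simp add: \<xi>_def)
  have op_D: "open (snd c ` (?D \<inter> fst c))" by (rule chart_image_open[OF ch]) simp
  have \<theta>_D: "\<theta> z \<in> snd c ` (?D \<inter> fst c)" for z using \<psi>(1) D_c by (auto simp: \<theta>_def)
  have d\<theta>: "(\<theta> has_derivative fderiv \<theta> z) (at z)" for z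
    using smooth_on_has_derivative[OF smooth_\<theta>] by simp
  have d\<xi>: "(\<xi> has_derivative fderiv \<xi> (\<theta> z)) (at (\<theta> z))" for z
    by (rule smooth_on_has_derivative[OF smooth_\<xi> \<theta>_D])
  have inverse: "fderiv \<theta> z (fderiv \<xi> (\<theta> z) h) = h" for z h
  proof -
    have "((\<lambda>y. \<theta> (\<xi> y)) has_derivative (\<lambda>h. fderiv \<theta> z (fderiv \<xi> (\<theta> z) h))) (at (\<theta> z))"
      using has_derivative_compose[OF d\<xi>] d\<theta>[of z] \<xi>\<theta>[of z] by metis
    then have "((\<lambda>y. y) has_derivative (\<lambda>h. fderiv \<theta> z (fderiv \<xi> (\<theta> z) h))) (at (\<theta> z))"
      by (rule has_derivative_transform_within_open[OF _ op_D \<theta>_D]) (simp add: \<theta>\<xi>)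
    from has_derivative_unique[OF this has_derivative_ident] show ?thesis by metis
  qed
  have X_\<theta>: "X (\<theta> z) = fderiv \<theta> z z" for z
  proof -
    let ?y = "\<psi> z"
    have y: "?y \<in> fst c" using \<psi>(1) D_c by auto
    have "tangent_map A std_atlas \<phi> ?y (\<Delta> ?y) std_chart
        = fderiv (snd std_chart \<circ> \<phi> \<circ> chart_inv c) (snd c ?y) (\<Delta> ?y c)"
      using \<Delta> by (intro tangent_map_eq[OF A smooth_atlas_std open_interior \<psi>(1) map_\<phi> _ c(1) y])
        (auto simp: vector_field_def)
    moreover have "dilation_field (\<phi> ?y) std_chart = z"
      using tvec_self[OF smooth_atlas_std in_std_atlas(1), of z z] by (simp add: dilation_field_def \<psi>)
    moreover have "X (\<theta> z) = \<Delta> ?y c" by (simp add: X_def inv_\<theta>)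
    ultimately have "fderiv \<xi> (\<theta> z) (X (\<theta> z)) = z"
      using euler \<psi>(1) by (simp add: \<xi>_def \<theta>_def)
    then show ?thesis using inverse[of z "X (\<theta> z)"] by simp
  qed
  have "range \<theta> \<subseteq> ?S" using \<psi>(1) D_c by (auto simp: \<theta>_def)
  moreover have "surj (fderiv \<theta> 0)" using inverse[of 0] by (metis surjI)
  moreover obtain us0 where us0: "length us0 = k" "?w (\<theta> 0) us0 \<noteq> 0"
    using nonzero[of "\<theta> 0"] \<theta>_D by blast
  ultimately obtain v where v: "v \<noteq> 0" and ray: "\<And>s. 0 \<le> s \<Longrightarrow> f' (\<theta> (s *\<^sub>R v)) = k"
    using constant_factor_along_ray[OF smooth_\<theta> _ _ X_\<theta> us0 degree] by metis
  have "compact (snd c ` K)"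
    using continuous_on_subset[OF chart_continuous(1)[OF ch] K] comp_K by (rule compact_continuous_image)
  moreover have "\<forall>j. \<theta> (real j *\<^sub>R v) \<in> snd c ` K" using \<psi>(1) D_K by (auto simp: \<theta>_def)
  ultimately obtain q r where q: "q \<in> snd c ` K" and r: "strict_mono (r :: nat \<Rightarrow> nat)"
    and "((\<lambda>j. \<theta> (real j *\<^sub>R v)) \<circ> r) \<longlonglongrightarrow> q"
    by (rule compact_imp_seq_compact[THEN seq_compactE])
  then have lim: "(\<lambda>j. \<theta> (real (r j) *\<^sub>R v)) \<longlonglongrightarrow> q" by (simp add: comp_def)
  obtain p where p: "p \<in> fst c" "q = snd c p" using q K by auto
  have q_S: "q \<in> ?S" using p by blast
  have "isCont f' q"
    using smooth_on_continuous[OF smooth_f] op(2) q_S continuous_on_eq_continuous_at by blast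
  from isCont_tendsto_compose[OF this lim] have "f' q = k"
    using ray by (simp add: LIMSEQ_const_iff)
  have "p \<notin> ?D"
  proof
    assume "p \<in> ?D"
    then have "q \<in> snd c ` (?D \<inter> fst c)" using p by blast
    then have "isCont \<xi> q"
      using smooth_on_continuous[OF smooth_\<xi>] op_D continuous_on_eq_continuous_at by blast
    from isCont_tendsto_compose[OF this lim] have "(\<lambda>j. real (r j) *\<^sub>R v) \<longlonglongrightarrow> \<xi> q" by (simp add: \<xi>\<theta>)
    then have "Bseq (\<lambda>j. real (r j) *\<^sub>R v)" using convergentI convergent_imp_Bseq by blast
    then obtain B where B: "\<And>j. norm (real (r j) *\<^sub>R v) \<le> B" unfolding Bseq_def by blast
    obtain j :: nat where j: "B / norm v < real j" using reals_Archimedean2 by blast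
    have "B < real j * norm v" using j v by (simp add: field_simps)
    also have "\<dots> \<le> real (r j) * norm v"
      using seq_suble[OF r, of j] by (intro mult_right_mono) auto
    finally show False using B[of j] by simp
  qed
  have "f' q = 0"
  proof (rule ccontr)
    assume "f' q \<noteq> 0"
    have "open {y \<in> ?S. f' y \<noteq> 0}"
      using continuous_open_preimage[OF smooth_on_continuous[OF smooth_f] op(2), of "- {0}"]
      by (auto simp: vimage_def Int_def)
    then have "open (fst c \<inter> snd c -` {y \<in> ?S. f' y \<noteq> 0})"
      by (rule continuous_open_preimage[OF chart_continuous(1)[OF ch] op(1)])
    moreover have "p \<in> fst c \<inter> snd c -` {y \<in> ?S. f' y \<noteq> 0}" using p \<open>f' q \<noteq> 0\<close> by blast
    ultimately have "\<not> fst c \<inter> snd c -` {y \<in> ?S. f' y \<noteq> 0} \<subseteq> support \<Delta>"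
      using \<open>p \<notin> ?D\<close> by (meson interiorI)
    then obtain p' where p': "p' \<in> fst c" "p' \<notin> support \<Delta>" "f' (snd c p') \<noteq> 0" by blast
    let ?N = "snd c ` (- support \<Delta> \<inter> fst c)"
    have N: "open ?N" by (rule chart_image_open[OF ch]) (simp add: support_def open_Compl)
    have X_0: "X y = 0" if "y \<in> ?N" for y
    proof -
      obtain p where p: "p \<in> fst c" "p \<notin> support \<Delta>" "y = snd c p" using \<open>y \<in> ?N\<close> by blast
      have "{p. \<Delta> p \<noteq> (\<lambda>_. 0)} \<subseteq> support \<Delta>" unfolding support_def by (rule closure_subset)
      then have "\<Delta> p = (\<lambda>_. 0)" using p(2) by blast
      then show ?thesis using p by (simp add: X_def inv)
    qed
    obtain us where us: "length us = k" "?w (snd c p') us \<noteq> 0" using nonzero p'(1) by blast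
    have "f' (snd c p') = 0"
      by (rule factor_zero[OF N _ _ X_0 us]) (use p' in blast)+
    then show False using p'(3) by simp
  qed
  then show False using \<open>f' q = k\<close> k by simp
qed


section \<open>Flows in coordinates extended to the manifold\<close>

text \<open>The chain rule with the chart \<open>d\<close> inserted between \<open>\<phi>\<close> and the chart in which the component is read.\<close>

lemma tangent_map_tvec:
  assumes A: "smooth_atlas A" and B: "smooth_atlas B"
    and S: "open S" "p \<in> S" and \<phi>: "smooth_map A S B \<phi>"
    and v: "v \<in> tangent_space A p"
    and c: "c \<in> A" "p \<in> fst c" and d: "d \<in> B" "\<phi> p \<in> fst d"
  shows "tangent_map A B \<phi> p v = tvec B d (\<phi> p) (fderiv (snd d \<circ> \<phi> \<circ> chart_inv c) (snd c p) (v c))"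
proof
  fix c'
  show "tangent_map A B \<phi> p v c' = tvec B d (\<phi> p) (fderiv (snd d \<circ> \<phi> \<circ> chart_inv c) (snd c p) (v c)) c'"
  proof (cases "c' \<in> B \<and> \<phi> p \<in> fst c'")
    case False
    show ?thesis by (simp only: tangent_map_def tvec_def if_not_P[OF False])
  next
    case True
    have ch: "is_chart c" "is_chart d" using A B c d by (auto simp: smooth_atlas_def)
    let ?f = "snd d \<circ> \<phi> \<circ> chart_inv c" and ?z = "snd c p"
    have inv: "chart_inv c ?z = p" by (rule chart_inv_chart[OF ch(1) c(2)])
    have op: "open (snd c ` (S \<inter> fst c \<inter> \<phi> -` fst d))"
    proof -
      have "open (S \<inter> \<phi> -` fst d)"
        using \<phi> S(1) ch(2) by (auto simp: smooth_map_def is_chart_def intro: continuous_open_preimage)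
      from chart_image_open[OF ch(1) this] show ?thesis by (simp add: Int_ac)
    qed
    have z: "?z \<in> snd c ` (S \<inter> fst c \<inter> \<phi> -` fst d)" using S c d by blast
    have "smooth_on (snd c ` (S \<inter> fst c \<inter> \<phi> -` fst d)) ?f"
      using \<phi> c d by (simp add: smooth_map_def)
    from smooth_on_has_derivative[OF this z]
    have df: "(?f has_derivative fderiv ?f ?z) (at ?z)" .
    have dt: "((snd c' \<circ> chart_inv d) has_derivative fderiv (snd c' \<circ> chart_inv d) (snd d (\<phi> p))) (at (?f ?z))"
      using fderiv_works[OF transition_differentiable[OF B d(1) _ d(2)]] True inv by simp
    have "((snd c' \<circ> \<phi> \<circ> chart_inv c) has_derivative
      (\<lambda>h. fderiv (snd c' \<circ> chart_inv d) (snd d (\<phi> p)) (fderiv ?f ?z h))) (at ?z)"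
      by (rule has_derivative_transform_within_open[OF has_derivative_compose[OF df dt] op z])
        (auto simp: chart_inv_chart[OF ch(1)] chart_inv_chart[OF ch(2)])
    from fderiv_eq[OF this] show ?thesis
      using tangent_map_eq[OF A B S \<phi> v c, of c'] True by (simp add: tvec_def)
  qed
qed

text \<open>A one-parameter group that is jointly smooth in charts consists of diffeomorphisms, because
  the inverse of each of its members is again a member.\<close>

context
  fixes A :: "('m::t2_space, 'n::finite) atlas" and \<phi> :: "real \<Rightarrow> 'm \<Rightarrow> 'm"
  assumes A: "smooth_atlas A"
    and group: "\<And>s t p. \<phi> s (\<phi> t p) = \<phi> (s + t) p" and zero: "\<And>p. \<phi> 0 p = p"
    and local: "\<And>c c' t p. c \<in> A \<Longrightarrow> c' \<in> A \<Longrightarrow> p \<in> fst c \<Longrightarrow> \<phi> t p \<in> fst c' \<Longrightarrow>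
      \<exists>N g. open N \<and> (t, snd c p) \<in> N \<and> smooth_on N g \<and>
        (\<forall>s q. q \<in> fst c \<longrightarrow> (s, snd c q) \<in> N \<longrightarrow> \<phi> s q \<in> fst c' \<and> snd c' (\<phi> s q) = g (s, snd c q))"
begin

lemma flow_smooth_map: "smooth_map A UNIV A (\<phi> t)"
proof -
  have chart: "is_chart c" if "c \<in> A" for c using A that by (simp add: smooth_atlas_def)
  have slice: "\<exists>N h. open N \<and> snd c p \<in> N \<and> N \<subseteq> snd c ` fst c \<and> smooth_on N h \<and>
      (\<forall>z\<in>N. \<phi> t (chart_inv c z) \<in> fst c' \<and> snd c' (\<phi> t (chart_inv c z)) = h z)"
    if c: "c \<in> A" "p \<in> fst c" and c': "c' \<in> A" "\<phi> t p \<in> fst c'" for c c' p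
  proof -
    obtain N g where N: "open N" "(t, snd c p) \<in> N" "smooth_on N g"
      and g: "\<And>s q. q \<in> fst c \<Longrightarrow> (s, snd c q) \<in> N \<Longrightarrow> \<phi> s q \<in> fst c' \<and> snd c' (\<phi> s q) = g (s, snd c q)"
      using local[OF c(1) c'(1) c(2) c'(2)] by blast
    let ?N = "snd c ` fst c \<inter> (\<lambda>z. (t, z)) -` N"
    have op: "open (snd c ` fst c)" using chart[OF c(1)] by (simp add: is_chart_def)
    have "open ?N" by (intro continuous_open_preimage[OF _ op N(1)] continuous_intros)
    moreover have "smooth_on ?N (\<lambda>z. g (t, z))"
      by (rule smooth_on_compose[OF \<open>open ?N\<close> N(1,3)])
        (auto intro!: smooth_on_Pair \<open>open ?N\<close> smooth_on_const smooth_on_id)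
    moreover have "\<phi> t (chart_inv c z) \<in> fst c' \<and> snd c' (\<phi> t (chart_inv c z)) = g (t, z)" if "z \<in> ?N" for z
      using that g[of "chart_inv c z" t] chart_image_eq[OF chart[OF c(1)]] by auto
    ultimately show ?thesis using N(2) c(2) by (intro exI[of _ ?N] exI[of _ "\<lambda>z. g (t, z)"]) auto
  qed
  have "continuous_on UNIV (\<phi> t)"
  proof -
    have "isCont (\<phi> t) p" for p
    proof -
      obtain c where c: "c \<in> A" "p \<in> fst c" using A unfolding smooth_atlas_def by blast
      obtain c' where c': "c' \<in> A" "\<phi> t p \<in> fst c'" using A unfolding smooth_atlas_def by blast
      obtain N h where N: "open N" "snd c p \<in> N" "N \<subseteq> snd c ` fst c" "smooth_on N h"
        and h: "\<And>z. z \<in> N \<Longrightarrow> \<phi> t (chart_inv c z) \<in> fst c' \<and> snd c' (\<phi> t (chart_inv c z)) = h z"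
        using slice[OF c c'] by blast
      let ?P = "fst c \<inter> snd c -` N"
      have P: "open ?P"
        using chart[OF c(1)] by (intro continuous_open_preimage[OF chart_continuous(1)[OF chart[OF c(1)]] _ N(1)])
          (simp add: is_chart_def)
      have on_P: "\<phi> t q \<in> fst c'" "snd c' (\<phi> t q) = h (snd c q)" if "q \<in> ?P" for q
        using h[of "snd c q"] that chart_inv_chart[OF chart[OF c(1)], of q] by auto
      have "continuous_on ?P (\<lambda>q. chart_inv c' (h (snd c q)))"
      proof (rule continuous_on_compose2[OF chart_continuous(2)[OF chart[OF c'(1)]]])
        show "continuous_on ?P (\<lambda>q. h (snd c q))"
          by (rule continuous_on_compose2[OF smooth_on_continuous[OF N(4)]
                continuous_on_subset[OF chart_continuous(1)[OF chart[OF c(1)]]]]) auto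
        show "(\<lambda>q. h (snd c q)) ` ?P \<subseteq> snd c' ` fst c'"
          using on_P by (metis (no_types, lifting) image_eqI image_subsetI)
      qed
      then have "continuous_on ?P (\<phi> t)"
        by (rule continuous_on_eq) (simp add: on_P(1) chart_inv_chart[OF chart[OF c'(1)]] flip: on_P(2))
      then show ?thesis using P c(2) N(2) continuous_on_eq_continuous_at by blast
    qed
    then show ?thesis by (simp add: continuous_at_imp_continuous_on)
  qed
  moreover have "smooth_on (snd c ` (UNIV \<inter> fst c \<inter> \<phi> t -` fst c')) (snd c' \<circ> \<phi> t \<circ> chart_inv c)"
    if c: "c \<in> A" "c' \<in> A" for c c'
  proof (rule smooth_on_local)
    fix z assume "z \<in> snd c ` (UNIV \<inter> fst c \<inter> \<phi> t -` fst c')"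
    then obtain p where p: "p \<in> fst c" "\<phi> t p \<in> fst c'" "z = snd c p" by blast
    obtain N h where N: "open N" "snd c p \<in> N" "smooth_on N h"
      and h: "\<And>z. z \<in> N \<Longrightarrow> snd c' (\<phi> t (chart_inv c z)) = h z"
      using slice[OF c(1) p(1) c(2) p(2)] by blast
    have "smooth_on N (snd c' \<circ> \<phi> t \<circ> chart_inv c)"
      by (rule smooth_on_cong[OF N(1) _ N(3)]) (simp add: h)
    then show "\<exists>N. open N \<and> z \<in> N \<and> smooth_on N (snd c' \<circ> \<phi> t \<circ> chart_inv c)"
      using N p by blast
  qed
  ultimately show ?thesis by (auto simp: smooth_map_def)
qed

lemma flow_diffeo: "diffeo A UNIV A UNIV (\<phi> t)"
proof -
  have inv: "\<phi> (- t) (\<phi> t p) = p" "\<phi> t (\<phi> (- t) p) = p" for p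
    by (simp_all add: group zero)
  have bij: "bij (\<phi> t)" using inv by (intro o_bij[of "\<phi> (- t)"]) auto
  have "inv_into UNIV (\<phi> t) = \<phi> (- t)" using inv by (intro inv_equality)
  then show ?thesis using bij flow_smooth_map by (simp add: diffeo_def)
qed

lemma flow_smooth_isotopy: "smooth_isotopy A \<phi>"
  unfolding smooth_isotopy_def
proof (intro conjI ballI impI)
  fix c c' t p assume "c \<in> A" "c' \<in> A" "p \<in> fst c" "\<phi> t p \<in> fst c'"
  from local[OF this]
  show "\<exists>N g. open N \<and> (t, snd c p) \<in> N \<and> smooth_on N g \<and>
    (\<forall>s\<in>{0..1}. \<forall>q\<in>fst c. (s, snd c q) \<in> N \<longrightarrow> \<phi> s q \<in> fst c' \<and> snd c' (\<phi> s q) = g (s, snd c q))"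
    by blast
qed (rule flow_diffeo)

end

text \<open>Coordinates \<open>\<kappa>\<close> on an open set \<open>P\<close>, with inverse \<open>\<iota>\<close>, that are smooth with respect to the atlas.\<close>

locale adapted_coordinates =
  fixes A :: "('m::t2_space, 'n::finite) atlas"
    and P :: "'m set" and \<kappa> :: "'m \<Rightarrow> real ^ 'n" and \<iota> :: "real ^ 'n \<Rightarrow> 'm"
  assumes A: "smooth_atlas A"
    and open_P: "open P" and open_T: "open (\<kappa> ` P)"
    and \<iota>_\<kappa>: "p \<in> P \<Longrightarrow> \<iota> (\<kappa> p) = p"
    and cont_\<kappa>: "continuous_on P \<kappa>" and cont_\<iota>: "continuous_on (\<kappa> ` P) \<iota>"
    and smooth_\<kappa>: "c \<in> A \<Longrightarrow> smooth_on (snd c ` (P \<inter> fst c)) (\<lambda>z. \<kappa> (chart_inv c z))"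
    and smooth_\<iota>: "c \<in> A \<Longrightarrow> smooth_on (\<kappa> ` (P \<inter> fst c)) (\<lambda>y. snd c (\<iota> y))"
begin

lemma \<kappa>_\<iota>: "y \<in> \<kappa> ` P \<Longrightarrow> \<iota> y \<in> P \<and> \<kappa> (\<iota> y) = y"
  using \<iota>_\<kappa> by auto

lemma open_image:
  assumes "Q \<subseteq> P" "open Q"
  shows "open (\<kappa> ` Q)"
proof -
  have "\<kappa> ` Q = \<kappa> ` P \<inter> \<iota> -` Q" using assms(1) \<iota>_\<kappa> by force
  then show ?thesis using continuous_open_preimage[OF cont_\<iota> open_T assms(2)] by simp
qed

lemma open_\<iota>_image:
  assumes "Y \<subseteq> \<kappa> ` P" "open Y"
  shows "open (\<iota> ` Y)"
proof -
  have "\<iota> ` Y = P \<inter> \<kappa> -` Y" using assms(1) \<iota>_\<kappa> by force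
  then show ?thesis using continuous_open_preimage[OF cont_\<kappa> open_P assms(2)] by simp
qed

lemma compact_\<iota>_image: "Y \<subseteq> \<kappa> ` P \<Longrightarrow> compact Y \<Longrightarrow> compact (\<iota> ` Y)"
  using compact_continuous_image continuous_on_subset[OF cont_\<iota>] by blast

text \<open>A flow on the coordinate domain with support in a compact set \<open>Y\<close> extends by the identity.\<close>

definition transported :: "(real \<Rightarrow> real ^ 'n \<Rightarrow> real ^ 'n) \<Rightarrow> real \<Rightarrow> 'm \<Rightarrow> 'm" where
  "transported \<Phi> t p = (if p \<in> P then \<iota> (\<Phi> t (\<kappa> p)) else p)"

context
  fixes \<Phi> :: "real \<Rightarrow> real ^ 'n \<Rightarrow> real ^ 'n" and Y :: "(real ^ 'n) set"
  assumes smooth_\<Phi>: "smooth_on UNIV (\<lambda>(t, z). \<Phi> t z)"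
    and \<Phi>_0: "\<And>z. \<Phi> 0 z = z" and \<Phi>_\<Phi>: "\<And>s t z. \<Phi> s (\<Phi> t z) = \<Phi> (s + t) z"
    and Y: "compact Y" "Y \<subseteq> \<kappa> ` P" and support: "\<And>t z. z \<notin> Y \<Longrightarrow> \<Phi> t z = z"
begin

text \<open>A point of \<open>Y\<close> cannot leave \<open>Y\<close>, since it could not return under the inverse.\<close>

lemma \<Phi>_image: "z \<in> \<kappa> ` P \<Longrightarrow> \<Phi> t z \<in> \<kappa> ` P"
proof (cases "z \<in> Y")
  case True
  have "\<Phi> t z \<in> Y"
  proof (rule ccontr)
    assume *: "\<Phi> t z \<notin> Y"
    then have "\<Phi> (- t) (\<Phi> t z) = \<Phi> t z" by (rule support)
    then show False using True * by (simp add: \<Phi>_\<Phi> \<Phi>_0)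
  qed
  then show ?thesis using Y(2) by blast
qed (simp add: support)

lemma transported_in: "p \<in> P \<Longrightarrow> transported \<Phi> t p \<in> P \<and> \<kappa> (transported \<Phi> t p) = \<Phi> t (\<kappa> p)"
  using \<kappa>_\<iota>[OF \<Phi>_image] by (simp add: transported_def)

lemma transported_outside: "p \<notin> \<iota> ` Y \<Longrightarrow> transported \<Phi> t p = p"
  using \<iota>_\<kappa>[of p] support[of "\<kappa> p" t] by (force simp: transported_def)

lemma transported_0: "transported \<Phi> 0 p = p"
  by (simp add: transported_def \<Phi>_0 \<iota>_\<kappa>)

lemma transported_add: "transported \<Phi> s (transported \<Phi> t p) = transported \<Phi> (s + t) p"
  using transported_in[of p t] by (cases "p \<in> P") (simp_all add: transported_def \<Phi>_\<Phi>)

text \<open>The coordinate domain and the complement of the compact set \<open>\<iota> ` Y\<close> are open and cover the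
  manifold; on the latter the flow is the identity.\<close>

lemma transported_local:
  assumes c: "c \<in> A" "c' \<in> A" and p: "p \<in> fst c" "transported \<Phi> t p \<in> fst c'"
  shows "\<exists>N g. open N \<and> (t, snd c p) \<in> N \<and> smooth_on N g \<and>
    (\<forall>s q. q \<in> fst c \<longrightarrow> (s, snd c q) \<in> N \<longrightarrow>
      transported \<Phi> s q \<in> fst c' \<and> snd c' (transported \<Phi> s q) = g (s, snd c q))"
proof -
  have ch: "is_chart c" "is_chart c'" using A c by (auto simp: smooth_atlas_def)
  have op: "open (fst c)" "open (fst c')" using ch by (auto simp: is_chart_def)
  show ?thesis
  proof (cases "p \<in> P")
    case True
    let ?Z = "snd c ` (P \<inter> fst c)" and ?T = "\<kappa> ` (P \<inter> fst c')"
    have Z: "open ?Z" by (rule chart_image_open[OF ch(1) open_P])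
    have T: "open ?T" by (intro open_image open_Int open_P op) auto
    define h where "h = (\<lambda>(s, z). \<Phi> s (\<kappa> (chart_inv c z)))"
    have h: "smooth_on (UNIV \<times> ?Z) h"
    proof -
      have oZ: "open (UNIV \<times> ?Z :: (real \<times> (real ^ 'n)) set)" by (intro open_Times open_UNIV Z)
      have "smooth_on (UNIV \<times> ?Z) (\<lambda>p :: real \<times> (real ^ 'n). \<kappa> (chart_inv c (snd p)))"
        by (rule smooth_on_compose[OF oZ Z smooth_\<kappa>[OF c(1)] smooth_on_bounded_linear[OF bounded_linear_snd]]) auto
      then have "smooth_on (UNIV \<times> ?Z) (\<lambda>p :: real \<times> (real ^ 'n). (fst p, \<kappa> (chart_inv c (snd p))))"
        by (intro smooth_on_Pair oZ smooth_on_bounded_linear[OF bounded_linear_fst])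
      from smooth_on_compose[OF oZ open_UNIV smooth_\<Phi> this] show ?thesis
        by (simp add: h_def case_prod_beta')
    qed
    let ?N = "(UNIV \<times> ?Z) \<inter> h -` ?T"
    have N: "open ?N"
      by (intro continuous_open_preimage[OF smooth_on_continuous[OF h] _ T] open_Times open_UNIV Z)
    have "smooth_on ?N (\<lambda>p. snd c' (\<iota> (h p)))"
      by (rule smooth_on_compose[OF N T smooth_\<iota>[OF c(2)] smooth_on_subset[OF h]]) auto
    moreover have "(t, snd c p) \<in> ?N"
      using True p chart_inv_chart[OF ch(1) p(1)] transported_in[OF True, of t]
      by (auto simp: h_def intro!: image_eqI[of _ \<kappa> "transported \<Phi> t p"])
    moreover have "transported \<Phi> s q \<in> fst c' \<and> snd c' (transported \<Phi> s q) = snd c' (\<iota> (h (s, snd c q)))"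
      if q: "q \<in> fst c" "(s, snd c q) \<in> ?N" for s q
    proof -
      obtain q' where "q' \<in> P" "q' \<in> fst c" "snd c q = snd c q'" using q(2) by blast
      then have "q \<in> P" using chart_inv_chart[OF ch(1)] q(1) by metis
      then have eq: "transported \<Phi> s q = \<iota> (h (s, snd c q))"
        using chart_inv_chart[OF ch(1) q(1)] by (simp add: h_def transported_def)
      have "h (s, snd c q) \<in> ?T" using q(2) by blast
      then have "\<iota> (h (s, snd c q)) \<in> fst c'" using \<iota>_\<kappa> by auto
      then show ?thesis using eq by simp
    qed
    ultimately show ?thesis using N by (intro exI[of _ ?N] exI[of _ "\<lambda>p. snd c' (\<iota> (h p))"]) blast
  next
    case False
    then have out: "p \<notin> \<iota> ` Y" using Y(2) \<kappa>_\<iota> by blast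
    have "closed (\<iota> ` Y)" using compact_\<iota>_image[OF Y(2,1)] by (rule compact_imp_closed)
    then have "open ((- (\<iota> ` Y)) \<inter> fst c')" using op(2) by (intro open_Int) auto
    from chart_image_open[OF ch(1) this]
    have Z: "open (snd c ` (- (\<iota> ` Y) \<inter> fst c' \<inter> fst c))" (is "open ?Z") .
    let ?N = "UNIV \<times> ?Z :: (real \<times> (real ^ 'n)) set"
    have N: "open ?N" by (intro open_Times open_UNIV Z)
    have tr: "smooth_on (snd c ` (fst c \<inter> fst c')) (snd c' \<circ> chart_inv c)"
      using A c by (simp add: smooth_atlas_def)
    have "smooth_on ?N (\<lambda>p. (snd c' \<circ> chart_inv c) (snd p))"
      by (rule smooth_on_compose[OF N Z smooth_on_subset[OF tr] smooth_on_bounded_linear[OF bounded_linear_snd]]) auto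
    moreover have "(t, snd c p) \<in> ?N" using p out transported_outside[OF out] by auto
    moreover have "transported \<Phi> s q \<in> fst c' \<and> snd c' (transported \<Phi> s q) = (snd c' \<circ> chart_inv c) (snd (s, snd c q))"
      if q: "q \<in> fst c" "(s, snd c q) \<in> ?N" for s q
    proof -
      obtain q' where q': "q' \<notin> \<iota> ` Y" "q' \<in> fst c'" "q' \<in> fst c" "snd c q = snd c q'" using q(2) by blast
      then have "q = q'" using chart_inv_chart[OF ch(1)] q(1) by metis
      then show ?thesis using q' transported_outside[OF q'(1)] chart_inv_chart[OF ch(1) q(1)] by simp
    qed
    ultimately show ?thesis using N
      by (intro exI[of _ ?N] exI[of _ "\<lambda>p. (snd c' \<circ> chart_inv c) (snd p)"]) blast
  qed
qed

lemma transported_isotopy: "smooth_isotopy A (transported \<Phi>)"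
  by (rule flow_smooth_isotopy[OF A transported_add transported_0 transported_local])

lemma transported_diffeo: "diffeo A UNIV A UNIV (transported \<Phi> t)"
  by (rule flow_diffeo[OF A transported_add transported_0 transported_local])

lemma transported_smooth_map: "smooth_map A UNIV A (transported \<Phi> t)"
  by (rule flow_smooth_map[OF A transported_add transported_0 transported_local])

end

end


section \<open>Strong local transitivity\<close>

text \<open>A form of top degree is its density times the determinant, and \<open>\<kappa> = \<Sigma> \<circ> snd c\<close> has that density as
  its Jacobian in the chart \<open>c\<close>. Taking determinants in \<open>\<Sigma> \<circ> H = \<Phi> t \<circ> \<Sigma>\<close>, where \<open>H\<close> is the flow in
  the chart, shows that the density is preserved.\<close>

lemma (in adapted_coordinates) transported_preserves_top_form:
  fixes \<Phi> :: "real \<Rightarrow> real ^ 'n \<Rightarrow> real ^ 'n" and Y :: "(real ^ 'n) set" and \<Omega> :: "('m, 'n) dform"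
  assumes flow: "smooth_on UNIV (\<lambda>(t, z). \<Phi> t z)" "\<And>z. \<Phi> 0 z = z" "\<And>s t z. \<Phi> s (\<Phi> t z) = \<Phi> (s + t) z"
      "compact Y" "Y \<subseteq> \<kappa> ` P" "\<And>t z. z \<notin> Y \<Longrightarrow> \<Phi> t z = z"
    and volume: "\<And>t z. det (matrix (fderiv (\<Phi> t) z)) = 1"
    and c: "c \<in> A" "P \<subseteq> fst c"
    and \<Omega>: "\<And>p. p \<in> P \<Longrightarrow> alternating CARD('n) (local_rep A c \<Omega> (snd c p))"
    and \<Sigma>: "smooth_on (snd c ` P) \<Sigma>" "\<And>p. p \<in> P \<Longrightarrow> \<kappa> p = \<Sigma> (snd c p)"
      "\<And>p. p \<in> P \<Longrightarrow> det (matrix (fderiv \<Sigma> (snd c p))) = local_rep A c \<Omega> (snd c p) std_basis_list"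
    and vs: "vs \<in> tuples A p CARD('n)"
  shows "pullback A A (transported \<Phi> t) \<Omega> p vs = \<Omega> p vs"
proof -
  let ?f = "transported \<Phi> t"
  note smooth_f = transported_smooth_map[OF flow, of t]
  have tangent: "v \<in> tangent_space A p" if "v \<in> set vs" for v using vs that by (auto simp: tuples_def)
  have chart: "is_chart d" if "d \<in> A" for d using A that by (simp add: smooth_atlas_def)
  have derivative: "((snd d \<circ> ?f \<circ> chart_inv d) has_derivative fderiv (snd d \<circ> ?f \<circ> chart_inv d) (snd d p)) (at (snd d p))"
    if "d \<in> A" "p \<in> fst d" "?f p \<in> fst d" for d p
  proof -
    have "smooth_on (snd d ` (UNIV \<inter> fst d \<inter> ?f -` fst d)) (snd d \<circ> ?f \<circ> chart_inv d)"
      using smooth_f that(1) unfolding smooth_map_def by blast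
    then show ?thesis by (rule smooth_on_has_derivative) (use that in blast)
  qed
  show ?thesis
  proof (cases "p \<in> P")
    case True
    let ?p = "?f p" and ?z = "snd c p" and ?z' = "snd c (?f p)"
    let ?H = "snd c \<circ> ?f \<circ> chart_inv c" and ?us = "map (\<lambda>v. v c) vs"
    let ?M = "fderiv ?H ?z" and ?w = "local_rep A c \<Omega>"
    note inv = chart_inv_chart[OF chart[OF c(1)]]
    have p': "?p \<in> P" "\<kappa> ?p = \<Phi> t (\<kappa> p)" using transported_in[OF flow True] by auto
    have in_c: "p \<in> fst c" "?p \<in> fst c" using True p' c by auto
    have dH: "(?H has_derivative ?M) (at ?z)" by (rule derivative[OF c(1) in_c])
    have Hz: "?H ?z = ?z'" using inv[OF in_c(1)] by simp
    have len: "length ?us = CARD('n)" using vs by (simp add: tuples_def)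
    have "map (tangent_map A A ?f p) vs = map (tvec A c ?p) (map ?M ?us)"
      using tangent tangent_map_tvec[OF A A open_UNIV UNIV_I smooth_f _ c(1) in_c(1) c(1) in_c(2)]
      by simp
    then have "pullback A A ?f \<Omega> p vs = ?w ?z' (map ?M ?us)"
      by (simp only: pullback_def local_rep_def inv[OF in_c(2)])
    also have "\<dots> = ?w ?z' std_basis_list * list_det (map ?M ?us)"
      using len by (intro alternating_top_degree[OF \<Omega>[OF p'(1)]]) simp
    also have "\<dots> = (?w ?z' std_basis_list * det (matrix ?M)) * list_det ?us"
      unfolding list_det_map[OF has_derivative_linear[OF dH] len] by simp
    also have "?w ?z' std_basis_list * det (matrix ?M) = ?w ?z std_basis_list"
    proof -
      have d\<Sigma>: "(\<Sigma> has_derivative fderiv \<Sigma> (snd c q)) (at (snd c q))" if "q \<in> P" for q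
        using that by (intro smooth_on_has_derivative[OF \<Sigma>(1)]) auto
      have slice: "smooth_on UNIV (\<Phi> t)"
        using smooth_on_compose[OF open_UNIV open_UNIV flow(1)
            smooth_on_Pair[OF open_UNIV smooth_on_const smooth_on_id]] by simp
      have d\<Phi>: "(\<Phi> t has_derivative fderiv (\<Phi> t) z) (at z)" for z
        by (rule smooth_on_has_derivative[OF slice UNIV_I])
      have op: "open (snd c ` P)"
        using chart_image_open[OF chart[OF c(1)] open_P] c(2) by (simp add: Int_absorb2)
      have "((\<lambda>y. \<Sigma> (?H y)) has_derivative (\<lambda>h. fderiv \<Sigma> ?z' (?M h))) (at ?z)"
        by (rule has_derivative_compose[OF dH]) (use d\<Sigma>[OF p'(1)] Hz in simp)
      moreover have "\<Phi> t (\<Sigma> y) = \<Sigma> (?H y)" if y: "y \<in> snd c ` P" for y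
      proof -
        obtain q where q: "q \<in> P" "y = snd c q" using y by blast
        have "chart_inv c y = q" using inv[of q] c(2) q by auto
        then show ?thesis
          using transported_in[OF flow q(1), of t] \<Sigma>(2)[of "?f q"] \<Sigma>(2)[OF q(1)] q(2) by simp
      qed
      then have "((\<lambda>y. \<Sigma> (?H y)) has_derivative (\<lambda>h. fderiv (\<Phi> t) (\<Sigma> ?z) (fderiv \<Sigma> ?z h))) (at ?z)"
        using True
        by (intro has_derivative_transform_within_open[OF has_derivative_compose[OF d\<Sigma>[OF True] d\<Phi>] op]) auto
      ultimately have eq: "fderiv \<Sigma> ?z' \<circ> ?M = fderiv (\<Phi> t) (\<Sigma> ?z) \<circ> fderiv \<Sigma> ?z"
        unfolding comp_def by (rule has_derivative_unique)
      have "det (matrix (fderiv \<Sigma> ?z')) * det (matrix ?M) = det (matrix (fderiv \<Sigma> ?z' \<circ> ?M))"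
        using matrix_compose[OF has_derivative_linear[OF dH] has_derivative_linear[OF d\<Sigma>[OF p'(1)]]]
        by (simp add: det_mul)
      also have "\<dots> = det (matrix (fderiv (\<Phi> t) (\<Sigma> ?z))) * det (matrix (fderiv \<Sigma> ?z))"
        unfolding eq
        using matrix_compose[OF has_derivative_linear[OF d\<Sigma>[OF True]] has_derivative_linear[OF d\<Phi>]]
        by (simp add: det_mul)
      finally show ?thesis using \<Sigma>(3)[OF True] \<Sigma>(3)[OF p'(1)] volume by simp
    qed
    also have "?w ?z std_basis_list * list_det ?us = ?w ?z ?us"
      by (rule alternating_top_degree[OF \<Omega>[OF True] len, symmetric])
    also have "\<dots> = \<Omega> p vs" by (rule form_local_rep[OF A c(1) in_c(1) vs, symmetric])
    finally show ?thesis .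
  next
    case False
    obtain d where d: "d \<in> A" "p \<in> fst d" using A unfolding smooth_atlas_def by blast
    have out: "p \<notin> \<iota> ` Y" using False flow(5) \<kappa>_\<iota> by blast
    have fix_p: "?f p = p" by (rule transported_outside[OF flow out])
    have "closed (\<iota> ` Y)" by (rule compact_imp_closed[OF compact_\<iota>_image[OF flow(5,4)]])
    then have op: "open (snd d ` (- (\<iota> ` Y) \<inter> fst d))"
      by (intro chart_image_open[OF chart[OF d(1)]]) (rule open_Compl)
    have z: "snd d p \<in> snd d ` (- (\<iota> ` Y) \<inter> fst d)" using d(2) out by blast
    have "((snd d \<circ> ?f \<circ> chart_inv d) has_derivative (\<lambda>h. h)) (at (snd d p))"
    proof (rule has_derivative_transform_within_open[OF has_derivative_ident op z])
      fix y assume "y \<in> snd d ` (- (\<iota> ` Y) \<inter> fst d)"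
      then obtain q where "q \<notin> \<iota> ` Y" "q \<in> fst d" "y = snd d q" by blast
      then show "y = (snd d \<circ> ?f \<circ> chart_inv d) y"
        using transported_outside[OF flow, of q t] chart_inv_chart[OF chart[OF d(1)], of q] by simp
    qed
    from fderiv_eq[OF this] have "tangent_map A A ?f p v = v" if "v \<in> set vs" for v
      using tangent_map_tvec[OF A A open_UNIV UNIV_I smooth_f tangent[OF that] d d(1)] d(2)
        tvec_component[OF d tangent[OF that]] by (simp add: fix_p)
    then have "map (tangent_map A A ?f p) vs = vs" by (intro map_idI)
    then show ?thesis by (simp add: pullback_def fix_p)
  qed
qed

theorem theorem4p6:
  fixes A :: "('m::t2_space, 'n::finite) atlas"
    and \<Omega> :: "('m, 'n) dform"
    and k :: nat
  assumes "multisymplectic A k \<Omega>"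
    and "locally_homogeneous A k \<Omega>"
  shows "strongly_locally_transitive A (automorphisms A k \<Omega>)"
  unfolding strongly_locally_transitive_def
proof (intro allI impI)
  fix x :: 'm and U :: "'m set" assume U: "open U \<and> x \<in> U"
  have k: "k = CARD('n)" by (rule locally_homogeneous_top_degree[OF assms])
  have A: "smooth_atlas A" and form: "differential_form A k \<Omega>"
    and nd: "one_nondegenerate A k \<Omega>" and k2: "2 \<le> k"
    using assms(1) by (auto simp: multisymplectic_def smooth_manifold_def)
  obtain c where c: "c \<in> A" "x \<in> fst c" using A unfolding smooth_atlas_def by blast
  have ch: "is_chart c" using A c by (simp add: smooth_atlas_def)
  note inv = chart_inv_chart[OF ch]
  let ?w = "local_rep A c \<Omega>"
  have alt: "alternating CARD('n) (?w (snd c p))" if "p \<in> fst c" for p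
    using form k alternating_local_rep[OF A c(1) that] by (simp add: differential_form_def)
  \<comment> \<open>\<open>\<rho>\<close> is the density of the volume form \<open>\<Omega>\<close> in the chart.\<close>
  define \<rho> where "\<rho> z = ?w z std_basis_list" for z
  have len: "length (std_basis_list :: (real ^ 'n) list) = CARD('n)"
    by (simp add: std_basis_list_def length_index_list)
  have smooth_\<rho>: "smooth_on (snd c ` fst c) \<rho>"
    using form c(1) len k by (simp add: \<rho>_def[abs_def] differential_form_def)
  have \<rho>_nz: "\<rho> (snd c p) \<noteq> 0" if p: "p \<in> fst c" for p
  proof -
    obtain us where us: "length us = k" "?w (snd c p) us \<noteq> 0"
      using nondegenerate_local_rep[OF A c(1) p nd] k2 by auto
    then show ?thesis using alternating_top_degree[OF alt[OF p], of us] k by (auto simp: \<rho>_def)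
  qed
  have "open (snd c ` (U \<inter> fst c))" using U by (intro chart_image_open[OF ch]) simp
  moreover have "snd c x \<in> snd c ` (U \<inter> fst c)" using U c by blast
  ultimately obtain r where r: "0 < r" "ball (snd c x) r \<subseteq> snd c ` (U \<inter> fst c)"
    using open_contains_ball by metis
  let ?B = "ball (snd c x) r"
  have "?B \<subseteq> snd c ` fst c" using r(2) by blast
  then have "smooth_on ?B \<rho>" "\<And>z. z \<in> ?B \<Longrightarrow> \<rho> z \<noteq> 0"
    using smooth_on_subset[OF smooth_\<rho>] \<rho>_nz by (auto simp: subset_iff image_iff)
  then obtain \<Sigma> \<Psi> where \<Sigma>: "smooth_on ?B \<Sigma>" "open (\<Sigma> ` ?B)" "smooth_on (\<Sigma> ` ?B) \<Psi>"
    "\<And>z. z \<in> ?B \<Longrightarrow> \<Psi> (\<Sigma> z) = z" "\<And>z. z \<in> ?B \<Longrightarrow> det (matrix (fderiv \<Sigma> z)) = \<rho> z"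
    using straighten_density by metis
  define P where "P = fst c \<inter> snd c -` ?B"
  have P_c: "P \<subseteq> fst c" by (auto simp: P_def)
  have P_U: "P \<subseteq> U"
  proof
    fix p assume p: "p \<in> P"
    then obtain q where q: "q \<in> U" "q \<in> fst c" "snd c p = snd c q" using r(2) by (auto simp: P_def)
    then have "p = q" using p inv P_c by (metis subsetD)
    then show "p \<in> U" using q by simp
  qed
  have image_P: "snd c ` P = ?B"
    using \<open>?B \<subseteq> snd c ` fst c\<close> unfolding P_def by blast
  define \<kappa> where "\<kappa> p = \<Sigma> (snd c p)" for p
  define \<iota> where "\<iota> y = chart_inv c (\<Psi> y)" for y
  have \<kappa>_P: "\<kappa> ` P = \<Sigma> ` ?B" unfolding image_P[symmetric] by (simp add: \<kappa>_def image_image)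
  have \<Psi>_B: "\<Psi> y \<in> ?B" if "y \<in> \<Sigma> ` ?B" for y using that \<Sigma>(4) by auto
  have open_P: "open P"
    unfolding P_def using ch
    by (intro continuous_open_preimage[OF chart_continuous(1)[OF ch]] open_ball) (simp add: is_chart_def)
  \<comment> \<open>Around \<open>x\<close> there are coordinates in which \<open>\<Omega>\<close> is the standard volume form.\<close>
  interpret adapted_coordinates A P \<kappa> \<iota>
  proof
    show "smooth_atlas A" "open P" "open (\<kappa> ` P)" using A open_P \<kappa>_P \<Sigma>(2) by auto
    show \<iota>_\<kappa>: "\<iota> (\<kappa> p) = p" if "p \<in> P" for p
      using that \<Sigma>(4) inv by (simp add: \<iota>_def \<kappa>_def P_def)
    show "continuous_on P \<kappa>"
      unfolding \<kappa>_def
      by (rule continuous_on_compose2[OF smooth_on_continuous[OF \<Sigma>(1)]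
            continuous_on_subset[OF chart_continuous(1)[OF ch] P_c]]) (simp add: image_P)
    show "continuous_on (\<kappa> ` P) \<iota>"
      unfolding \<iota>_def \<kappa>_P
      by (rule continuous_on_compose2[OF chart_continuous(2)[OF ch] smooth_on_continuous[OF \<Sigma>(3)]])
        (use \<Psi>_B \<open>?B \<subseteq> snd c ` fst c\<close> in blast)
  next
    fix d assume d: "d \<in> A"
    have chd: "is_chart d" using A d by (simp add: smooth_atlas_def)
    have tr: "smooth_on (snd d ` (fst d \<inter> fst c)) (snd c \<circ> chart_inv d)"
      "smooth_on (snd c ` (fst c \<inter> fst d)) (snd d \<circ> chart_inv c)"
      using A c d by (auto simp: smooth_atlas_def)
    have op: "open (snd d ` (P \<inter> fst d))" by (rule chart_image_open[OF chd open_P])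
    have "smooth_on (snd d ` (P \<inter> fst d)) (\<lambda>z. \<Sigma> ((snd c \<circ> chart_inv d) z))"
    proof (rule smooth_on_compose[OF op open_ball \<Sigma>(1) smooth_on_subset[OF tr(1)]])
      show "snd d ` (P \<inter> fst d) \<subseteq> snd d ` (fst d \<inter> fst c)" using P_c by blast
      show "(snd c \<circ> chart_inv d) ` (snd d ` (P \<inter> fst d)) \<subseteq> ?B"
        using chart_inv_chart[OF chd] image_P by auto
    qed
    then show "smooth_on (snd d ` (P \<inter> fst d)) (\<lambda>z. \<kappa> (chart_inv d z))" by (simp add: \<kappa>_def)
    have op_c: "open (snd c ` (P \<inter> fst d))"
    proof -
      have "open (P \<inter> fst d)" using open_P chd by (auto simp: is_chart_def)
      from chart_image_open[OF ch this] show ?thesis using P_c by (simp add: Int_absorb2 le_infI1)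
    qed
    have image: "\<kappa> ` (P \<inter> fst d) = \<Sigma> ` ?B \<inter> \<Psi> -` (snd c ` (P \<inter> fst d))" (is "?L = ?R")
    proof
      have B: "snd c p \<in> ?B" if "p \<in> P" for p using that by (simp add: P_def)
      show "?L \<subseteq> ?R" using \<Sigma>(4)[OF B] B by (auto simp: \<kappa>_def simp del: mem_ball)
      show "?R \<subseteq> ?L"
      proof
        fix y assume "y \<in> ?R"
        then obtain z p where "z \<in> ?B" "y = \<Sigma> z" "p \<in> P" "p \<in> fst d" "\<Psi> y = snd c p" by blast
        then show "y \<in> ?L" using \<Sigma>(4)[of z] by (auto simp: \<kappa>_def)
      qed
    qed
    have op_L: "open (\<kappa> ` (P \<inter> fst d))"
      unfolding image by (rule continuous_open_preimage[OF smooth_on_continuous[OF \<Sigma>(3)] \<Sigma>(2) op_c])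
    have "smooth_on (\<kappa> ` (P \<inter> fst d)) (\<lambda>y. (snd d \<circ> chart_inv c) (\<Psi> y))"
    proof (rule smooth_on_compose[OF op_L op_c smooth_on_subset[OF tr(2)] smooth_on_subset[OF \<Sigma>(3)]])
      show "snd c ` (P \<inter> fst d) \<subseteq> snd c ` (fst c \<inter> fst d)" using P_c by blast
    qed (auto simp: image)
    then show "smooth_on (\<kappa> ` (P \<inter> fst d)) (\<lambda>y. snd d (\<iota> y))" by (simp add: \<iota>_def)
  qed
  have x_P: "x \<in> P" using c r(1) by (simp add: P_def)
  \<comment> \<open>The flow from \<open>\<kappa> x\<close> to a point of the ball of radius \<open>\<epsilon>\<close> lives in radius \<open>2 \<epsilon>\<close>; radius \<open>3 \<epsilon>\<close> leaves
    room for the open set \<open>W\<close>.\<close>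
  obtain \<epsilon> where \<epsilon>: "0 < \<epsilon>" "cball (\<kappa> x) (3 * \<epsilon>) \<subseteq> \<kappa> ` P"
  proof -
    obtain e where "0 < e" "cball (\<kappa> x) e \<subseteq> \<kappa> ` P"
      using open_T x_P open_contains_cball by (metis imageI)
    then show thesis using that[of "e / 3"] by simp
  qed
  have sub: "ball (\<kappa> x) \<epsilon> \<subseteq> \<kappa> ` P" "cball (\<kappa> x) \<epsilon> \<subseteq> \<kappa> ` P" "cball (\<kappa> x) (2 * \<epsilon>) \<subseteq> \<kappa> ` P"
    "ball (\<kappa> x) (3 * \<epsilon>) \<subseteq> \<kappa> ` P"
    using \<epsilon> by (auto simp: subset_iff)
  define V where "V = \<iota> ` ball (\<kappa> x) \<epsilon>"
  define W where "W = \<iota> ` ball (\<kappa> x) (3 * \<epsilon>)"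
  have x_in: "x \<in> \<iota> ` ball (\<kappa> x) e" if "0 < e" for e
    using that x_P \<iota>_\<kappa>[OF x_P] by (intro image_eqI[of _ _ "\<kappa> x"]) auto
  have closure_image: "closure (\<iota> ` ball (\<kappa> x) e) \<subseteq> \<iota> ` cball (\<kappa> x) e" "compact (\<iota> ` cball (\<kappa> x) e)"
    if "cball (\<kappa> x) e \<subseteq> \<kappa> ` P" for e
  proof -
    show comp: "compact (\<iota> ` cball (\<kappa> x) e)" by (rule compact_\<iota>_image[OF that compact_cball])
    show "closure (\<iota> ` ball (\<kappa> x) e) \<subseteq> \<iota> ` cball (\<kappa> x) e"
      by (rule closure_minimal[OF image_mono[OF ball_subset_cball] compact_imp_closed[OF comp]])
  qed
  have "open V" "open W" unfolding V_def W_def by (intro open_\<iota>_image sub open_ball)+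
  moreover have "x \<in> V" "x \<in> W" unfolding V_def W_def using x_in \<epsilon>(1) by auto
  moreover have "closure V \<subseteq> W"
  proof -
    have "\<iota> ` cball (\<kappa> x) \<epsilon> \<subseteq> W" unfolding W_def using \<epsilon>(1) by (intro image_mono) auto
    then show ?thesis using closure_image(1)[OF sub(2)] by (simp add: V_def)
  qed
  moreover have "closure W \<subseteq> U"
  proof -
    have "\<iota> ` cball (\<kappa> x) (3 * \<epsilon>) \<subseteq> P" using \<epsilon>(2) \<kappa>_\<iota> by auto
    then show ?thesis using closure_image(1)[OF \<epsilon>(2)] P_U by (auto simp: W_def)
  qed
  moreover have "compact (closure W)"
    using compact_Int_closed[OF closure_image(2)[OF \<epsilon>(2)] closed_closure[of W]] closure_image(1)[OF \<epsilon>(2)]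
    by (simp add: W_def Int_absorb1)
  moreover have "\<exists>\<phi>. smooth_isotopy A \<phi> \<and> (\<forall>t\<in>{0..1}. \<phi> t \<in> automorphisms A k \<Omega>) \<and>
      \<phi> 0 = id \<and> \<phi> 1 x = y \<and> (\<forall>t\<in>{0..1}. \<forall>z. z \<notin> closure W \<longrightarrow> \<phi> t z = z)" if y: "y \<in> V" for y
  proof -
    obtain q where q: "q \<in> ball (\<kappa> x) \<epsilon>" "y = \<iota> q" using y by (auto simp: V_def)
    have "2 \<le> CARD('n)" using k k2 by simp
    then obtain \<Phi> :: "real \<Rightarrow> real ^ 'n \<Rightarrow> real ^ 'n" where \<Phi>:
      "smooth_on UNIV (\<lambda>(t, z). \<Phi> t z)" "\<And>z. \<Phi> 0 z = z" "\<And>s t z. \<Phi> s (\<Phi> t z) = \<Phi> (s + t) z"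
      "\<Phi> 1 (\<kappa> x) = q" "\<And>t z. z \<notin> cball (\<kappa> x) (2 * \<epsilon>) \<Longrightarrow> \<Phi> t z = z"
      "\<And>t z. det (matrix (fderiv (\<Phi> t) z)) = 1"
      using volume_preserving_flow[of "\<kappa> x" q \<epsilon>] q(1) by (auto simp only: mem_ball)
    note flow = \<Phi>(1-3) compact_cball sub(3) \<Phi>(5)
    have "transported \<Phi> t \<in> automorphisms A k \<Omega>" for t
    proof -
      have "pullback A A (transported \<Phi> t) \<Omega> p vs = \<Omega> p vs" if "vs \<in> tuples A p k" for p vs
      proof (rule transported_preserves_top_form[OF flow \<Phi>(6) c(1) P_c])
        show "smooth_on (snd c ` P) \<Sigma>" unfolding image_P by (rule \<Sigma>(1))
        show "det (matrix (fderiv \<Sigma> (snd c p))) = ?w (snd c p) std_basis_list" if "p \<in> P" for p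
          using that \<Sigma>(5)[of "snd c p"] by (simp add: \<rho>_def P_def)
      qed (use that k alt P_c in \<open>auto simp: \<kappa>_def\<close>)
      then show ?thesis using transported_diffeo[OF flow] by (auto simp: automorphisms_def)
    qed
    moreover have "transported \<Phi> 0 = id" using transported_0[OF flow] by auto
    moreover have "transported \<Phi> 1 x = y" using x_P q(2) \<Phi>(4) by (simp add: transported_def)
    moreover have "transported \<Phi> t z = z" if "z \<notin> closure W" for t z
    proof (rule transported_outside[OF flow])
      have "cball (\<kappa> x) (2 * \<epsilon>) \<subseteq> ball (\<kappa> x) (3 * \<epsilon>)" using \<epsilon>(1) by auto
      then show "z \<notin> \<iota> ` cball (\<kappa> x) (2 * \<epsilon>)" using that closure_subset[of W] unfolding W_def by blast
    qed
    ultimately show ?thesis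
      using transported_isotopy[OF flow] by (intro exI[of _ "transported \<Phi>"] conjI ballI allI impI)
  qed
  ultimately show "\<exists>V W. open V \<and> x \<in> V \<and> open W \<and> x \<in> W \<and>
      closure V \<subseteq> W \<and> closure W \<subseteq> U \<and> compact (closure W) \<and>
      (\<forall>y\<in>V. \<exists>\<phi>. smooth_isotopy A \<phi> \<and> (\<forall>t\<in>{0..1}. \<phi> t \<in> automorphisms A k \<Omega>) \<and>
        \<phi> 0 = id \<and> \<phi> 1 x = y \<and> (\<forall>t\<in>{0..1}. \<forall>z. z \<notin> closure W \<longrightarrow> \<phi> t z = z))"
    by (intro exI[of _ V] exI[of _ W] conjI ballI)
qed

end
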